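(* Let $\mathbf{T}=(T_t)_{t\ge0}$ be a strongly continuous semigroup with generator $A$ on a complex Banach space $X$, and let $\alpha>0$. Suppose $i\mathbb{Z}\subset\rho(A)$. Then the following conditions are equivalent: 1) $X_\alpha\subset\operatorname{Rg}(I-T_{2\pi})$; 2) the sum $(C,1)\sum_{k\in\mathbb{Z}}R(ik)x$ exists in the norm of $X$ for all $x\in X_\alpha$; 3) $\{R(ik)\}_{k\in\mathbb{Z}}$ is a multiplier from $L_p(\mathbb{T};X_\alpha)$ to $L_p(\mathbb{T};X)$ for some (equivalently, for all) $1\le p<\infty$; 4) $\{R(ik)\}_{k\in\mathbb{Z}}$ is a multiplier from $L_1(\mathbb{T};X_\alpha)$ to $F(\mathbb{T};X)$, where $F$ is some quasi-normed function lattice on $\mathbb{T}$; 5) there exists a constant $K>0$ such that $$\Big|\sum_{k\in\mathbb{Z}}\langle x^*,R(ik)x\rangle\,\Phi(k)\Big|\le K\|x\|_\alpha\|x^*\|\,\|\check\Phi\|_{L_1(\mathbb{T})}$$ for all $x\in X_\alpha$, $x^*\in X^*$, and all $\Phi=(\Phi(k))_{k\in\mathbb{Z}}$ such that $\check\Phi\in C^\infty(\mathbb{T})$.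
   Context: $R(\lambda)=(\lambda-A)^{-1}$, $\lambda\in\rho(A)$, is the resolvent of $A$; $\omega_0$ is the growth bound of $\mathbf{T}$; $\operatorname{Rg}$ denotes the range of an operator; $\mathbb{T}$ is the unit circle, identified with $[0,2\pi)$. Fractional powers: fix $\omega>\max\{\omega_0+3,3\}$ and put $A_\omega=A-\omega$. Let $\gamma$ be the upward-oriented path consisting of the rays $\{-1+te^{i\theta}:t\ge0\}$ and $\{-1+te^{-i\theta}:t\ge0\}$, where $0<\theta<\pi/6$ is small enough that $\|R(\mu+\omega)\|\le C/(1+|\mu|)$ in the sector bounded by $\gamma$. Set $A_\omega^{-\alpha}x=\frac1{2\pi i}\int_\gamma\mu^{-\alpha}R(\mu+\omega)x\,d\mu$ (branch cut of $\mu^{-\alpha}$ along $[0,\infty)$; up to a unimodular scalar this is the usual $(\omega-A)^{-\alpha}$), and let $A_\omega^\alpha$ be its inverse. $X_\alpha$ is the domain of $A_\omega^\alpha$ with norm $\|x\|_\alpha=\|A_\omega^\alpha x\|$. $(C,1)\sum_{k\in\mathbb{Z}}a_k=\lim_{N\to\infty}\frac1N\sum_{n=0}^{N-1}\sum_{|k|\le n}a_k$ (Ces\`aro sum). $\{R(ik)\}_{k\in\mathbb{Z}}$ is a multiplier from $L_p(\mathbb{T};X_\alpha)$ to a space $Z$ of $X$-valued functions on $\mathbb{T}$ if the map $f\mapsto\sum_kR(ik)\hat f(k)e^{ik\theta}$, defined on $X_\alpha$-valued trigonometric polynomials $f=\sum_k\hat f(k)e^{ik\theta}$, extends to a bounded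 operator from $L_p(\mathbb{T};X_\alpha)$ to $Z$. $F(\mathbb{T};X)$ is the space of strongly measurable $f:\mathbb{T}\to X$ with $\|f(\cdot)\|\in F$. For a sequence $\Phi$, $\check\Phi(\theta)=\sum_{k\in\mathbb{Z}}\Phi(k)e^{ik\theta}$. *)

theory Defs
  imports "HOL-Analysis.Analysis"
begin

section \<open>Complex Banach spaces\<close>

class complex_normed_vector = real_normed_vector +
  fixes scaleC :: "complex \<Rightarrow> 'a \<Rightarrow> 'a"  (infixr "*\<^sub>C" 75)
  assumes scaleC_add_right: "c *\<^sub>C (x + y) = c *\<^sub>C x + c *\<^sub>C y"
    and scaleC_add_left: "(c + d) *\<^sub>C x = c *\<^sub>C x + d *\<^sub>C x"
    and scaleC_scaleC: "c *\<^sub>C d *\<^sub>C x = (c * d) *\<^sub>C x"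
    and scaleC_of_real: "complex_of_real r *\<^sub>C x = r *\<^sub>R x"
    and norm_scaleC: "norm (c *\<^sub>C x) = cmod c * norm x"

class complex_banach = complex_normed_vector + banach

instantiation complex :: complex_banach
begin

definition scaleC_complex :: "complex \<Rightarrow> complex \<Rightarrow> complex"
  where "scaleC_complex c z = c * z"

instance
  by standard (simp_all add: scaleC_complex_def algebra_simps norm_mult scaleR_conv_of_real)

end

definition bounded_clinear :: "('a::complex_normed_vector \<Rightarrow> 'b::complex_normed_vector) \<Rightarrow> bool"
  where "bounded_clinear f \<longleftrightarrow> bounded_linear f \<and> (\<forall>c x. f (c *\<^sub>C x) = c *\<^sub>C f x)"

section \<open>Unbounded operators, resolvents and semigroups\<close>

text \<open>An operator is given by its domain and its action; the action is only relevant on the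
  domain.\<close>

type_synonym 'a operator = "'a set \<times> ('a \<Rightarrow> 'a)"

definition shift_op :: "complex \<Rightarrow> 'a::complex_normed_vector operator \<Rightarrow> 'a \<Rightarrow> 'a"
  where "shift_op l A = (\<lambda>x. l *\<^sub>C x - snd A x)"

definition resolvent :: "'a::complex_normed_vector operator \<Rightarrow> complex \<Rightarrow> 'a \<Rightarrow> 'a"
  where "resolvent A l = inv_into (fst A) (shift_op l A)"

definition resolvent_set :: "'a::complex_normed_vector operator \<Rightarrow> complex set"
  where "resolvent_set A =
    {l. bij_betw (shift_op l A) (fst A) UNIV \<and> bounded_clinear (resolvent A l)}"

definition C0_semigroup :: "(real \<Rightarrow> 'a::complex_normed_vector \<Rightarrow> 'a) \<Rightarrow> bool"
  where "C0_semigroup T \<longleftrightarrow>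
    (\<forall>t\<ge>0. bounded_clinear (T t)) \<and>
    (\<forall>x. T 0 x = x) \<and>
    (\<forall>s\<ge>0. \<forall>t\<ge>0. \<forall>x. T (s + t) x = T s (T t x)) \<and>
    (\<forall>x. ((\<lambda>t. T t x) \<longlongrightarrow> x) (at_right 0))"

definition generator :: "(real \<Rightarrow> 'a::complex_normed_vector \<Rightarrow> 'a) \<Rightarrow> 'a operator"
  where "generator T =
    ({x. \<exists>y. ((\<lambda>t. (T t x - x) /\<^sub>R t) \<longlongrightarrow> y) (at_right 0)},
     \<lambda>x. Lim (at_right 0) (\<lambda>t. (T t x - x) /\<^sub>R t))"

text \<open>Extended-real valued, since the growth bound may be \<open>-\<infinity>\<close>.\<close>

definition growth_bound :: "(real \<Rightarrow> 'a::complex_normed_vector \<Rightarrow> 'a) \<Rightarrow> ereal"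
  where "growth_bound T =
    Inf {ereal w | w. \<exists>M. \<forall>t\<ge>0. onorm (T t) \<le> M * exp (w * t)}"

section \<open>Fractional powers\<close>

definition sector :: "real \<Rightarrow> complex set"
  where "sector \<theta> = {- 1 + of_real r * cis \<phi> | r \<phi>. 0 \<le> r \<and> \<bar>\<phi>\<bar> \<le> \<theta>}"

definition admissible :: "'a::complex_normed_vector operator \<Rightarrow> real \<Rightarrow> real \<Rightarrow> bool"
  where "admissible A \<omega> \<theta> \<longleftrightarrow> 0 < \<theta> \<and> \<theta> < pi / 6 \<and>
    (\<exists>C. \<forall>\<mu>\<in>sector \<theta>. \<mu> + of_real \<omega> \<in> resolvent_set A \<and>
       onorm (resolvent A (\<mu> + of_real \<omega>)) \<le> C / (1 + cmod \<mu>))"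

text \<open>The branch of \<open>\<mu>\<close> to the power \<open>- \<alpha>\<close> cut along the nonnegative real axis:
  \<^const>\<open>Arg2pi\<close> takes values in \<open>[0, 2\<pi>)\<close>.\<close>

definition cpow_neg :: "real \<Rightarrow> complex \<Rightarrow> complex"
  where "cpow_neg \<alpha> \<mu> = exp (- of_real \<alpha> * (of_real (ln (cmod \<mu>)) + \<i> * of_real (Arg2pi \<mu>)))"

definition ray_integral :: "'a::complex_banach operator \<Rightarrow> real \<Rightarrow> real \<Rightarrow> real \<Rightarrow> 'a \<Rightarrow> 'a"
  where "ray_integral A \<omega> \<alpha> \<phi> x =
    integral {0..} (\<lambda>t. let \<mu> = - 1 + of_real t * cis \<phi> in
      (cpow_neg \<alpha> \<mu> * cis \<phi>) *\<^sub>C resolvent A (\<mu> + of_real \<omega>) x)"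

text \<open>The contour comes in from infinity along the ray of angle \<open>- \<theta>\<close> and leaves along the ray of
  angle \<open>\<theta>\<close>.\<close>

definition frac_neg_power ::
    "'a::complex_banach operator \<Rightarrow> real \<Rightarrow> real \<Rightarrow> real \<Rightarrow> 'a \<Rightarrow> 'a"
  where "frac_neg_power A \<omega> \<theta> \<alpha> x =
    (1 / (2 * of_real pi * \<i>)) *\<^sub>C (ray_integral A \<omega> \<alpha> \<theta> x - ray_integral A \<omega> \<alpha> (- \<theta>) x)"

definition frac_power ::
    "'a::complex_banach operator \<Rightarrow> real \<Rightarrow> real \<Rightarrow> real \<Rightarrow> 'a \<Rightarrow> 'a"
  where "frac_power A \<omega> \<theta> \<alpha> = inv (frac_neg_power A \<omega> \<theta> \<alpha>)"

definition X_space :: "'a::complex_banach operator \<Rightarrow> real \<Rightarrow> real \<Rightarrow> real \<Rightarrow> 'a set"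
  where "X_space A \<omega> \<theta> \<alpha> = range (frac_neg_power A \<omega> \<theta> \<alpha>)"

definition X_norm :: "'a::complex_banach operator \<Rightarrow> real \<Rightarrow> real \<Rightarrow> real \<Rightarrow> 'a \<Rightarrow> real"
  where "X_norm A \<omega> \<theta> \<alpha> x = norm (frac_power A \<omega> \<theta> \<alpha> x)"

section \<open>Cesaro sums\<close>

definition C1_summable :: "(int \<Rightarrow> 'a::real_normed_vector) \<Rightarrow> bool"
  where "C1_summable a \<longleftrightarrow>
    convergent (\<lambda>N::nat. (\<Sum>n<N. \<Sum>k\<in>{- int n..int n}. a k) /\<^sub>R real N)"

section \<open>Function spaces on the circle\<close>

abbreviation circle :: "real measure"
  where "circle \<equiv> lebesgue_on {0..<2 * pi}"

text \<open>In what follows a subspace \<open>V\<close> carries its own norm \<open>N\<close>, which need not be the restriction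
  of the ambient one. Functions on the circle are not identified almost everywhere, so equalities
  between them are stated almost everywhere. The library's Bochner integral and measurability
  require separable spaces, whence the direct definition of strong measurability.\<close>

definition strongly_measurable :: "'a::real_normed_vector set \<Rightarrow> ('a \<Rightarrow> real) \<Rightarrow> (real \<Rightarrow> 'a) \<Rightarrow> bool"
  where "strongly_measurable V N f \<longleftrightarrow>
    (\<forall>t\<in>space circle. f t \<in> V) \<and>
    (\<exists>s :: nat \<Rightarrow> real \<Rightarrow> 'a.
      (\<forall>n. simple_function circle (s n) \<and> (\<forall>t\<in>space circle. s n t \<in> V)) \<and>
      (AE t in circle. (\<lambda>n. N (s n t - f t)) \<longlonglongrightarrow> 0))"

definition Lp_space ::
    "'a::real_normed_vector set \<Rightarrow> ('a \<Rightarrow> real) \<Rightarrow> real \<Rightarrow> (real \<Rightarrow> 'a) set"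
  where "Lp_space V N p =
    {f. strongly_measurable V N f \<and> integrable circle (\<lambda>t. N (f t) powr p)}"

definition Lp_norm :: "('a \<Rightarrow> real) \<Rightarrow> real \<Rightarrow> (real \<Rightarrow> 'a) \<Rightarrow> real"
  where "Lp_norm N p f = (\<integral>t. N (f t) powr p \<partial>circle) powr (1 / p)"

definition quasi_normed_function_lattice :: "(real \<Rightarrow> real) set \<Rightarrow> ((real \<Rightarrow> real) \<Rightarrow> real) \<Rightarrow> bool"
  where "quasi_normed_function_lattice F q \<longleftrightarrow>
    F \<subseteq> borel_measurable circle \<and>
    (\<lambda>t. 0) \<in> F \<and>
    (\<forall>f\<in>F. \<forall>g\<in>F. (\<lambda>t. f t + g t) \<in> F) \<and>
    (\<forall>c. \<forall>f\<in>F. (\<lambda>t. c * f t) \<in> F) \<and>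
    (\<forall>f\<in>F. \<forall>g\<in>borel_measurable circle.
      (AE t in circle. \<bar>g t\<bar> \<le> \<bar>f t\<bar>) \<longrightarrow> g \<in> F \<and> q g \<le> q f) \<and>
    (\<forall>f\<in>F. 0 \<le> q f \<and> (q f = 0 \<longleftrightarrow> (AE t in circle. f t = 0))) \<and>
    (\<forall>c. \<forall>f\<in>F. q (\<lambda>t. c * f t) = \<bar>c\<bar> * q f) \<and>
    (\<exists>K. \<forall>f\<in>F. \<forall>g\<in>F. q (\<lambda>t. f t + g t) \<le> K * (q f + q g))"

definition lattice_space :: "(real \<Rightarrow> real) set \<Rightarrow> (real \<Rightarrow> 'a::real_normed_vector) set"
  where "lattice_space F = {f. strongly_measurable UNIV norm f \<and> (\<lambda>t. norm (f t)) \<in> F}"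

definition lattice_norm ::
    "((real \<Rightarrow> real) \<Rightarrow> real) \<Rightarrow> (real \<Rightarrow> 'a::real_normed_vector) \<Rightarrow> real"
  where "lattice_norm q f = q (\<lambda>t. norm (f t))"

section \<open>Fourier multipliers\<close>

definition trig_poly :: "int set \<Rightarrow> (int \<Rightarrow> 'a::complex_normed_vector) \<Rightarrow> real \<Rightarrow> 'a"
  where "trig_poly S c t = (\<Sum>k\<in>S. cis (of_int k * t) *\<^sub>C c k)"

text \<open>The map induced by \<open>m\<close> on \<open>V\<close>-valued trigonometric polynomials extends to a bounded linear
  operator \<open>U\<close> from the \<open>Lp\<close> space over \<open>V\<close> (normed by \<open>N\<close>) to the space \<open>Z\<close> (normed by \<open>NZ\<close>).\<close>

definition multiplier ::
    "(int \<Rightarrow> 'a::complex_normed_vector \<Rightarrow> 'a) \<Rightarrow> 'a set \<Rightarrow> ('a \<Rightarrow> real) \<Rightarrow> real \<Rightarrow>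
     (real \<Rightarrow> 'a) set \<Rightarrow> ((real \<Rightarrow> 'a) \<Rightarrow> real) \<Rightarrow> bool"
  where "multiplier m V N p Z NZ \<longleftrightarrow>
    (\<exists>U :: (real \<Rightarrow> 'a) \<Rightarrow> (real \<Rightarrow> 'a).
      (\<forall>f\<in>Lp_space V N p. U f \<in> Z) \<and>
      (\<exists>C. \<forall>f\<in>Lp_space V N p. NZ (U f) \<le> C * Lp_norm N p f) \<and>
      (\<forall>f\<in>Lp_space V N p. \<forall>g\<in>Lp_space V N p.
        AE t in circle. U (\<lambda>s. f s + g s) t = U f t + U g t) \<and>
      (\<forall>c. \<forall>f\<in>Lp_space V N p. AE t in circle. U (\<lambda>s. c *\<^sub>C f s) t = c *\<^sub>C U f t) \<and>
      (\<forall>S c. finite S \<and> (\<forall>k\<in>S. c k \<in> V) \<longrightarrow>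
        (AE t in circle. U (trig_poly S c) t = trig_poly S (\<lambda>k. m k (c k)) t)))"

section \<open>Sequences with smooth inverse Fourier transform\<close>

definition smooth :: "(real \<Rightarrow> 'a::real_normed_vector) \<Rightarrow> bool"
  where "smooth f \<longleftrightarrow>
    (\<exists>D :: nat \<Rightarrow> real \<Rightarrow> 'a. D 0 = f \<and>
      (\<forall>n t. (D n has_vector_derivative D (Suc n) t) (at t)))"

definition check_transform :: "(int \<Rightarrow> complex) \<Rightarrow> real \<Rightarrow> complex"
  where "check_transform \<Phi> t = (\<Sum>\<^sub>\<infinity>k\<in>UNIV. \<Phi> k * cis (of_int k * t))"

text \<open>Smoothness on the circle is smoothness on the real line, as the transform is
  \<open>2\<pi>\<close>-periodic. Summability is required separately, as \<^const>\<open>infsum\<close> is \<open>0\<close> on families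
  that are not summable.\<close>

definition smooth_check :: "(int \<Rightarrow> complex) \<Rightarrow> bool"
  where "smooth_check \<Phi> \<longleftrightarrow>
    (\<forall>t. (\<lambda>k. \<Phi> k * cis (of_int k * t)) summable_on UNIV) \<and> smooth (check_transform \<Phi>)"

end

theory Submission
  imports Defs "HOL-Complex_Analysis.Complex_Analysis"
begin

text \<open>Write \<open>P = I - T\<^sub>2\<^sub>\<pi>\<close>, \<open>R k\<close> for the resolvent at \<open>i k\<close> and \<open>J\<close> for the negative fractional power
  of the generator. Since \<open>R k (P x)\<close> is the \<open>k\<close>-th Fourier coefficient of the orbit of \<open>x\<close> over \<open>[0, 2 \<pi>]\<close>,
  Fejer's theorem at the jump of the periodized orbit shows that the Cesaro sums of \<open>R k (P x)\<close>
  converge to \<open>\<pi> (x + T\<^sub>2\<^sub>\<pi> x)\<close>. Hence \<open>P\<close> is injective, and if its range contains that of \<open>J\<close>, then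
  \<open>S = P\<^sup>-\<^sup>1 J\<close> is bounded; \<open>R k J\<close> is then the Fourier transform of the bounded function \<open>T\<^sub>t S\<close>, and all
  other conditions follow by convolution. Conversely, applying \<open>P\<close> to the Cesaro sums of \<open>R k J x\<close> gives
  \<open>\<pi> (J x + T\<^sub>2\<^sub>\<pi> J x)\<close>, which together with \<open>P J x\<close> spans \<open>J x\<close>. The weak condition, tested on the
  Fejer kernel, bounds the Cesaro means, which converge on the dense range of \<open>P\<close>. A multiplier into a
  lattice is applied to the continuous function \<open>(1 - cos s) T\<^sub>s x\<close>: its image converges at some point,
  and \<open>P\<close> maps the limit to a combination of \<open>T\<^sub>s J x\<close> and \<open>P T\<^sub>s J x\<close>, which puts \<open>J x\<close> in the range
  of \<open>P\<close>. The norm of the fractional domain makes sense because \<open>J\<close> is injective; this is a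
  uniqueness property of the Cauchy integral along the contour.\<close>

section \<open>Complex scalar multiplication\<close>

text \<open>Since \<open>T\<close> is bounded on \<open>[0, 2 pi]\<close>, convolution with
  \<open>T t S\<close> maps integrable functions to bounded ones, so one estimate serves every
  exponent. Conversely, each \<open>L_p\<close> is itself a quasi-normed lattice, so conditions 3
  and 4 return to condition 1 by the same argument. Its obstacle is that a quasi-normed lattice
  offers only the ideal property and a triangle inequality with a constant \<open>K\<close>, neither
  completeness nor a Fatou property, so no limit can be formed inside it. The approximations are
  therefore made so fast that the sets where consecutive images differ noticeably shrink faster than
  repeated use of \<open>K\<close> can enlarge them. This gives convergence at one point
  \<open>s\<close>, and one point is enough because the semigroup carries the conclusion from time
  \<open>s\<close> on to a full period. The factor \<open>1 - cos s\<close> closes up the orbit,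
  which is not periodic, so that trigonometric polynomials approximate it uniformly; its mean value
  1 keeps the final coefficient nonzero. In the injectivity of \<open>J\<close>, the Cauchy
  integrals are controlled only away from the contour; near it the resolvent estimate takes
  over.\<close>

interpretation scaleC: bounded_bilinear "scaleC :: complex \<Rightarrow> 'a::complex_normed_vector \<Rightarrow> 'a"
proof
  fix a a' :: complex and b b' :: 'a and r :: real
  show "(a + a') *\<^sub>C b = a *\<^sub>C b + a' *\<^sub>C b" "a *\<^sub>C (b + b') = a *\<^sub>C b + a *\<^sub>C b'"
    by (simp_all add: scaleC_add_left scaleC_add_right)
  show "(r *\<^sub>R a) *\<^sub>C b = r *\<^sub>R a *\<^sub>C b"
    by (simp add: scaleC_scaleC scaleR_conv_of_real flip: scaleC_of_real)
  show "a *\<^sub>C r *\<^sub>R b = r *\<^sub>R a *\<^sub>C b"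
    by (simp add: scaleC_scaleC mult.commute flip: scaleC_of_real)
  show "\<exists>K. \<forall>(a::complex) (b::'a). norm (a *\<^sub>C b) \<le> norm a * norm b * K"
    by (intro exI[of _ 1]) (simp add: norm_scaleC)
qed

lemma scaleC_one [simp]: "1 *\<^sub>C x = (x :: 'a::complex_normed_vector)"
  using scaleC_of_real[of 1 x] by simp

lemmas [simp] = scaleC.zero_left scaleC.zero_right

declare scaleC.continuous_on [continuous_intros]

section \<open>The Fejer kernel\<close>

lemma sum_symmetric_Suc:
  fixes f :: "int \<Rightarrow> 'a::comm_monoid_add"
  shows "(\<Sum>k\<in>{- int (Suc n)..int (Suc n)}. f k)
    = (\<Sum>k\<in>{- int n..int n}. f k) + (f (int (Suc n)) + f (- int (Suc n)))"
proof -
  have "{- int (Suc n)..int (Suc n)} = insert (int (Suc n)) (insert (- int (Suc n)) {- int n..int n})"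
    by auto
  then show ?thesis
    by (simp add: add_ac)
qed

text \<open>The average of the Dirichlet kernels, normalised to total mass \<open>2 * pi\<close>
  instead of 1. Division by zero makes it vanish for \<open>N = 0\<close>, so \<open>N > 0\<close>
  reappears wherever the mass is used.\<close>

definition fejer :: "nat \<Rightarrow> real \<Rightarrow> real"
  where "fejer N t = (\<Sum>n<N. \<Sum>k\<in>{- int n..int n}. cos (of_int k * t)) / real N"

lemma sum_cis_symmetric:
  "(\<Sum>k\<in>{- int n..int n}. cis (of_int k * t)) = of_real (\<Sum>k\<in>{- int n..int n}. cos (of_int k * t))"
proof -
  have "(\<Sum>k\<in>{- int n..int n}. sin (of_int k * t)) = 0"
    by (induction n) (simp_all add: sum_symmetric_Suc del: of_nat_Suc)
  then show ?thesis by (simp add: complex_eq_iff)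
qed

text \<open>The closed form of the Dirichlet kernel, multiplied out so that it also holds where
  \<open>sin (t / 2)\<close> vanishes.\<close>

lemma sin_half_mult_dirichlet:
  "sin (t / 2) * (\<Sum>k\<in>{- int n..int n}. cos (of_int k * t)) = sin ((real n + 1 / 2) * t)"
proof (induction n)
  case 0
  then show ?case by simp
next
  case (Suc n)
  have "2 * (sin (t / 2) * cos ((real n + 1) * t))
      = sin ((real n + 3 / 2) * t) - sin ((real n + 1 / 2) * t)"
    using sin_times_cos[of "t / 2" "(real n + 1) * t"] sin_minus[of "(real n + 1/2) * t"]
    by (simp add: algebra_simps)
  moreover have "of_int (int (Suc n)) * t = (real n + 1) * t" "of_int (- int (Suc n)) * t = - ((real n + 1) * t)"
    by (simp_all add: algebra_simps)
  then have "(\<Sum>k\<in>{- int (Suc n)..int (Suc n)}. cos (of_int k * t))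
      = (\<Sum>k\<in>{- int n..int n}. cos (of_int k * t)) + 2 * cos ((real n + 1) * t)"
    by (simp only: sum_symmetric_Suc cos_minus)
  ultimately show ?case
    using Suc by (simp only: distrib_left) (simp add: algebra_simps)
qed

text \<open>The identity \<open>sin a ^ 2 - sin b ^ 2 = sin (a - b) * sin (a + b)\<close> turns each
  Dirichlet kernel, multiplied by the square of \<open>sin (t / 2)\<close>, into an increment of
  \<open>sin (n * t / 2) ^ 2\<close>, and the sum telescopes.\<close>

lemma sin_half_mult_fejer:
  "(sin (t / 2))\<^sup>2 * (\<Sum>n<N. \<Sum>k\<in>{- int n..int n}. cos (of_int k * t)) = (sin (real N * t / 2))\<^sup>2"
proof (induction N)
  case 0
  then show ?case by simp
next
  case (Suc n)
  have 1: "(sin (real (Suc n) * t / 2))\<^sup>2 - (sin (real n * t / 2))\<^sup>2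
      = sin (t / 2) * sin ((real n + 1 / 2) * t)"
  proof -
    define a b where "a = real (Suc n) * t / 2" and "b = real n * t / 2"
    have ab: "t / 2 = a - b" "(real n + 1/2) * t = a + b"
      by (simp_all add: a_def b_def field_simps)
    have "(sin a)\<^sup>2 - (sin b)\<^sup>2 = sin (a - b) * sin (a + b)"
    proof -
      have "sin (a - b) * sin (a + b) = (sin a)\<^sup>2 * (cos b)\<^sup>2 - (cos a)\<^sup>2 * (sin b)\<^sup>2"
        by (simp add: sin_add sin_diff algebra_simps power2_eq_square)
      also have "\<dots> = (sin a)\<^sup>2 - (sin b)\<^sup>2"
        by (simp add: cos_squared_eq algebra_simps)
      finally show ?thesis by simp
    qed
    then show ?thesis by (simp only: ab flip: a_def b_def)
  qed
  have "(sin (t / 2))\<^sup>2 * (\<Sum>k\<in>{- int n..int n}. cos (of_int k * t)) =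
     sin (t / 2) * sin ((real n + 1 / 2) * t)"
    using sin_half_mult_dirichlet[of t n] by (simp add: power2_eq_square)
  with Suc 1 show ?case by (simp add: distrib_left)
qed

text \<open>The closed form decides the sign except where \<open>sin (t / 2) = 0\<close>; there
  \<open>t\<close> is a multiple of \<open>2 * pi\<close> and every cosine is 1.\<close>

lemma fejer_nonneg: "0 \<le> fejer N t"
proof (cases "sin (t / 2) = 0")
  case True
  then obtain m :: int where m: "t / 2 = of_int m * pi"
    by (auto simp: sin_zero_iff_int2)
  then have "cos (of_int k * t) = 1" for k :: int
  proof -
    have "of_int k * t = 2 * pi * of_int (k * m)"
      using m by (simp add: field_simps)
    then show ?thesis by (simp only: cos_int_2pin)
  qed
  then show ?thesis
    by (simp add: fejer_def sum_nonneg)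
next
  case False
  have "0 \<le> (sin (t / 2))\<^sup>2 * (\<Sum>n<N. \<Sum>k\<in>{- int n..int n}. cos (of_int k * t))"
    unfolding sin_half_mult_fejer by (rule zero_le_power2)
  moreover have "0 < (sin (t / 2))\<^sup>2" using False by simp
  ultimately have "0 \<le> (\<Sum>n<N. \<Sum>k\<in>{- int n..int n}. cos (of_int k * t))"
    by (simp only: zero_le_mult_iff) auto
  then show ?thesis by (simp add: fejer_def)
qed

lemma fejer_le:
  assumes "sin (t / 2) \<noteq> 0"
  shows "fejer N t \<le> 1 / (real N * (sin (t / 2))\<^sup>2)"
proof (cases "N = 0")
  case False
  have "(sin (t / 2))\<^sup>2 * (real N * fejer N t) = (sin (real N * t / 2))\<^sup>2"
    using sin_half_mult_fejer[of t N] False by (simp add: fejer_def)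
  also have "\<dots> \<le> 1" by (simp add: abs_square_le_1)
  finally show ?thesis
    using False assms by (simp add: field_simps)
qed (simp add: fejer_def)

lemma continuous_on_fejer [continuous_intros]:
  fixes f :: "real \<Rightarrow> real"
  assumes "continuous_on A f"
  shows "continuous_on A (\<lambda>x. fejer N (f x))"
  unfolding fejer_def divide_inverse by (intro continuous_intros assms)

lemma has_integral_cos_shift:
  fixes k :: int
  shows "((\<lambda>t. cos (of_int k * (s - t))) has_integral (if k = 0 then 2 * pi else 0)) {0..2 * pi}"
proof (cases "k = 0")
  case True
  then show ?thesis
    using has_integral_const_real[of "1::real" 0 "2 * pi"] by simp
next
  case False
  have "((\<lambda>t. cos (of_int k * (s - t))) has_integral
      (- sin (of_int k * (s - 2 * pi)) / of_int k - - sin (of_int k * (s - 0)) / of_int k)) {0..2 * pi}"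
    by (rule fundamental_theorem_of_calculus)
      (auto intro!: derivative_eq_intros simp: False simp flip: has_real_derivative_iff_has_vector_derivative)
  moreover have "sin (of_int k * (s - 2 * pi)) = sin (of_int k * s)"
  proof -
    have "of_int k * (s - 2 * pi) = of_int k * s - 2 * pi * of_int k"
      by (simp add: algebra_simps)
    then show ?thesis by (simp only: sin_diff sin_int_2pin cos_int_2pin mult_zero_right mult_1_right diff_zero)
  qed
  ultimately show ?thesis using False by simp
qed

lemma has_integral_fejer:
  assumes "N > 0"
  shows "((\<lambda>t. fejer N (s - t)) has_integral (2 * pi)) {0..2 * pi}"
proof -
  have "((\<lambda>t. (\<Sum>n<N. \<Sum>k\<in>{- int n..int n}. cos (of_int k * (s - t))) / real N) has_integral
     ((\<Sum>n<N. \<Sum>k\<in>{- int n..int n}. if k = 0 then 2 * pi else 0) / real N)) {0..2 * pi}"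
    by (intro has_integral_divide has_integral_sum has_integral_cos_shift) auto
  moreover have "(\<Sum>n<N. \<Sum>k\<in>{- int n..int n}. if k = 0 then 2 * pi else 0) / real N = 2 * pi"
    using assms by simp
  ultimately show ?thesis by (simp add: fejer_def)
qed

text \<open>Under \<open>t\<close> to \<open>2 * pi - t\<close> the kernel is even and
  \<open>t - pi\<close> is odd. Hence a linear function that carries a jump can be subtracted
  without changing the integral against the kernel, as in \<open>fejer_jump\<close>.\<close>

lemma has_integral_fejer_centred: "((\<lambda>t. fejer N (- t) * (t - pi)) has_integral 0) {0..2 * pi}"
proof -
  have "((\<lambda>t. cos (of_int k * (- t)) * (t - pi)) has_integral 0) {0..2 * pi}" for k :: int
  proof (cases "k = 0")
    case True
    have "((\<lambda>t. t - pi) has_integral ((2 * pi - pi)\<^sup>2 / 2 - (0 - pi)\<^sup>2 / 2)) {0..2 * pi}"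
      by (rule fundamental_theorem_of_calculus)
        (auto intro!: derivative_eq_intros simp flip: has_real_derivative_iff_has_vector_derivative)
    with True show ?thesis by simp
  next
    case False
    let ?F = "\<lambda>t. (t - pi) * sin (of_int k * t) / of_int k + cos (of_int k * t) / (of_int k)\<^sup>2"
    have "((\<lambda>t. cos (of_int k * (- t)) * (t - pi)) has_integral (?F (2 * pi) - ?F 0)) {0..2 * pi}"
      by (rule fundamental_theorem_of_calculus)
        (auto intro!: derivative_eq_intros simp: False field_simps power2_eq_square
          simp flip: has_real_derivative_iff_has_vector_derivative)
    moreover have "?F (2 * pi) = ?F 0"
      using sin_int_2pin[of k] cos_int_2pin[of k] by (simp add: mult_ac)
    ultimately show ?thesis by simp
  qed
  then have "((\<lambda>t. (\<Sum>n<N. \<Sum>k\<in>{- int n..int n}. cos (of_int k * (- t)) * (t - pi)) / real N)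
      has_integral ((\<Sum>n<N. \<Sum>k\<in>{- int n..int n}. 0) / real N)) {0..2 * pi}"
    by (intro has_integral_divide has_integral_sum) auto
  then show ?thesis by (simp add: fejer_def sum_distrib_right)
qed

section \<open>Fejer's theorem\<close>

text \<open>Uniformity in \<open>s\<close> is what later yields uniform approximation by
  trigonometric polynomials. The condition on the end values enters when \<open>s\<close> and
  \<open>t\<close> lie near opposite ends of the interval, which are neighbours on the
  circle.\<close>

lemma fejer_uniform:
  fixes h :: "real \<Rightarrow> 'a::banach"
  assumes cont: "continuous_on {0..2 * pi} h" and per: "h 0 = h (2 * pi)" and e: "e > 0"
  shows "\<exists>N0. \<forall>N\<ge>N0. \<forall>s\<in>{0..2 * pi}.
    norm (integral {0..2 * pi} (\<lambda>t. fejer N (s - t) *\<^sub>R h t) - (2 * pi) *\<^sub>R h s) \<le> e"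
proof -
  \<comment> \<open>The near part contributes at most \<open>2 * pi * (2 * e') = e / 2\<close>; the
    inner factor 2 pays for crossing the point where the ends are glued.\<close>
  define e' where "e' = e / (8 * pi)"
  have e': "e' > 0" using e by (simp add: e'_def)
  have "uniformly_continuous_on {0..2 * pi} h"
    by (intro compact_uniformly_continuous cont) auto
  then obtain d0 where d0: "d0 > 0"
    "\<And>s t. s \<in> {0..2 * pi} \<Longrightarrow> t \<in> {0..2 * pi} \<Longrightarrow> dist s t < d0 \<Longrightarrow> dist (h s) (h t) < e'"
    using e' unfolding uniformly_continuous_on_def by metis
  \<comment> \<open>The cap \<open>pi\<close> keeps \<open>d / 2\<close> in the range where the sine
    increases, so that \<open>\<sigma>\<close> below bounds the square of
    \<open>sin ((s - t) / 2)\<close> from below on the far part.\<close>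
  define d where "d = min d0 pi"
  have d: "d > 0" "d \<le> pi" "d \<le> d0" using d0(1) by (auto simp: d_def)
  obtain B0 where B0: "\<And>t. t \<in> {0..2 * pi} \<Longrightarrow> norm (h t) \<le> B0"
    using compact_imp_bounded[OF compact_continuous_image[OF cont compact_Icc]]
    unfolding bounded_iff by blast
  have B0nn: "B0 \<ge> 0" using B0[of 0] norm_ge_zero[of "h 0"] by (simp del: norm_ge_zero)
  define \<sigma> where "\<sigma> = (sin (d / 2))\<^sup>2"
  have \<sigma>: "\<sigma> > 0" using sin_gt_zero[of "d / 2"] d pi_gt_zero by (simp add: \<sigma>_def del: pi_gt_zero)
  \<comment> \<open>Makes the far part, at most \<open>2 * B0 / (N * \<sigma>)\<close> over length
    \<open>2 * pi\<close>, at most \<open>e / 2\<close>; the summand 1 forces \<open>N > 0\<close>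
    even if \<open>B0 = 0\<close>.\<close>
  obtain N0 :: nat where N0: "real N0 > 8 * pi * B0 / (e * \<sigma>) + 1"
    using reals_Archimedean2 by blast
  have near: "norm (h t - h s) \<le> 2 * e'"
    if "s \<in> {0..2 * pi}" "t \<in> {0..2 * pi}" "\<bar>s - t\<bar> < d \<or> \<bar>s - t\<bar> > 2 * pi - d" for s t
  proof (cases "\<bar>s - t\<bar> < d")
    case True
    then have "norm (h t - h s) < e'"
      using d0(2)[of t s] that d by (simp add: dist_norm abs_minus_commute)
    then show ?thesis using e' by simp
  next
    case False
    then have *: "\<bar>s - t\<bar> > 2 * pi - d" using that by simp
    have "norm (h t - h s) < e' + e'"
    proof (cases "s \<le> t")
      case True
      have "norm (h s - h 0) < e'" "norm (h t - h (2 * pi)) < e'"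
        using * True that d d0(2)[of s 0] d0(2)[of t "2 * pi"] by (auto simp: dist_norm)
      then show ?thesis using per norm_triangle_ineq4[of "h t - h (2*pi)" "h s - h 0"] by simp
    next
      case False
      have "norm (h t - h 0) < e'" "norm (h s - h (2 * pi)) < e'"
        using * False that d d0(2)[of t 0] d0(2)[of s "2 * pi"] by (auto simp: dist_norm)
      then show ?thesis using per norm_triangle_ineq4[of "h t - h 0" "h s - h (2*pi)"] by simp
    qed
    then show ?thesis by simp
  qed
  have far: "fejer N (s - t) \<le> 1 / (real N * \<sigma>)"
    if "d \<le> \<bar>s - t\<bar>" "\<bar>s - t\<bar> \<le> 2 * pi - d" "N > 0" for s t N
  proof -
    define u where "u = \<bar>s - t\<bar> / 2"
    have u: "d / 2 \<le> u" "u \<le> pi - d / 2" using that by (auto simp: u_def)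
    have "sin (d / 2) \<le> sin u"
    proof (cases "u \<le> pi / 2")
      case True
      then show ?thesis using u d by (intro sin_monotone_2pi_le) auto
    next
      case False
      then have "sin (d / 2) \<le> sin (pi - u)" using u d by (intro sin_monotone_2pi_le) auto
      then show ?thesis by simp
    qed
    moreover have "sin (d / 2) > 0" using sin_gt_zero[of "d / 2"] d pi_gt_zero by linarith
    ultimately have "\<sigma> \<le> (sin u)\<^sup>2"
      unfolding \<sigma>_def by (intro power_mono) auto
    moreover have "(sin u)\<^sup>2 = (sin ((s - t) / 2))\<^sup>2"
    proof (cases "s \<ge> t")
      case True
      then show ?thesis by (simp add: u_def)
    next
      case False
      then have "u = - ((s - t) / 2)" by (simp add: u_def abs_of_neg minus_divide_left)
      then show ?thesis by (simp only: sin_minus power2_minus)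
    qed
    ultimately have *: "\<sigma> \<le> (sin ((s - t) / 2))\<^sup>2" by simp
    then have "fejer N (s - t) \<le> 1 / (real N * (sin ((s - t) / 2))\<^sup>2)"
      using \<sigma> by (intro fejer_le) auto
    also have "\<dots> \<le> 1 / (real N * \<sigma>)"
      using * \<sigma> that by (intro divide_left_mono mult_left_mono mult_pos_pos) auto
    finally show ?thesis .
  qed
  have main: "norm (integral {0..2 * pi} (\<lambda>t. fejer N (s - t) *\<^sub>R h t) - (2 * pi) *\<^sub>R h s) \<le> e"
    if N: "N \<ge> N0" and s: "s \<in> {0..2 * pi}" for N s
  proof -
    have Npos: "N > 0"
      using N N0 B0nn e \<sigma> by (smt (verit) divide_nonneg_pos mult_nonneg_nonneg mult_pos_pos
          of_nat_0_less_iff of_nat_le_iff pi_ge_zero)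
    have i1: "(\<lambda>t. fejer N (s - t) *\<^sub>R h t) integrable_on {0..2 * pi}"
      by (intro integrable_continuous_interval continuous_intros cont)
    have i2: "((\<lambda>t. fejer N (s - t) *\<^sub>R h s) has_integral (2 * pi) *\<^sub>R h s) {0..2 * pi}"
      by (intro has_integral_scaleR_left has_integral_fejer Npos)
    have "integral {0..2 * pi} (\<lambda>t. fejer N (s - t) *\<^sub>R h t) - (2 * pi) *\<^sub>R h s
       = integral {0..2 * pi} (\<lambda>t. fejer N (s - t) *\<^sub>R h t - fejer N (s - t) *\<^sub>R h s)"
      using i1 i2 by (subst Henstock_Kurzweil_Integration.integral_diff) (auto simp: integral_unique)
    also have "norm \<dots> \<le> integral {0..2 * pi} (\<lambda>t. fejer N (s - t) * (2 * e') + 2 * B0 / (real N * \<sigma>))"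
    proof (rule integral_norm_bound_integral)
      show "(\<lambda>t. fejer N (s - t) *\<^sub>R h t - fejer N (s - t) *\<^sub>R h s) integrable_on {0..2 * pi}"
        using i1 i2 by (auto intro: integrable_diff)
      show "(\<lambda>t. fejer N (s - t) * (2 * e') + 2 * B0 / (real N * \<sigma>)) integrable_on {0..2 * pi}"
        by (intro integrable_continuous_interval continuous_intros)
      fix t assume t: "t \<in> {0..2 * pi}"
      have nn: "fejer N (s - t) \<ge> 0" by (rule fejer_nonneg)
      have "norm (fejer N (s - t) *\<^sub>R h t - fejer N (s - t) *\<^sub>R h s) = fejer N (s - t) * norm (h t - h s)"
        using nn by (simp flip: scaleR_diff_right)
      also have "\<dots> \<le> fejer N (s - t) * (2 * e') + 2 * B0 / (real N * \<sigma>)"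
      proof (cases "\<bar>s - t\<bar> < d \<or> \<bar>s - t\<bar> > 2 * pi - d")
        case True
        have "fejer N (s - t) * norm (h t - h s) \<le> fejer N (s - t) * (2 * e')"
          using near[OF s t True] nn by (intro mult_left_mono)
        moreover have "0 \<le> 2 * B0 / (real N * \<sigma>)" using B0nn \<sigma> by simp
        ultimately show ?thesis by linarith
      next
        case False
        have "norm (h t - h s) \<le> 2 * B0"
          using B0[OF s] B0[OF t] norm_triangle_ineq4[of "h t" "h s"] by linarith
        then have "fejer N (s - t) * norm (h t - h s) \<le> (1 / (real N * \<sigma>)) * (2 * B0)"
          using far[of s t N] False Npos B0nn nn \<sigma> by (intro mult_mono) auto
        also have "\<dots> = 2 * B0 / (real N * \<sigma>)" by simp
        finally have "fejer N (s - t) * norm (h t - h s) \<le> 2 * B0 / (real N * \<sigma>)" .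
        moreover have "0 \<le> fejer N (s - t) * (2 * e')" using nn e' by simp
        ultimately show ?thesis by linarith
      qed
      finally show "norm (fejer N (s - t) *\<^sub>R h t - fejer N (s - t) *\<^sub>R h s)
          \<le> fejer N (s - t) * (2 * e') + 2 * B0 / (real N * \<sigma>)" .
    qed
    also have "\<dots> = 2 * pi * (2 * e') + 2 * B0 / (real N * \<sigma>) * (2 * pi)"
    proof (rule integral_unique)
      show "((\<lambda>t. fejer N (s - t) * (2 * e') + 2 * B0 / (real N * \<sigma>)) has_integral
          2 * pi * (2 * e') + 2 * B0 / (real N * \<sigma>) * (2 * pi)) {0..2 * pi}"
        using has_integral_const_real[of "2 * B0 / (real N * \<sigma>)" 0 "2 * pi"]
        by (intro has_integral_add has_integral_mult_left has_integral_fejer Npos) (simp add: mult.commute)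
    qed
    also have "\<dots> \<le> e / 2 + e / 2"
    proof (rule add_mono)
      show "2 * pi * (2 * e') \<le> e / 2" by (simp add: e'_def field_simps)
      have "8 * pi * B0 / (e * \<sigma>) \<le> real N" using N N0 by linarith
      then have "8 * pi * B0 \<le> real N * (e * \<sigma>)" using e \<sigma> by (simp add: field_simps)
      then show "2 * B0 / (real N * \<sigma>) * (2 * pi) \<le> e / 2"
        using Npos \<sigma> by (simp add: field_simps)
    qed
    finally show ?thesis by simp
  qed
  then show ?thesis by blast
qed

text \<open>A multiple of \<open>t - pi\<close> absorbs the jump and integrates to 0 against the
  kernel, so the continuous periodic case applies to the remainder \<open>h\<close>, whose common
  end value is the mean of \<open>F 0\<close> and \<open>F (2 * pi)\<close>.\<close>

lemma fejer_jump:
  fixes F :: "real \<Rightarrow> 'a::banach"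
  assumes cont: "continuous_on {0..2 * pi} F"
  shows "(\<lambda>N. integral {0..2 * pi} (\<lambda>t. fejer N (- t) *\<^sub>R F t)) \<longlonglongrightarrow> pi *\<^sub>R (F 0 + F (2 * pi))"
proof -
  define v where "v = (1 / (2 * pi)) *\<^sub>R (F (2 * pi) - F 0)"
  define h where "h = (\<lambda>t. F t - (t - pi) *\<^sub>R v)"
  have hc: "continuous_on {0..2 * pi} h" unfolding h_def by (intro continuous_intros cont)
  have h0: "h 0 = (1 / 2) *\<^sub>R (F 0 + F (2 * pi))"
    by (simp add: h_def v_def algebra_simps flip: scaleR_left_distrib)
  have h1: "h 0 = h (2 * pi)"
  proof -
    have "h (2 * pi) - h 0 = F (2 * pi) - F 0 - (2 * pi) *\<^sub>R v"
      by (simp add: h_def algebra_simps flip: scaleR_left_distrib)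
    then show ?thesis by (simp add: v_def)
  qed
  have eq: "integral {0..2 * pi} (\<lambda>t. fejer N (- t) *\<^sub>R F t)
      = integral {0..2 * pi} (\<lambda>t. fejer N (0 - t) *\<^sub>R h t)" for N
  proof -
    have "((\<lambda>t. (fejer N (- t) * (t - pi)) *\<^sub>R v) has_integral 0 *\<^sub>R v) {0..2 * pi}"
      by (intro has_integral_scaleR_left has_integral_fejer_centred)
    moreover have "((\<lambda>t. fejer N (0 - t) *\<^sub>R h t) has_integral
        integral {0..2 * pi} (\<lambda>t. fejer N (0 - t) *\<^sub>R h t)) {0..2 * pi}"
      by (intro integrable_integral integrable_continuous_interval continuous_intros hc)
    ultimately have "((\<lambda>t. fejer N (0 - t) *\<^sub>R h t + (fejer N (- t) * (t - pi)) *\<^sub>R v) has_integral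
        integral {0..2 * pi} (\<lambda>t. fejer N (0 - t) *\<^sub>R h t) + 0 *\<^sub>R v) {0..2 * pi}"
      by (intro has_integral_add)
    then show ?thesis
      by (intro integral_unique) (simp add: h_def scaleR_diff_right flip: scaleR_scaleR)
  qed
  have "(\<lambda>N. integral {0..2 * pi} (\<lambda>t. fejer N (0 - t) *\<^sub>R h t)) \<longlonglongrightarrow> (2 * pi) *\<^sub>R h 0"
  proof (rule LIMSEQ_I)
    fix r :: real assume "r > 0"
    then obtain N0 where N0: "\<And>N s. N \<ge> N0 \<Longrightarrow> s \<in> {0..2 * pi} \<Longrightarrow>
      norm (integral {0..2 * pi} (\<lambda>t. fejer N (s - t) *\<^sub>R h t) - (2 * pi) *\<^sub>R h s) \<le> r / 2"
      using fejer_uniform[OF hc h1 half_gt_zero[OF \<open>r > 0\<close>]] by blast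
    have "\<forall>N\<ge>N0. norm (integral {0..2 * pi} (\<lambda>t. fejer N (0 - t) *\<^sub>R h t) - (2 * pi) *\<^sub>R h 0) \<le> r / 2"
      using N0[of _ 0] by simp
    then show "\<exists>no. \<forall>n\<ge>no. norm (integral {0..2 * pi} (\<lambda>t. fejer n (0 - t) *\<^sub>R h t) - (2 * pi) *\<^sub>R h 0) < r"
      using \<open>r > 0\<close> by (intro exI[of _ N0]) (auto intro: le_less_trans)
  qed
  then show ?thesis using eq h0 by simp
qed

text \<open>Over symmetric ranges of \<open>k\<close> the sines cancel, so the complex exponentials
  leave a real kernel.\<close>

lemma cesaro_integral:
  fixes F :: "real \<Rightarrow> 'a::complex_banach"
  assumes cont: "continuous_on {0..2 * pi} F"
  shows "(\<Sum>n<N. \<Sum>k\<in>{- int n..int n}. integral {0..2 * pi} (\<lambda>t. cis (of_int k * (s - t)) *\<^sub>C F t)) /\<^sub>R real N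
     = integral {0..2 * pi} (\<lambda>t. fejer N (s - t) *\<^sub>R F t)"
proof -
  have "((\<lambda>t. (\<Sum>n<N. \<Sum>k\<in>{- int n..int n}. cis (of_int k * (s - t)) *\<^sub>C F t) /\<^sub>R real N) has_integral
     (\<Sum>n<N. \<Sum>k\<in>{- int n..int n}. integral {0..2 * pi} (\<lambda>t. cis (of_int k * (s - t)) *\<^sub>C F t)) /\<^sub>R real N) {0..2 * pi}"
    by (intro has_integral_cmul has_integral_sum integrable_integral integrable_continuous_interval
        continuous_intros cont) auto
  moreover have "(\<Sum>n<N. \<Sum>k\<in>{- int n..int n}. cis (of_int k * (s - t)) *\<^sub>C F t) /\<^sub>R real N
      = fejer N (s - t) *\<^sub>R F t" for t
  proof -
    have "(\<Sum>n<N. \<Sum>k\<in>{- int n..int n}. cis (of_int k * (s - t)) *\<^sub>C F t)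
      = of_real (\<Sum>n<N. \<Sum>k\<in>{- int n..int n}. cos (of_int k * (s - t))) *\<^sub>C F t"
      by (simp add: sum_cis_symmetric flip: scaleC.sum_left)
    then show ?thesis by (simp only: scaleC_of_real fejer_def divide_inverse_commute scaleR_scaleR)
  qed
  ultimately show ?thesis by (simp add: integral_unique)
qed

section \<open>Trigonometric polynomials\<close>

text \<open>Hides the frequency set and the coefficients, which the function does not
  determine.\<close>

definition is_trig :: "(real \<Rightarrow> 'a::complex_normed_vector) \<Rightarrow> bool"
  where "is_trig f \<longleftrightarrow> (\<exists>S c. finite S \<and> f = trig_poly S c)"

lemma trig_poly_extend:
  assumes "finite S'" "S \<subseteq> S'"
  shows "trig_poly S c = trig_poly S' (\<lambda>k. if k \<in> S then c k else 0)"
proof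
  fix t
  show "trig_poly S c t = trig_poly S' (\<lambda>k. if k \<in> S then c k else 0) t"
    unfolding trig_poly_def using assms by (intro sum.mono_neutral_cong_left) auto
qed

lemma is_trigI: "finite S \<Longrightarrow> is_trig (trig_poly S c)"
  by (auto simp: is_trig_def)

lemma is_trig_monomial: "is_trig (\<lambda>t. cis (of_int k * t) *\<^sub>C c)"
proof -
  have "(\<lambda>t. cis (of_int k * t) *\<^sub>C c) = trig_poly {k} (\<lambda>_. c)"
    by (auto simp: trig_poly_def)
  then show ?thesis by (metis is_trigI finite.intros)
qed

lemma is_trig_linear:
  assumes "is_trig f" "bounded_clinear L"
  shows "is_trig (\<lambda>t. L (f t))"
proof -
  obtain S c where S: "finite S" "f = trig_poly S c" using assms(1) by (auto simp: is_trig_def)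
  have bl: "bounded_linear L" and sc: "\<And>c x. L (c *\<^sub>C x) = c *\<^sub>C L x"
    using assms(2) by (auto simp: bounded_clinear_def)
  have "(\<lambda>t. L (f t)) = trig_poly S (\<lambda>k. L (c k))"
    by (auto simp: S trig_poly_def linear_sum[OF bounded_linear.linear[OF bl]] sc)
  then show ?thesis using S is_trigI by metis
qed

lemma is_trig_add:
  assumes "is_trig f" "is_trig g"
  shows "is_trig (\<lambda>t. f t + g t)"
proof -
  obtain S c S' c' where S: "finite S" "f = trig_poly S c" "finite S'" "g = trig_poly S' c'"
    using assms by (auto simp: is_trig_def)
  have "f = trig_poly (S \<union> S') (\<lambda>k. if k \<in> S then c k else 0)"
       "g = trig_poly (S \<union> S') (\<lambda>k. if k \<in> S' then c' k else 0)"
    using S by (auto intro!: trig_poly_extend)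
  then have "(\<lambda>t. f t + g t) = trig_poly (S \<union> S')
     (\<lambda>k. (if k \<in> S then c k else 0) + (if k \<in> S' then c' k else 0))"
    by (auto simp: trig_poly_def scaleC_add_right sum.distrib)
  then show ?thesis using S by (auto intro!: is_trigI)
qed

lemma is_trig_scaleC: "is_trig f \<Longrightarrow> is_trig (\<lambda>t. c *\<^sub>C f t)"
proof -
  have "bounded_clinear (\<lambda>x::'a. c *\<^sub>C x)"
    by (simp add: bounded_clinear_def scaleC.bounded_linear_right scaleC_scaleC mult.commute)
  then show "is_trig f \<Longrightarrow> is_trig (\<lambda>t. c *\<^sub>C f t)" using is_trig_linear by blast
qed

lemma is_trig_scaleR: "is_trig f \<Longrightarrow> is_trig (\<lambda>t. c *\<^sub>R f t)"
  using is_trig_scaleC[of f "of_real c"] by (simp add: scaleC_of_real)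

lemma is_trig_diff: "is_trig f \<Longrightarrow> is_trig g \<Longrightarrow> is_trig (\<lambda>t. f t - g t)"
  using is_trig_add[of f "\<lambda>t. (-1) *\<^sub>R g t"] is_trig_scaleR[of g "-1"] by simp

lemma is_trig_zero: "is_trig (\<lambda>t. 0)"
  using is_trig_scaleR[OF is_trig_monomial, of 0] by simp

lemma is_trig_sum:
  assumes "\<And>i. i \<in> I \<Longrightarrow> is_trig (f i)"
  shows "is_trig (\<lambda>t. \<Sum>i\<in>I. f i t)"
  using assms by (induction I rule: infinite_finite_induct) (auto intro: is_trig_zero is_trig_add)

lemma continuous_on_trig: "is_trig f \<Longrightarrow> continuous_on A f"
  by (auto simp: is_trig_def trig_poly_def [abs_def] intro!: continuous_intros)

lemma is_trig_periodic:
  assumes "is_trig f"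
  shows "f (t + 2 * pi) = f t"
proof -
  have "cis (of_int k * (t + 2 * pi)) = cis (of_int k * t)" for k :: int
  proof -
    have "cis (of_int k * (t + 2 * pi)) = cis (of_int k * t) * cis (2 * pi * of_int k)"
      by (simp add: cis_mult algebra_simps)
    then show ?thesis by (simp add: cis_multiple_2pi)
  qed
  then show ?thesis using assms by (auto simp: is_trig_def trig_poly_def)
qed

lemma is_trig_dense:
  fixes h :: "real \<Rightarrow> 'a::complex_banach"
  assumes cont: "continuous_on {0..2 * pi} h" and per: "h 0 = h (2 * pi)" and e: "e > 0"
  shows "\<exists>f. is_trig f \<and> (\<forall>t\<in>{0..2 * pi}. norm (h t - f t) \<le> e)"
proof -
  obtain N where N: "\<forall>s\<in>{0..2 * pi}.
    norm (integral {0..2 * pi} (\<lambda>t. fejer N (s - t) *\<^sub>R h t) - (2 * pi) *\<^sub>R h s) \<le> e"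
    using fejer_uniform[OF cont per e] by blast
  \<comment> \<open>The Fejer mean of \<open>h\<close> with \<open>cis (k * s)\<close> pulled out of
    the integrals, so that it is visibly a trigonometric polynomial in \<open>s\<close>.\<close>
  define f where "f = (\<lambda>s. (1 / (2 * pi)) *\<^sub>R ((\<Sum>n<N. \<Sum>k\<in>{- int n..int n}.
     cis (of_int k * s) *\<^sub>C integral {0..2 * pi} (\<lambda>t. cis (- of_int k * t) *\<^sub>C h t)) /\<^sub>R real N))"
  have "is_trig f"
    unfolding f_def by (intro is_trig_scaleR is_trig_sum is_trig_monomial)
  moreover have "norm (h s - f s) \<le> e" if s: "s \<in> {0..2 * pi}" for s
  proof -
    have "cis (of_int k * s) *\<^sub>C integral {0..2 * pi} (\<lambda>t. cis (- of_int k * t) *\<^sub>C h t)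
        = integral {0..2 * pi} (\<lambda>t. cis (of_int k * (s - t)) *\<^sub>C h t)" for k
    proof -
      have "(\<lambda>t. cis (- of_int k * t) *\<^sub>C h t) integrable_on {0..2 * pi}"
        by (intro integrable_continuous_interval continuous_intros cont)
      from integral_linear[OF this scaleC.bounded_linear_right, of "cis (of_int k * s)"]
      show ?thesis by (simp add: o_def scaleC_scaleC cis_mult algebra_simps)
    qed
    then have "f s = (1 / (2 * pi)) *\<^sub>R integral {0..2 * pi} (\<lambda>t. fejer N (s - t) *\<^sub>R h t)"
      by (simp only: f_def cesaro_integral[OF cont, of N s])
    then have "h s - f s = - (1 / (2 * pi)) *\<^sub>R
       (integral {0..2 * pi} (\<lambda>t. fejer N (s - t) *\<^sub>R h t) - (2 * pi) *\<^sub>R h s)"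
      by (simp add: algebra_simps)
    then have "norm (h s - f s) = (1 / (2 * pi)) *
       norm (integral {0..2 * pi} (\<lambda>t. fejer N (s - t) *\<^sub>R h t) - (2 * pi) *\<^sub>R h s)"
      by (simp del: scaleR_diff_right scaleR_minus_left)
    also have "\<dots> \<le> 1 * e"
      using N s pi_gt3 by (intro mult_mono) auto
    finally show ?thesis by simp
  qed
  ultimately show ?thesis by blast
qed

section \<open>The uniform boundedness principle\<close>

text \<open>Baire category: the closed sets \<open>A n\<close> of points where all the operators are
  bounded by \<open>n\<close> cover the space, so one of them contains a ball. Subtracting the value
  at its centre gives the estimate on a ball about 0.\<close>

lemma uniform_boundedness:
  fixes f :: "'i \<Rightarrow> 'a::banach \<Rightarrow> 'b::real_normed_vector"
  assumes lin: "\<And>i. bounded_linear (f i)"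
    and ptw: "\<And>x. \<exists>M. \<forall>i. norm (f i x) \<le> M"
  shows "\<exists>M. \<forall>i x. norm (f i x) \<le> M * norm x"
proof -
  define A where "A n = {x. \<forall>i. norm (f i x) \<le> real n}" for n :: nat
  have closedA: "closed (A n)" for n
  proof -
    have "A n = (\<Inter>i. {x. norm (f i x) \<le> real n})" by (auto simp: A_def)
    moreover have "closed {x. norm (f i x) \<le> real n}" for i
      by (intro closed_Collect_le continuous_intros linear_continuous_on lin)
    ultimately show ?thesis by auto
  qed
  have cover: "(\<Union>n. A n) = UNIV"
  proof (safe, simp_all)
    fix x
    obtain M where "\<forall>i. norm (f i x) \<le> M" using ptw by blast
    moreover obtain n :: nat where "M \<le> real n" using real_arch_simple by blast
    ultimately show "\<exists>n. x \<in> A n" unfolding A_def by (blast intro: order_trans)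
  qed
  have "\<exists>n. interior (A n) \<noteq> {}"
  proof (rule ccontr)
    assume "\<not> ?thesis"
    then have "euclidean interior_of \<Union>(range A) = {}"
      by (intro Baire_category_alt) (auto simp: completely_metrizable_space_euclidean closedA)
    then show False using cover by simp
  qed
  then obtain n x0 where "x0 \<in> interior (A n)" by blast
  then obtain r where r: "r > 0" "cball x0 r \<subseteq> A n" unfolding mem_interior_cball by blast
  have "norm (f i x) \<le> (2 * real n / r) * norm x" for i x
  proof (cases "x = 0")
    case True
    then show ?thesis using linear_0[OF bounded_linear.linear[OF lin[of i]]] by simp
  next
    case False
    define y where "y = (r / norm x) *\<^sub>R x"
    have "norm y = r" using False r by (simp add: y_def)
    then have "x0 + y \<in> A n" "x0 \<in> A n" using r by (auto simp: subset_iff dist_norm)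
    then have "norm (f i (x0 + y)) \<le> real n" "norm (f i x0) \<le> real n" by (auto simp: A_def)
    moreover have "f i y = f i (x0 + y) - f i x0"
      using linear_add[OF bounded_linear.linear[OF lin[of i]]] by simp
    ultimately have "norm (f i y) \<le> 2 * real n"
      using norm_triangle_ineq4[of "f i (x0 + y)" "f i x0"] by simp
    moreover have "f i y = (r / norm x) *\<^sub>R f i x"
      unfolding y_def using linear_scale[OF bounded_linear.linear[OF lin[of i]]] by blast
    ultimately have "(r / norm x) * norm (f i x) \<le> 2 * real n" using r by simp
    then show ?thesis using r False by (simp add: field_simps)
  qed
  then show ?thesis by blast
qed

section \<open>The Hahn-Banach theorem\<close>

text \<open>Partial functionals are represented by their graphs: a linear subspace of
  \<^typ>\<open>'a \<times> real\<close> on which the second component is dominated by the norm of the first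
  is automatically single valued.\<close>

lemma hahn_banach_real:
  fixes v :: "'a::real_normed_vector"
  shows "\<exists>f. linear f \<and> (\<forall>x. f x \<le> norm x) \<and> f v = norm v"
proof -
  define \<A> where "\<A> = {G :: ('a \<times> real) set. subspace G \<and> (v, norm v) \<in> G \<and> (\<forall>(x, a)\<in>G. a \<le> norm x)}"
  have ne: "\<A> \<noteq> {}"
  proof -
    have "\<forall>(x, a)\<in>span {(v, norm v)}. a \<le> norm x"
    proof clarify
      fix x a assume "(x, a) \<in> span {(v, norm v)}"
      then obtain k where "x = k *\<^sub>R v" "a = k * norm v" by (auto simp: span_singleton)
      then show "a \<le> norm x" by (simp add: mult_right_mono)
    qed
    then have "span {(v, norm v)} \<in> \<A>" by (simp add: \<A>_def span_base)
    then show ?thesis by blast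
  qed
  have chain: "\<Union>C \<in> \<A>" if "C \<noteq> {}" "subset.chain \<A> C" for C
  proof -
    have C: "\<And>G. G \<in> C \<Longrightarrow> G \<in> \<A>" "\<And>G H. G \<in> C \<Longrightarrow> H \<in> C \<Longrightarrow> G \<subseteq> H \<or> H \<subseteq> G"
      using that by (auto simp: subset_chain_def)
    have "subspace (\<Union>C)"
    proof (rule subspaceI)
      show "0 \<in> \<Union>C" using that C(1) by (fastforce simp: \<A>_def subspace_0)
      fix x y assume "x \<in> \<Union>C" "y \<in> \<Union>C"
      then obtain G H where "G \<in> C" "H \<in> C" "x \<in> G" "y \<in> H" by blast
      then obtain K where "K \<in> C" "x \<in> K" "y \<in> K" using C(2) by blast
      then show "x + y \<in> \<Union>C" using C(1) by (auto simp: \<A>_def intro: subspace_add)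
    next
      fix c x assume "x \<in> \<Union>C"
      then show "c *\<^sub>R x \<in> \<Union>C" using C(1) by (auto simp: \<A>_def intro: subspace_scale)
    qed
    then show ?thesis using that C(1) unfolding \<A>_def by blast
  qed
  obtain G where G: "G \<in> \<A>" and max: "\<And>H. H \<in> \<A> \<Longrightarrow> G \<subseteq> H \<Longrightarrow> H = G"
    using subset_Zorn_nonempty[OF ne chain] by blast
  have sub: "subspace G" and Gv: "(v, norm v) \<in> G" and dom: "\<And>x a. (x, a) \<in> G \<Longrightarrow> a \<le> norm x"
    using G by (auto simp: \<A>_def)
  have add: "(x + y, a + b) \<in> G" if "(x, a) \<in> G" "(y, b) \<in> G" for x y a b
    using subspace_add[OF sub that] by simp
  have scale: "(t *\<^sub>R x, t * a) \<in> G" if "(x, a) \<in> G" for x a t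
    using subspace_scale[OF sub that, of t] by simp
  have total: "\<exists>a. (x0, a) \<in> G" for x0
  proof -
    \<comment> \<open>The value \<open>c\<close> at \<open>x0\<close> must lie above all
      \<open>a - norm (x - x0)\<close> and below all \<open>norm (y + x0) - b\<close>;
      \<open>LU\<close> shows that these bounds do not cross.\<close>
    define L where "L = (\<lambda>(x, a). a - norm (x - x0)) ` G"
    define c where "c = Sup L"
    have LU: "a - norm (x - x0) \<le> norm (y + x0) - b" if "(x, a) \<in> G" "(y, b) \<in> G" for x a y b
    proof -
      have "a + b \<le> norm (x + y)" using dom[OF add[OF that]] .
      also have "\<dots> \<le> norm (x - x0) + norm (y + x0)"
        using norm_triangle_ineq[of "x - x0" "y + x0"] by simp
      finally show ?thesis by simp
    qed
    have "bdd_above L" using LU[OF _ Gv] by (auto simp: L_def intro!: bdd_aboveI)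
    then have lo: "a - norm (x - x0) \<le> c" if "(x, a) \<in> G" for x a
      unfolding c_def using that by (intro cSup_upper) (auto simp: L_def)
    have hi: "c \<le> norm (y + x0) - b" if "(y, b) \<in> G" for y b
      unfolding c_def using that Gv LU by (intro cSup_least) (auto simp: L_def)
    define H where "H = span (insert (x0, c) G)"
    have "\<forall>(x, a)\<in>H. a \<le> norm x"
    proof clarify
      fix x a assume "(x, a) \<in> H"
      then obtain t where "(x, a) - t *\<^sub>R (x0, c) \<in> span G"
        unfolding H_def span_insert by auto
      then have xa: "(x - t *\<^sub>R x0, a - t * c) \<in> G"
        using sub by (simp add: span_eq_iff[THEN iffD2, OF sub])
      \<comment> \<open>Dividing by the absolute value of \<open>t\<close> reduces domination on the
        extended graph to the coefficients 1 and -1 of \<open>x0\<close>, that is, to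
        \<open>hi\<close> and \<open>lo\<close>.\<close>
      consider "t = 0" | "t > 0" | "t < 0" by linarith
      then show "a \<le> norm x"
      proof cases
        case 1
        then show ?thesis using dom[OF xa] by simp
      next
        case 2
        have "c \<le> norm ((1 / t) *\<^sub>R (x - t *\<^sub>R x0) + x0) - (1 / t) * (a - t * c)"
          using hi[OF scale[OF xa]] .
        also have "(1 / t) *\<^sub>R (x - t *\<^sub>R x0) + x0 = (1 / t) *\<^sub>R x"
          using 2 by (simp add: scaleR_diff_right)
        finally show ?thesis using 2 by (simp add: field_simps)
      next
        case 3
        have "(- 1 / t) * (a - t * c) - norm ((- 1 / t) *\<^sub>R (x - t *\<^sub>R x0) - x0) \<le> c"
          using lo[OF scale[OF xa]] .
        also have "(- 1 / t) *\<^sub>R (x - t *\<^sub>R x0) - x0 = (- 1 / t) *\<^sub>R x"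
          using 3 by (simp add: scaleR_diff_right)
        finally show ?thesis using 3 by (simp add: field_simps)
      qed
    qed
    moreover have "(v, norm v) \<in> H" unfolding H_def using Gv by (simp add: span_base)
    ultimately have "H \<in> \<A>" by (simp add: \<A>_def H_def)
    moreover have "G \<subseteq> H" unfolding H_def using span_superset[of "insert (x0, c) G"] by simp
    ultimately have "H = G" by (rule max)
    moreover have "(x0, c) \<in> H" unfolding H_def by (simp add: span_base)
    ultimately show ?thesis by blast
  qed
  have uniq: "a = b" if "(x, a) \<in> G" "(x, b) \<in> G" for x a b
  proof -
    have *: "a' \<le> b'" if "(x, a') \<in> G" "(x, b') \<in> G" for a' b'
      using dom[OF add[OF that(1) scale[OF that(2), of "-1"]]] by simp
    show ?thesis using *[OF that] *[OF that(2,1)] by simp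
  qed
  define f where "f x = (THE a. (x, a) \<in> G)" for x
  have f: "(x, f x) \<in> G" for x
    unfolding f_def using total[of x] uniq by (metis theI)
  have "linear f"
  proof (rule linearI)
    show "f (x + y) = f x + f y" for x y using uniq[OF f add[OF f f]] .
    show "f (r *\<^sub>R x) = r *\<^sub>R f x" for r x using uniq[OF f scale[OF f]] by simp
  qed
  moreover have "f v = norm v" using uniq[OF f Gv] .
  ultimately show ?thesis using dom[OF f] by blast
qed

text \<open>A complex functional is recovered from its real part \<open>f\<close> as
  \<open>f x - i f (i x)\<close>.\<close>

lemma hahn_banach:
  fixes v :: "'a::complex_normed_vector"
  obtains x' :: "'a \<Rightarrow> complex" where "bounded_clinear x'" "\<And>x. cmod (x' x) \<le> norm x" "x' v = of_real (norm v)"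
proof -
  obtain f :: "'a \<Rightarrow> real" where f: "linear f" "\<And>x. f x \<le> norm x" "f v = norm v"
    using hahn_banach_real by blast
  define g where "g x = Complex (f x) (- f (\<i> *\<^sub>C x))" for x
  have add: "g (x + y) = g x + g y" for x y
    by (simp add: g_def linear_add[OF f(1)] scaleC_add_right complex_eq_iff)
  have scaleR: "f (r *\<^sub>R x) = r * f x" for r x using linear_scale[OF f(1), of r x] by simp
  have scale: "g (c *\<^sub>C x) = c * g x" for c x
  proof -
    have fc: "f (c *\<^sub>C y) = Re c * f y + Im c * f (\<i> *\<^sub>C y)" for c y
    proof -
      have "c = of_real (Re c) + of_real (Im c) * \<i>" by (simp add: complex_eq_iff)
      then have "c *\<^sub>C y = (of_real (Re c) + of_real (Im c) * \<i>) *\<^sub>C y" by (rule arg_cong)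
      then have "c *\<^sub>C y = Re c *\<^sub>R y + Im c *\<^sub>R (\<i> *\<^sub>C y)"
        by (simp only: scaleC_add_left scaleC_of_real flip: scaleC_scaleC)
      then show ?thesis by (simp add: linear_add[OF f(1)] scaleR)
    qed
    show ?thesis
      by (simp add: g_def scaleC_scaleC complex_eq_iff fc[of c x] fc[of "\<i> * c" x])
  qed
  have bound: "cmod (g x) \<le> norm x" for x
  proof -
    \<comment> \<open>Rotating \<open>x\<close> by the conjugate phase makes the value of
      \<open>g\<close> real and nonnegative, and then it equals the value of
      \<open>f\<close>.\<close>
    define u where "u = cnj (sgn (g x))"
    have "g x * cnj (g x) = of_real (cmod (g x)) * of_real (cmod (g x))"
      using complex_norm_square[of "g x"] by (simp add: power2_eq_square)
    then have "g (u *\<^sub>C x) = of_real (cmod (g x))"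
      unfolding scale u_def by (cases "g x = 0") (simp_all add: sgn_eq field_simps)
    then have "cmod (g x) = f (u *\<^sub>C x)" by (simp add: g_def complex_eq_iff)
    also have "\<dots> \<le> norm (u *\<^sub>C x)" by (rule f(2))
    also have "\<dots> \<le> norm x" by (simp add: norm_scaleC u_def norm_sgn)
    finally show ?thesis .
  qed
  have "bounded_linear g"
  proof (rule bounded_linear_intro)
    show "g (r *\<^sub>R x) = r *\<^sub>R g x" for r x
      using scale[of "of_real r" x] by (simp add: scaleC_of_real scaleR_conv_of_real)
    show "norm (g x) \<le> norm x * 1" for x using bound by simp
  qed (rule add)
  then have "bounded_clinear g" by (simp add: bounded_clinear_def scale scaleC_complex_def)
  moreover have "g v = of_real (norm v)"
  proof -
    \<comment> \<open>The real part already has the largest modulus allowed, so the imaginary part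
      must vanish.\<close>
    have "Re (g v) = norm v" using f by (simp add: g_def)
    moreover have "cmod (g v) \<le> norm v" by (rule bound)
    ultimately have "(Re (g v))\<^sup>2 + (Im (g v))\<^sup>2 \<le> (Re (g v))\<^sup>2"
      by (metis cmod_power2 norm_ge_zero power_mono)
    then show ?thesis using \<open>Re (g v) = norm v\<close> by (simp add: complex_eq_iff)
  qed
  ultimately show ?thesis using that bound by blast
qed

section \<open>Resolvents\<close>

lemma bounded_clinearD:
  assumes "bounded_clinear f"
  shows "bounded_linear f" "f (x + y) = f x + f y" "f (x - y) = f x - f y" "f 0 = 0"
    "f (r *\<^sub>R x) = r *\<^sub>R f x" "f (c *\<^sub>C x) = c *\<^sub>C f x" "f (- x) = - f x"
    "f (sum g I) = (\<Sum>i\<in>I. f (g i))"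
  using assms bounded_linear.linear[of f]
  by (auto simp: bounded_clinear_def linear_add linear_diff linear_0 linear_scale linear_neg linear_sum)

lemma bounded_clinearI:
  assumes "\<And>x y. f (x + y) = f x + f y" "\<And>c x. f (c *\<^sub>C x) = c *\<^sub>C f x" "\<And>x. norm (f x) \<le> norm x * K"
  shows "bounded_clinear f"
proof -
  have "f (r *\<^sub>R x) = r *\<^sub>R f x" for r x
    using assms(2)[of "of_real r" x] by (simp add: scaleC_of_real)
  then have "bounded_linear f" using assms by (intro bounded_linear_intro)
  then show ?thesis using assms by (simp add: bounded_clinear_def)
qed

lemma resolvent_clinear: "l \<in> resolvent_set A \<Longrightarrow> bounded_clinear (resolvent A l)"
  by (simp add: resolvent_set_def)

lemma resolvent_in_domain:
  assumes "l \<in> resolvent_set A"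
  shows "resolvent A l x \<in> fst A" "l *\<^sub>C resolvent A l x - snd A (resolvent A l x) = x"
proof -
  have b: "bij_betw (shift_op l A) (fst A) UNIV" using assms by (simp add: resolvent_set_def)
  then have x: "x \<in> shift_op l A ` fst A" by (simp add: bij_betw_def)
  show "resolvent A l x \<in> fst A" unfolding resolvent_def by (rule inv_into_into[OF x])
  show "l *\<^sub>C resolvent A l x - snd A (resolvent A l x) = x"
    using f_inv_into_f[OF x] by (simp add: resolvent_def shift_op_def)
qed

lemma resolvent_shift:
  assumes "l \<in> resolvent_set A" "z \<in> fst A"
  shows "resolvent A l (l *\<^sub>C z - snd A z) = z"
proof -
  have "inj_on (shift_op l A) (fst A)" using assms by (simp add: resolvent_set_def bij_betw_def)
  from inv_into_f_f[OF this assms(2)] show ?thesis by (simp add: resolvent_def shift_op_def)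
qed

lemma resolvent_eq_0_iff:
  assumes "l \<in> resolvent_set A"
  shows "resolvent A l x = 0 \<longleftrightarrow> x = 0"
proof
  assume *: "resolvent A l x = 0"
  have "0 \<in> fst A" using resolvent_in_domain(1)[OF assms, of x] * by simp
  have "l *\<^sub>C 0 - snd A 0 = x" using resolvent_in_domain(2)[OF assms, of x] * by simp
  \<comment> \<open>\<open>snd A\<close> is not assumed linear, so its value at 0 is obtained from
    the linearity of the resolvent.\<close>
  moreover have "l *\<^sub>C 0 - snd A 0 = 0"
  proof -
    have "resolvent A l 0 = 0" using bounded_clinearD(4)[OF resolvent_clinear[OF assms]] .
    then show ?thesis using resolvent_in_domain(2)[OF assms, of 0] by simp
  qed
  ultimately show "x = 0" by simp
next
  assume "x = 0"
  then show "resolvent A l x = 0" using bounded_clinearD(4)[OF resolvent_clinear[OF assms]] by simp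
qed

text \<open>With \<open>z\<close> the resolvent at \<open>l\<close> of \<open>x\<close>, the vector
  \<open>x\<close> is \<open>(m z - A z) + (l - m) z\<close>. Linearity is used of the resolvent at
  \<open>m\<close>, not of the \<open>operator\<close>, which carries none.\<close>

lemma resolvent_identity:
  assumes "l \<in> resolvent_set A" "m \<in> resolvent_set A"
  shows "resolvent A m x - resolvent A l x = (l - m) *\<^sub>C resolvent A m (resolvent A l x)"
proof -
  define z where "z = resolvent A l x"
  have z: "z \<in> fst A" "l *\<^sub>C z - snd A z = x"
    using resolvent_in_domain[OF assms(1)] by (auto simp: z_def)
  have "x = (m *\<^sub>C z - snd A z) + (l - m) *\<^sub>C z"
    using z(2) by (simp add: scaleC.diff_left)
  then have "resolvent A m x = resolvent A m (m *\<^sub>C z - snd A z) + (l - m) *\<^sub>C resolvent A m z"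
    using bounded_clinearD(2,6)[OF resolvent_clinear[OF assms(2)]] by metis
  then show ?thesis using resolvent_shift[OF assms(2) z(1)] by (simp add: z_def)
qed

text \<open>The equation \<open>(m - A) z = x\<close> is read as a fixed point equation for the map
  from \<open>z\<close> to \<open>R (x - (m - l) z)\<close>, a contraction with constant 1/2.
  Uniqueness of the fixed point makes the new resolvent linear, and absorbing half of its norm gives
  the bound \<open>2 * C\<close>.\<close>

lemma resolvent_neumann:
  fixes A :: "'a::complex_banach operator"
  assumes l: "l \<in> resolvent_set A" and C: "\<And>x. norm (resolvent A l x) \<le> C * norm x"
    and m: "cmod (m - l) * C \<le> 1 / 2"
  shows "m \<in> resolvent_set A" "norm (resolvent A m x) \<le> 2 * C * norm x"
proof -
  define R where "R = resolvent A l"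
  have Rlin: "bounded_clinear R" using resolvent_clinear[OF l] by (simp add: R_def)
  note R = bounded_clinearD[OF Rlin]
  have fixpt: "\<exists>!z. R (x - (m - l) *\<^sub>C z) = z" for x
  proof (rule banach_fix_type[of "1/2"])
      show "\<forall>y. \<forall>z. dist (R (x - (m - l) *\<^sub>C y)) (R (x - (m - l) *\<^sub>C z)) \<le> 1 / 2 * dist y z"
      proof (intro allI)
        fix y z :: 'a
        have "R (x - (m - l) *\<^sub>C y) - R (x - (m - l) *\<^sub>C z) = R ((m - l) *\<^sub>C (z - y))"
          by (simp add: scaleC.diff_right flip: R(3))
        then have "dist (R (x - (m - l) *\<^sub>C y)) (R (x - (m - l) *\<^sub>C z)) \<le> C * norm ((m - l) *\<^sub>C (z - y))"
          using C unfolding R_def by (simp add: dist_norm)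
        also have "\<dots> = (cmod (m - l) * C) * dist y z"
          by (simp add: norm_scaleC dist_norm norm_minus_commute)
        also have "\<dots> \<le> 1 / 2 * dist y z" by (intro mult_right_mono m) auto
        finally show "dist (R (x - (m - l) *\<^sub>C y)) (R (x - (m - l) *\<^sub>C z)) \<le> 1 / 2 * dist y z" .
      qed
  qed auto
  have iff: "z \<in> fst A \<and> shift_op m A z = x \<longleftrightarrow> R (x - (m - l) *\<^sub>C z) = z" for x z
  proof
    assume *: "z \<in> fst A \<and> shift_op m A z = x"
    then have "x - (m - l) *\<^sub>C z = l *\<^sub>C z - snd A z"
      by (auto simp: shift_op_def scaleC.diff_left)
    then show "R (x - (m - l) *\<^sub>C z) = z" using * resolvent_shift[OF l] by (simp add: R_def)
  next
    assume *: "R (x - (m - l) *\<^sub>C z) = z"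
    then have "z \<in> fst A" "l *\<^sub>C z - snd A z = x - (m - l) *\<^sub>C z"
      using resolvent_in_domain[OF l, of "x - (m - l) *\<^sub>C z"] by (auto simp: R_def)
    then show "z \<in> fst A \<and> shift_op m A z = x"
      by (auto simp: shift_op_def scaleC.diff_left algebra_simps)
  qed
  have bij: "bij_betw (shift_op m A) (fst A) UNIV"
  proof (rule bij_betwI')
    show "(shift_op m A x = shift_op m A y) = (x = y)" if "x \<in> fst A" "y \<in> fst A" for x y
      using that fixpt iff by metis
    show "\<exists>x\<in>fst A. y = shift_op m A x" for y
      using fixpt[of y] iff by metis
  qed auto
  have rfix: "R (x - (m - l) *\<^sub>C resolvent A m x) = resolvent A m x" for x
  proof -
    have x: "x \<in> shift_op m A ` fst A" using bij by (simp add: bij_betw_def)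
    have "resolvent A m x \<in> fst A \<and> shift_op m A (resolvent A m x) = x"
      using inv_into_into[OF x] f_inv_into_f[OF x] by (simp add: resolvent_def)
    then show ?thesis using iff by blast
  qed
  have uniq: "resolvent A m x = z" if "R (x - (m - l) *\<^sub>C z) = z" for x z
    using fixpt[of x] that rfix[of x] by blast
  have bound: "norm (resolvent A m x) \<le> 2 * C * norm x" for x
  proof -
    define z where "z = resolvent A m x"
    have "z = R x - (m - l) *\<^sub>C R z"
      using rfix[of x] by (simp add: z_def R)
    then have "norm z \<le> norm (R x) + cmod (m - l) * norm (R z)"
      using norm_triangle_ineq4[of "R x" "(m - l) *\<^sub>C R z"] by (simp add: norm_scaleC)
    also have "\<dots> \<le> C * norm x + cmod (m - l) * (C * norm z)"
      unfolding R_def by (intro add_mono mult_left_mono C) auto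
    also have "cmod (m - l) * (C * norm z) \<le> 1 / 2 * norm z"
      using mult_right_mono[OF m, of "norm z"] by (simp add: mult.assoc)
    finally show ?thesis by (simp add: z_def)
  qed
  have "bounded_clinear (resolvent A m)"
  proof (rule bounded_clinearI)
    show "resolvent A m (x + y) = resolvent A m x + resolvent A m y" for x y
    proof (rule uniq)
      have "x + y - (m - l) *\<^sub>C (resolvent A m x + resolvent A m y)
          = (x - (m - l) *\<^sub>C resolvent A m x) + (y - (m - l) *\<^sub>C resolvent A m y)"
        by (simp add: scaleC_add_right)
      then show "R (x + y - (m - l) *\<^sub>C (resolvent A m x + resolvent A m y))
          = resolvent A m x + resolvent A m y"
        by (simp only: R(2) rfix)
    qed
    show "resolvent A m (c *\<^sub>C x) = c *\<^sub>C resolvent A m x" for c x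
    proof (rule uniq)
      have "R (c *\<^sub>C x - (m - l) *\<^sub>C c *\<^sub>C resolvent A m x) = c *\<^sub>C R (x - (m - l) *\<^sub>C resolvent A m x)"
        by (simp add: R scaleC.diff_right scaleC_scaleC mult.commute)
      then show "R (c *\<^sub>C x - (m - l) *\<^sub>C c *\<^sub>C resolvent A m x) = c *\<^sub>C resolvent A m x"
        by (simp add: rfix)
    qed
    show "norm (resolvent A m x) \<le> norm x * (2 * C)" for x
      using bound[of x] by (simp add: mult.commute)
  qed
  then show "m \<in> resolvent_set A" using bij by (simp add: resolvent_set_def)
  show "norm (resolvent A m x) \<le> 2 * C * norm x" by (rule bound)
qed

lemma resolvent_bound:
  assumes "l \<in> resolvent_set A"
  obtains C where "C > 0" "\<And>x. norm (resolvent A l x) \<le> C * norm x"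
proof -
  have "bounded_linear (resolvent A l)" using assms by (simp add: resolvent_set_def bounded_clinear_def)
  from bounded_linear.pos_bounded[OF this] obtain K where "K > 0" "\<forall>x. norm (resolvent A l x) \<le> norm x * K"
    by blast
  then show ?thesis using that[of K] by (simp add: mult.commute)
qed

lemma resolvent_set_ball:
  fixes A :: "'a::complex_banach operator"
  assumes "l \<in> resolvent_set A"
  obtains d C where "d > 0" "C > 0" "ball l d \<subseteq> resolvent_set A"
    "\<And>m x. m \<in> ball l d \<Longrightarrow> norm (resolvent A m x) \<le> C * norm x"
proof -
  obtain C where C: "C > 0" "\<And>x. norm (resolvent A l x) \<le> C * norm x"
    using resolvent_bound[OF assms] by blast
  have "cmod (m - l) * C \<le> 1 / 2" if "m \<in> ball l (1 / (2 * C))" for m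
    using that C(1) by (simp add: dist_norm norm_minus_commute field_simps)
  then show ?thesis
    using that[of "1 / (2 * C)" "2 * C"] C resolvent_neumann[OF assms C(2)] by (auto simp: subset_iff)
qed

lemma open_resolvent_set: "open (resolvent_set (A :: 'a::complex_banach operator))"
  unfolding open_contains_ball by (meson resolvent_set_ball)

lemma continuous_on_resolvent:
  fixes A :: "'a::complex_banach operator"
  shows "continuous_on (resolvent_set A) (\<lambda>l. resolvent A l x)"
proof (rule continuous_at_imp_continuous_on, rule ballI)
  fix l assume l: "l \<in> resolvent_set A"
  obtain d C where d: "d > 0" "C > 0" "ball l d \<subseteq> resolvent_set A"
    and C: "\<And>m x. m \<in> ball l d \<Longrightarrow> norm (resolvent A m x) \<le> C * norm x"
    using resolvent_set_ball[OF l] by blast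
  have "((\<lambda>m. resolvent A m x - resolvent A l x) \<longlongrightarrow> 0) (at l)"
  proof (rule Lim_null_comparison)
    show "\<forall>\<^sub>F m in at l. norm (resolvent A m x - resolvent A l x) \<le> cmod (l - m) * (C * norm (resolvent A l x))"
      unfolding eventually_at
    proof (intro exI conjI ballI impI)
      fix m assume "m \<noteq> l \<and> dist m l < d"
      then have m: "m \<in> ball l d" by (simp add: dist_commute)
      then show "norm (resolvent A m x - resolvent A l x) \<le> cmod (l - m) * (C * norm (resolvent A l x))"
        using resolvent_identity[OF l, of m x] C[OF m, of "resolvent A l x"] d m
        by (auto simp: norm_scaleC subset_iff intro!: mult_left_mono)
    qed (rule d)
    have "((\<lambda>m. cmod (l - m) * (C * norm (resolvent A l x))) \<longlongrightarrow> cmod (l - l) * (C * norm (resolvent A l x))) (at l)"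
      by (intro tendsto_intros)
    then show "((\<lambda>m. cmod (l - m) * (C * norm (resolvent A l x))) \<longlongrightarrow> 0) (at l)" by simp
  qed
  then show "isCont (\<lambda>l. resolvent A l x) l"
    by (simp add: isCont_def Lim_null[symmetric])
qed

text \<open>By the resolvent identity the difference quotient is minus the resolvent at
  \<open>m\<close> of the resolvent at \<open>l\<close>, which converges by strong continuity.
  Composing with a functional keeps the complex analysis scalar.\<close>

lemma holomorphic_on_resolvent:
  fixes A :: "'a::complex_banach operator"
  assumes x': "bounded_clinear (x' :: 'a \<Rightarrow> complex)"
  shows "(\<lambda>l. x' (resolvent A l x)) holomorphic_on resolvent_set A"
proof (rule holomorphic_onI)
  fix l assume l: "l \<in> resolvent_set A"
  have "((\<lambda>m. x' (- resolvent A m (resolvent A l x))) \<longlongrightarrow> x' (- resolvent A l (resolvent A l x))) (at l)"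
    using continuous_on_resolvent[of A "resolvent A l x"] l open_resolvent_set[of A]
    by (intro bounded_linear.tendsto[OF bounded_clinearD(1)[OF x']] tendsto_intros)
       (auto simp: continuous_on_eq_continuous_at isCont_def)
  moreover have "\<forall>\<^sub>F m in at l. x' (- resolvent A m (resolvent A l x))
      = (x' (resolvent A m x) - x' (resolvent A l x)) / (m - l)"
  proof -
    have "\<forall>\<^sub>F m in at l. m \<in> resolvent_set A \<and> m \<noteq> l"
      using open_resolvent_set[of A] l eventually_nhds_in_open
      by (fastforce simp: eventually_at_filter elim: eventually_mono)
    then show ?thesis
    proof eventually_elim
      case (elim m)
      have "x' (resolvent A m x) - x' (resolvent A l x) = (l - m) * x' (resolvent A m (resolvent A l x))"
        using elim l by (simp add: bounded_clinearD(6)[OF x'] resolvent_identity scaleC_complex_def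
            flip: bounded_clinearD(3)[OF x'])
      then show ?case using elim by (simp add: bounded_clinearD(7)[OF x'] field_simps)
    qed
  qed
  ultimately have "((\<lambda>m. (x' (resolvent A m x) - x' (resolvent A l x)) / (m - l)) \<longlongrightarrow> x' (- resolvent A l (resolvent A l x))) (at l)"
    by (rule Lim_transform_eventually)
  then have "((\<lambda>l. x' (resolvent A l x)) has_field_derivative x' (- resolvent A l (resolvent A l x))) (at l)"
    by (simp add: has_field_derivative_iff)
  then show "(\<lambda>l. x' (resolvent A l x)) field_differentiable at l within resolvent_set A"
    using field_differentiable_at_within field_differentiable_def by blast
qed

section \<open>Semigroups\<close>

text \<open>\<open>growth\<close> gives local boundedness of the semigroup by a direct estimate. In
  the theorem it follows from \<open>\<omega>\<close> being a real number above the growth bound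
  plus 3.\<close>

locale exp_bounded_semigroup =
  fixes T :: "real \<Rightarrow> 'a::complex_banach \<Rightarrow> 'a"
  assumes semigroup: "C0_semigroup T"
    and growth: "growth_bound T < \<infinity>"
begin

lemma clin: "t \<ge> 0 \<Longrightarrow> bounded_clinear (T t)"
  and T_0 [simp]: "T 0 x = x"
  and T_add: "s \<ge> 0 \<Longrightarrow> t \<ge> 0 \<Longrightarrow> T (s + t) x = T s (T t x)"
  and T_right: "((\<lambda>t. T t x) \<longlongrightarrow> x) (at_right 0)"
  using semigroup by (auto simp: C0_semigroup_def)

lemmas T_lin = bounded_clinearD[OF clin]

lemma local_bound:
  obtains K where "K > 0" "\<And>t x. 0 \<le> t \<Longrightarrow> t \<le> b \<Longrightarrow> norm (T t x) \<le> K * norm x"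
proof -
  obtain w M where M: "\<And>t. t \<ge> 0 \<Longrightarrow> onorm (T t) \<le> M * exp (w * t)"
    using growth unfolding growth_bound_def Inf_less_iff by auto
  define K where "K = (\<bar>M\<bar> + 1) * exp (\<bar>w\<bar> * \<bar>b\<bar>)"
  have "K > 0" by (auto simp: K_def intro!: mult_pos_pos)
  moreover have "norm (T t x) \<le> K * norm x" if t: "0 \<le> t" "t \<le> b" for t x
  proof -
    have "norm (T t x) \<le> onorm (T t) * norm x"
      using onorm[OF T_lin(1)[OF t(1)]] .
    also have "onorm (T t) \<le> K"
    proof -
      have "onorm (T t) \<le> M * exp (w * t)" using M t by blast
      also have "\<dots> \<le> (\<bar>M\<bar> + 1) * exp (w * t)" by (intro mult_right_mono) auto
      also have "\<dots> \<le> K"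
      proof -
        have "w * t \<le> \<bar>w\<bar> * \<bar>b\<bar>" using t by (intro mult_mono) auto
        then show ?thesis unfolding K_def by (intro mult_left_mono) auto
      qed
      finally show ?thesis .
    qed
    finally show ?thesis by (simp add: mult_right_mono)
  qed
  ultimately show ?thesis using that by blast
qed

text \<open>Reduces increments at any time, from either side, to increments at 0. To the left the
  base point varies, hence the bound \<open>K\<close> uniform on \<open>[0, b]\<close>.\<close>

lemma T_diff_bound:
  assumes K: "\<And>t x. 0 \<le> t \<Longrightarrow> t \<le> b \<Longrightarrow> norm (T t x) \<le> K * norm x"
    and "0 \<le> s" "s \<le> b" "0 \<le> t" "t \<le> b"
  shows "norm (T s x - T t x) \<le> K * norm (T \<bar>s - t\<bar> x - x)"
proof -
  have *: "norm (T u x - T v x) \<le> K * norm (T (u - v) x - x)" if "0 \<le> v" "v \<le> u" "u \<le> b" for u v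
  proof -
    have "T u x = T v (T (u - v) x)" using T_add[of v "u - v" x] that by simp
    then have "T u x - T v x = T v (T (u - v) x - x)" using that by (simp add: T_lin)
    then show ?thesis using K[of v] that by simp
  qed
  show ?thesis
  proof (cases "t \<le> s")
    case True
    then show ?thesis using *[of t s] assms by simp
  next
    case False
    then show ?thesis using *[of s t] assms by (simp add: norm_minus_commute)
  qed
qed

lemma continuous_on_T: "continuous_on {0..} (\<lambda>t. T t x)"
  unfolding continuous_on_iff
proof (intro ballI allI impI)
  fix t e :: real assume t: "t \<in> {0..}" and e: "e > 0"
  obtain K where K: "K > 0" "\<And>s x. 0 \<le> s \<Longrightarrow> s \<le> t + 1 \<Longrightarrow> norm (T s x) \<le> K * norm x"
    using local_bound by blast
  have "\<forall>\<^sub>F h in at_right 0. dist (T h x) x < e / K"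
    using T_right e K(1) unfolding tendsto_iff by simp
  then obtain d where d: "d > 0" "\<And>h. 0 < h \<Longrightarrow> h < d \<Longrightarrow> dist (T h x) x < e / K"
    unfolding eventually_at_right_field by auto
  show "\<exists>d>0. \<forall>s\<in>{0..}. dist s t < d \<longrightarrow> dist (T s x) (T t x) < e"
  proof (intro exI[of _ "min d 1"] conjI ballI impI)
    fix s :: real assume s: "s \<in> {0..}" "dist s t < min d 1"
    show "dist (T s x) (T t x) < e"
    proof (cases "s = t")
      case False
      have "norm (T s x - T t x) \<le> K * norm (T \<bar>s - t\<bar> x - x)"
        using s t by (intro T_diff_bound[OF K(2)]) (auto simp: dist_norm)
      also have "\<dots> < K * (e / K)"
        using d(2)[of "\<bar>s - t\<bar>"] s False K(1) by (intro mult_strict_left_mono) (auto simp: dist_norm)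
      finally show ?thesis using K(1) by (simp add: dist_norm)
    qed (use e in simp)
  qed (use d in simp)
qed

lemma continuous_on_T_Icc: "0 \<le> a \<Longrightarrow> continuous_on {a..b} (\<lambda>t. T t x)"
  by (rule continuous_on_subset[OF continuous_on_T]) auto

section \<open>The generator along orbits\<close>

lemma generator_tendsto:
  assumes "y \<in> fst (generator T)"
  shows "((\<lambda>t. (T t y - y) /\<^sub>R t) \<longlongrightarrow> snd (generator T) y) (at_right 0)"
proof -
  obtain z where z: "((\<lambda>t. (T t y - y) /\<^sub>R t) \<longlongrightarrow> z) (at_right 0)"
    using assms by (auto simp: generator_def)
  then have "snd (generator T) y = z" by (simp add: generator_def tendsto_Lim)
  then show ?thesis using z by simp
qed

lemma generator_T:
  assumes "y \<in> fst (generator T)" "t \<ge> 0"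
  shows "T t y \<in> fst (generator T)" "snd (generator T) (T t y) = T t (snd (generator T) y)"
proof -
  have "((\<lambda>h. T t ((T h y - y) /\<^sub>R h)) \<longlongrightarrow> T t (snd (generator T) y)) (at_right 0)"
    by (intro bounded_linear.tendsto[OF T_lin(1)] generator_tendsto assms)
  moreover have "\<forall>\<^sub>F h in at_right 0. T t ((T h y - y) /\<^sub>R h) = (T h (T t y) - T t y) /\<^sub>R h"
    unfolding eventually_at_right_field
    using assms(2) by (auto intro!: exI[of _ 1] simp: T_lin add.commute simp flip: T_add)
  ultimately have *: "((\<lambda>h. (T h (T t y) - T t y) /\<^sub>R h) \<longlongrightarrow> T t (snd (generator T) y)) (at_right 0)"
    by (rule Lim_transform_eventually)
  then show "T t y \<in> fst (generator T)" by (auto simp: generator_def)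
  show "snd (generator T) (T t y) = T t (snd (generator T) y)"
    using * by (simp add: generator_def tendsto_Lim)
qed

lemma resolvent_T:
  assumes "l \<in> resolvent_set (generator T)" "t \<ge> 0"
  shows "resolvent (generator T) l (T t x) = T t (resolvent (generator T) l x)"
proof -
  define z where "z = resolvent (generator T) l x"
  have z: "z \<in> fst (generator T)" "l *\<^sub>C z - snd (generator T) z = x"
    using resolvent_in_domain[OF assms(1)] by (auto simp: z_def)
  have "T t x = l *\<^sub>C T t z - snd (generator T) (T t z)"
    using assms(2) by (simp add: generator_T z(1) T_lin flip: z(2))
  then show ?thesis using resolvent_shift[OF assms(1) generator_T(1)[OF z(1) assms(2)]] by (simp add: z_def)
qed

text \<open>To the right of \<open>t\<close> the difference quotient is \<open>T t\<close> applied
  to the one at 0. To the left its base point \<open>s\<close> moves, and the uniform bound on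
  \<open>T s\<close> is combined with the continuity of \<open>T s a\<close> in
  \<open>s\<close>.\<close>

lemma T_has_vector_derivative:
  assumes y: "y \<in> fst (generator T)" and t: "t \<ge> 0"
  shows "((\<lambda>t. T t y) has_vector_derivative T t (snd (generator T) y)) (at t within {0..})"
  unfolding has_vector_derivative_def has_derivative_within_alt
proof (intro conjI allI impI)
  define a where "a = snd (generator T) y"
  show "bounded_linear (\<lambda>h. h *\<^sub>R T t (snd (generator T) y))" by (rule bounded_linear_scaleR_left)
  fix e :: real assume e: "e > 0"
  obtain K where K: "K > 0" "\<And>s x. 0 \<le> s \<Longrightarrow> s \<le> t + 1 \<Longrightarrow> norm (T s x) \<le> K * norm x"
    using local_bound by blast
  \<comment> \<open>Chosen so that \<open>K * e' + e' = e\<close>, the total of the two errors to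
    the left of \<open>t\<close>.\<close>
  define e' where "e' = e / (K + 1)"
  have e': "e' > 0" using e K by (simp add: e'_def)
  have e'': "K * e' + e' = e"
  proof -
    have "K * e' + e' = (K + 1) * e'" by (simp add: distrib_right)
    then show ?thesis using K by (simp add: e'_def)
  qed
  have "\<forall>\<^sub>F h in at_right 0. dist ((T h y - y) /\<^sub>R h) a < e'"
    using generator_tendsto[OF y] e' unfolding tendsto_iff a_def by simp
  then obtain d1 where d1: "d1 > 0" "\<And>h. 0 < h \<Longrightarrow> h < d1 \<Longrightarrow> norm ((T h y - y) /\<^sub>R h - a) < e'"
    unfolding eventually_at_right_field by (auto simp: dist_norm)
  obtain d2 where d2: "d2 > 0" "\<And>s. s \<ge> 0 \<Longrightarrow> \<bar>s - t\<bar> < d2 \<Longrightarrow> norm (T s a - T t a) < e'"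
    using continuous_on_T[of a, unfolded continuous_on_iff, rule_format, of t e'] t e'
    by (auto simp: dist_norm)
  show "\<exists>d>0. \<forall>s\<in>{0..}. norm (s - t) < d \<longrightarrow>
      norm (T s y - T t y - (s - t) *\<^sub>R T t (snd (generator T) y)) \<le> e * norm (s - t)"
  proof (intro exI[of _ "min (min d1 d2) 1"] conjI ballI impI)
    fix s :: real assume s: "s \<in> {0..}" "norm (s - t) < min (min d1 d2) 1"
    consider "s = t" | "s > t" | "s < t" by linarith
    then show "norm (T s y - T t y - (s - t) *\<^sub>R T t (snd (generator T) y)) \<le> e * norm (s - t)"
    proof cases
      case 1
      then show ?thesis by simp
    next
      case 2
      define h where "h = s - t"
      have h: "0 < h" "h < d1" using s 2 by (auto simp: h_def)
      have "T s y = T t (T h y)" using T_add[of t h y] h t by (simp add: h_def)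
      then have "T s y - T t y - (s - t) *\<^sub>R T t a = h *\<^sub>R T t ((T h y - y) /\<^sub>R h - a)"
        using h t by (simp add: T_lin scaleR_diff_right flip: h_def)
      then have "norm (T s y - T t y - (s - t) *\<^sub>R T t a) = h * norm (T t ((T h y - y) /\<^sub>R h - a))"
        using h by simp
      also have "\<dots> \<le> h * (K * e')"
        using K(2)[of t "(T h y - y) /\<^sub>R h - a"] d1(2)[OF h] h t K(1)
        by (intro mult_left_mono) (auto intro: order_trans[OF _ mult_left_mono])
      also have "\<dots> \<le> h * e" using h e' e'' by (intro mult_left_mono) auto
      finally show ?thesis using h by (simp add: a_def h_def mult.commute)
    next
      case 3
      define h where "h = t - s"
      have h: "0 < h" "h < d1" "0 \<le> s" using s 3 by (auto simp: h_def)
      have "T t y = T s (T h y)" using T_add[of s h y] h t by (simp add: h_def)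
      then have e1: "T s ((T h y - y) /\<^sub>R h - a) + (T s a - T t a) = (T t y - T s y) /\<^sub>R h - T t a"
        using h by (simp add: T_lin)
      have e2: "s - t = - h" by (simp add: h_def)
      have "T s y - T t y - (s - t) *\<^sub>R T t a
          = (- h) *\<^sub>R (T s ((T h y - y) /\<^sub>R h - a) + (T s a - T t a))"
        unfolding e1 e2 using h(1) by (simp add: scaleR_diff_right)
      then have "norm (T s y - T t y - (s - t) *\<^sub>R T t a)
          = h * norm (T s ((T h y - y) /\<^sub>R h - a) + (T s a - T t a))"
        using h by simp
      also have "\<dots> \<le> h * (K * e' + e')"
      proof (intro mult_left_mono order_trans[OF norm_triangle_ineq] add_mono)
        have "norm (T s ((T h y - y) /\<^sub>R h - a)) \<le> K * norm ((T h y - y) /\<^sub>R h - a)"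
          using K(2)[of s] s 3 by auto
        also have "\<dots> \<le> K * e'" using d1(2)[OF h(1,2)] K(1) by (intro mult_left_mono) auto
        finally show "norm (T s ((T h y - y) /\<^sub>R h - a)) \<le> K * e'" .
        show "norm (T s a - T t a) \<le> e'" using d2(2)[of s] s by auto
      qed (use h in auto)
      finally show ?thesis using h e'' by (simp add: a_def h_def mult.commute)
    qed
  qed (use d1 d2 in auto)
qed

text \<open>With \<open>y\<close> the resolvent of \<open>x\<close>, the function
  \<open>cis (- k * t) T t y\<close> has derivative \<open>- cis (- k * t) T t x\<close>, and the
  exponential returns to 1 after a full period.\<close>

lemma fourier_resolvent:
  fixes k :: int
  assumes k: "\<i> * of_int k \<in> resolvent_set (generator T)"
  shows "((\<lambda>t. cis (of_int k * (- t)) *\<^sub>C T t x) has_integral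
     resolvent (generator T) (\<i> * of_int k) (x - T (2 * pi) x)) {0..2 * pi}"
proof -
  define y where "y = resolvent (generator T) (\<i> * of_int k) x"
  have y: "y \<in> fst (generator T)" "(\<i> * of_int k) *\<^sub>C y - snd (generator T) y = x"
    using resolvent_in_domain[OF k] by (auto simp: y_def)
  define G where "G t = cis (of_int k * (- t)) *\<^sub>C T t y" for t
  have der: "(G has_vector_derivative - (cis (of_int k * (- t)) *\<^sub>C T t x)) (at t within {0..2 * pi})"
    if t: "t \<in> {0..2 * pi}" for t
  proof -
    have "((\<lambda>t. cis (of_int k * (- t))) has_vector_derivative
        (- (\<i> * of_int k) * cis (of_int k * (- t)))) (at t within {0..2 * pi})"
    proof -
      have "((\<lambda>z. exp (- (\<i> * of_int k) * z)) has_field_derivative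
          - (\<i> * of_int k) * exp (- (\<i> * of_int k) * of_real t)) (at (of_real t))"
        by (auto intro!: derivative_eq_intros)
      from has_vector_derivative_real_field[OF this] show ?thesis
        by (simp add: cis_conv_exp mult.assoc)
    qed
    moreover have "((\<lambda>t. T t y) has_vector_derivative T t (snd (generator T) y)) (at t within {0..2 * pi})"
      by (rule has_vector_derivative_within_subset[OF T_has_vector_derivative[OF y(1)]]) (use t in auto)
    ultimately have "(G has_vector_derivative cis (of_int k * (- t)) *\<^sub>C T t (snd (generator T) y)
        + (- (\<i> * of_int k) * cis (of_int k * (- t))) *\<^sub>C T t y) (at t within {0..2 * pi})"
      unfolding G_def by (rule scaleC.has_vector_derivative)
    moreover have "cis (of_int k * (- t)) *\<^sub>C T t (snd (generator T) y)
        + (- (\<i> * of_int k) * cis (of_int k * (- t))) *\<^sub>C T t y = - (cis (of_int k * (- t)) *\<^sub>C T t x)"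
      using t by (simp add: T_lin scaleC.diff_right scaleC_scaleC scaleC.minus_left mult.commute flip: y(2))
    ultimately show ?thesis by simp
  qed
  have "((\<lambda>t. - (cis (of_int k * (- t)) *\<^sub>C T t x)) has_integral (G (2 * pi) - G 0)) {0..2 * pi}"
    by (rule fundamental_theorem_of_calculus) (use der in auto)
  from has_integral_neg[OF this] have "((\<lambda>t. cis (of_int k * (- t)) *\<^sub>C T t x) has_integral (G 0 - G (2 * pi))) {0..2 * pi}"
    by simp
  moreover have "cis (of_int k * (- (2 * pi))) = 1"
    using cis_multiple_2pi[of "of_int (- k)"] by (simp add: mult.commute)
  then have "G 0 - G (2 * pi) = y - T (2 * pi) y" by (simp add: G_def)
  moreover have "y - T (2 * pi) y = resolvent (generator T) (\<i> * of_int k) (x - T (2 * pi) x)"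
    using bounded_clinearD(3)[OF resolvent_clinear[OF k]] resolvent_T[OF k, of "2 * pi" x] by (simp add: y_def)
  ultimately show ?thesis by simp
qed

section \<open>Cesaro means of the resolvents at the integer multiples of the imaginary unit\<close>

definition cesaro :: "nat \<Rightarrow> 'a \<Rightarrow> 'a"
  where "cesaro N x = (\<Sum>n<N. \<Sum>k\<in>{- int n..int n}. resolvent (generator T) (\<i> * of_int k) x) /\<^sub>R real N"

context
  assumes spec: "\<forall>k::int. \<i> * of_int k \<in> resolvent_set (generator T)"
begin

lemma cesaro_clinear: "bounded_clinear (cesaro N)"
proof -
  note R = resolvent_clinear[OF spec[rule_format]]
  have "bounded_linear (cesaro N)"
    unfolding cesaro_def
    by (intro bounded_linear_const_scaleR bounded_linear_sum bounded_clinearD(1) R)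
  moreover have "cesaro N (c *\<^sub>C x) = c *\<^sub>C cesaro N x" for c x
    by (simp add: cesaro_def bounded_clinearD(6)[OF R] scaleC.sum_right scaleC.scaleR_right)
  ultimately show ?thesis by (simp add: bounded_clinear_def)
qed

lemma cesaro_T: "t \<ge> 0 \<Longrightarrow> cesaro N (T t x) = T t (cesaro N x)"
  using spec by (simp add: cesaro_def resolvent_T T_lin)

lemma cesaro_range:
  "cesaro N (x - T (2 * pi) x) = integral {0..2 * pi} (\<lambda>t. fejer N (- t) *\<^sub>R T t x)"
  using cesaro_integral[OF continuous_on_T_Icc[of 0 "2 * pi" x], of N 0]
    integral_unique[OF fourier_resolvent[OF spec[rule_format]]]
  by (simp add: cesaro_def)

lemma cesaro_range_tendsto:
  "(\<lambda>N. cesaro N (x - T (2 * pi) x)) \<longlonglongrightarrow> pi *\<^sub>R (x + T (2 * pi) x)"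
  unfolding cesaro_range using fejer_jump[OF continuous_on_T_Icc[of 0 "2 * pi" x]] by simp

text \<open>For a fixed vector of \<open>T (2 * pi)\<close> the means in
  \<open>cesaro_range_tendsto\<close> are all 0, while their limit is \<open>2 * pi\<close> times
  the vector.\<close>

lemma inj_period: "x - T (2 * pi) x = 0 \<Longrightarrow> x = 0"
proof -
  assume *: "x - T (2 * pi) x = 0"
  have "(\<lambda>N. cesaro N 0) \<longlonglongrightarrow> pi *\<^sub>R (x + x)"
    using cesaro_range_tendsto[of x] * by simp
  then have "pi *\<^sub>R (x + x) = 0"
    using bounded_clinearD(4)[OF cesaro_clinear] by (simp add: LIMSEQ_const_iff)
  then show "x = 0" by (simp flip: scaleR_2)
qed

text \<open>Since \<open>cesaro N\<close> commutes with the semigroup, \<open>pi (x + T x)\<close> is a limit of elements of the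
  range of \<open>I - T\<close>, and so is \<open>x - T x\<close>.\<close>

lemma dense_range: "\<exists>z. norm (x - (z - T (2 * pi) z)) \<le> e" if "e > 0"
proof -
  have "2 * pi * e > 0" using that by simp
  from LIMSEQ_D[OF cesaro_range_tendsto this]
  obtain N where "norm (cesaro N (x - T (2 * pi) x) - pi *\<^sub>R (x + T (2 * pi) x)) < 2 * pi * e"
    by blast
  moreover define c where "c = cesaro N x"
  moreover have "cesaro N (x - T (2 * pi) x) = c - T (2 * pi) c"
    by (simp add: c_def bounded_clinearD(3)[OF cesaro_clinear] cesaro_T)
  \<comment> \<open>\<open>x\<close> is half of \<open>x - T (2 * pi) x\<close> plus half of
    \<open>x + T (2 * pi) x\<close>; the latter is approximated by \<open>1 / (2 * pi)\<close> times
    \<open>c - T (2 * pi) c\<close>.\<close>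
  moreover define z where "z = (1 / (2 * pi)) *\<^sub>R c + (1 / 2) *\<^sub>R x"
  have "x - (z - T (2 * pi) z) = (- 1 / (2 * pi)) *\<^sub>R (c - T (2 * pi) c - pi *\<^sub>R (x + T (2 * pi) x))"
  proof -
    have "x = (1 / 2) *\<^sub>R x + (1 / 2) *\<^sub>R x" by (simp flip: scaleR_left_distrib)
    then show ?thesis by (simp add: z_def T_lin algebra_simps)
  qed
  ultimately have "norm (x - (z - T (2 * pi) z)) \<le> 1 / (2 * pi) * (2 * pi * e)"
    by (simp add: divide_simps del: scaleR_minus_left) (simp add: mult.commute)
  then show ?thesis by auto
qed

end

end

section \<open>Improper integrals of vector-valued functions\<close>

lemma restrict_Ici_integrable:
  fixes f :: "real \<Rightarrow> 'a::banach"
  assumes "continuous_on {0..} f"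
  shows "(\<lambda>t. if t \<in> {0..} then f t else 0) integrable_on {a..b}"
proof -
  have "{0..} \<inter> {a..b} = {max 0 a..b}" by auto
  moreover have "f integrable_on {max 0 a..b}"
    by (intro integrable_continuous_interval continuous_on_subset[OF assms]) auto
  ultimately show ?thesis by (simp only: integrable_restrict_Int)
qed

text \<open>Cauchy criterion over growing intervals: the two end pieces of the integral of
  \<open>f\<close> are bounded by those of \<open>g\<close>.\<close>

lemma integrable_dominated_Ici:
  fixes f :: "real \<Rightarrow> 'a::banach"
  assumes f: "continuous_on {0..} f" and g: "g integrable_on {0..}"
    and le: "\<And>t. t \<ge> 0 \<Longrightarrow> norm (f t) \<le> g t"
  shows "f integrable_on {0..}"
proof (subst integrable_alt_subset, intro conjI allI impI)
  let ?F = "\<lambda>t. if t \<in> {0..} then f t else 0" and ?G = "\<lambda>t. if t \<in> {0..} then g t else 0"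
  have Gint: "?G integrable_on {a..b}" for a b
    using integrable_altD(1)[OF g, of a b] by simp
  have Fint: "?F integrable_on {a..b}" for a b by (rule restrict_Ici_integrable[OF f])
  show "?F integrable_on cbox a b" for a b unfolding cbox_interval by (rule Fint)
  fix e :: real assume "e > 0"
  then obtain B where B: "B > 0" "\<forall>a b c d. ball 0 B \<subseteq> cbox a b \<and> cbox a b \<subseteq> cbox c d \<longrightarrow>
      norm (integral (cbox a b) ?G - integral (cbox c d) ?G) < e"
    using iffD1[OF integrable_alt_subset g, THEN conjunct2, rule_format, of e] by meson
  show "\<exists>B>0. \<forall>a b c d. ball 0 B \<subseteq> cbox a b \<and> cbox a b \<subseteq> cbox c d \<longrightarrow>
      norm (integral (cbox a b) ?F - integral (cbox c d) ?F) < e"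
  proof (intro exI[of _ B] conjI allI impI)
    fix a b c d :: real assume *: "ball 0 B \<subseteq> cbox a b \<and> cbox a b \<subseteq> cbox c d"
    have "0 \<in> ball 0 B" using B(1) by simp
    then have "0 \<in> cbox a b" using * by blast
    then have "a \<le> b" by simp
    then have ord: "c \<le> a" "a \<le> b" "b \<le> d" using * by auto
    have split: "integral {c..d} h = integral {c..a} h + integral {a..b} h + integral {b..d} h"
      if "\<And>a b. h integrable_on {a..b}" for h :: "real \<Rightarrow> 'x::banach"
      using Henstock_Kurzweil_Integration.integral_combine[of c a d h]
        Henstock_Kurzweil_Integration.integral_combine[of a b d h] ord that by (simp add: add.assoc)
    have piece: "norm (integral {u..v} ?F) \<le> integral {u..v} ?G" for u v
      using le by (intro integral_norm_bound_integral Fint Gint) auto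
    have "integral {a..b} ?F - integral {c..d} ?F = - (integral {c..a} ?F + integral {b..d} ?F)"
      unfolding split[OF Fint] by simp
    then have "norm (integral {a..b} ?F - integral {c..d} ?F) = norm (integral {c..a} ?F + integral {b..d} ?F)"
      by (simp only: norm_minus_cancel)
    also have "\<dots> \<le> integral {c..a} ?G + integral {b..d} ?G"
      by (intro order_trans[OF norm_triangle_ineq] add_mono piece)
    also have "\<dots> \<le> norm (integral {a..b} ?G - integral {c..d} ?G)"
      unfolding split[OF Gint] by simp
    also have "\<dots> < e" using B(2)[rule_format, OF *] by simp
    finally show "norm (integral (cbox a b) ?F - integral (cbox c d) ?F) < e" by simp
  qed (rule B)
qed

lemma integral_Ici_tendsto:
  fixes f :: "real \<Rightarrow> 'a::banach"
  assumes "f integrable_on {0..}"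
  shows "(\<lambda>n. integral {0..real n} f) \<longlonglongrightarrow> integral {0..} f"
proof (rule LIMSEQ_I)
  fix e :: real assume e: "e > 0"
  let ?F = "\<lambda>t. if t \<in> {0..} then f t else 0"
  obtain B where B: "B > 0" "\<And>a b. ball 0 B \<subseteq> cbox a b \<Longrightarrow> norm (integral (cbox a b) ?F - integral {0..} f) < e"
    using integrable_integral[OF assms] e unfolding has_integral_alt' by blast
  obtain N :: nat where N: "real N > B" using reals_Archimedean2 by blast
  have "norm (integral {0..real n} f - integral {0..} f) < e" if "n \<ge> N" for n
  proof -
    have "ball 0 B \<subseteq> cbox (- real n) (real n)" using that N by (auto simp: dist_norm)
    then have "norm (integral {- real n..real n} ?F - integral {0..} f) < e" using B(2) by fastforce
    moreover have "{0..} \<inter> {- real n..real n} = {0..real n}" by auto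
    then have "integral {- real n..real n} ?F = integral {0..real n} f"
      by (simp only: integral_restrict_Int)
    ultimately show ?thesis by simp
  qed
  then show "\<exists>N. \<forall>n\<ge>N. norm (integral {0..real n} f - integral {0..} f) < e" by blast
qed

lemma has_integral_shifted_powr:
  assumes "a > 0"
  shows "((\<lambda>t. (1 + t) powr (- a - 1)) has_integral (1 / a)) {0::real..}"
proof (rule has_integral_to_inf)
  have int: "((\<lambda>t. (1 + t) powr (- a - 1)) has_integral (- ((1 + y) powr (- a) / a) - - ((1 + 0) powr (- a) / a))) {0..y}"
    if "y \<ge> 0" for y
    using assms that
    by (intro fundamental_theorem_of_calculus)
      (auto intro!: derivative_eq_intros simp flip: has_real_derivative_iff_has_vector_derivative)
  show "(\<lambda>t. (1 + t) powr (- a - 1)) integrable_on {0..y}" for y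
    by (intro integrable_continuous_interval continuous_intros) auto
  have ev: "\<forall>\<^sub>F y in at_top. 1 / a - (1 + y) powr (- a) / a = integral {0..y} (\<lambda>t. (1 + t) powr (- a - 1))"
    using eventually_ge_at_top[of 0]
  proof eventually_elim
    case (elim y)
    then show ?case using integral_unique[OF int[OF elim]] by simp
  qed
  have "((\<lambda>y. (1 + y) powr (- a)) \<longlongrightarrow> 0) at_top"
    using assms by (intro tendsto_neg_powr)
      (simp_all add: filterlim_tendsto_add_at_top[OF tendsto_const filterlim_ident])
  then have "((\<lambda>y. 1 / a - (1 + y) powr (- a) / a) \<longlongrightarrow> 1 / a - 0 / a) at_top"
    using assms by (intro tendsto_intros) auto
  then show "((\<lambda>y. integral {0..y} (\<lambda>t. (1 + t) powr (- a - 1))) \<longlongrightarrow> 1 / a) at_top"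
    using Lim_transform_eventually[OF _ ev] by simp
qed auto

section \<open>The branch of the power and the contour\<close>

text \<open>Off the cut, the argument of \<open>z\<close> in \<open>(0, 2 pi)\<close> is the
  principal argument of \<open>- z\<close> plus \<open>pi\<close>; holomorphy of the power is then
  inherited from \<open>Ln\<close>.\<close>

lemma cpow_neg_eq:
  assumes "z \<notin> \<real>\<^sub>\<ge>\<^sub>0"
  shows "cpow_neg a z = exp (- of_real a * (Ln (- z) + \<i> * of_real pi))"
proof -
  have z: "z \<noteq> 0" using assms by auto
  have "Arg2pi z > 0" using assms by (simp add: Arg2pi_gt_0)
  then have "Arg2pi z = Im (Ln (- z)) + pi" by (rule Arg2pi_Ln)
  moreover have "Re (Ln (- z)) = ln (cmod z)" using z by simp
  ultimately have "of_real (ln (cmod z)) + \<i> * of_real (Arg2pi z) = Ln (- z) + \<i> * of_real pi"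
    by (simp add: complex_eq_iff)
  then show ?thesis by (simp add: cpow_neg_def)
qed

lemma open_slit: "open (- \<real>\<^sub>\<ge>\<^sub>0 :: complex set)"
  by (simp add: open_Compl)

lemma holomorphic_on_cpow_neg: "cpow_neg a holomorphic_on - \<real>\<^sub>\<ge>\<^sub>0"
proof -
  have "(\<lambda>z. exp (- of_real a * (Ln (- z) + \<i> * of_real pi))) holomorphic_on - \<real>\<^sub>\<ge>\<^sub>0"
    by (intro holomorphic_intros) (auto simp: complex_nonpos_Reals_iff complex_nonneg_Reals_iff)
  then show ?thesis
    by (rule holomorphic_transform) (simp add: cpow_neg_eq)
qed

lemma norm_cpow_neg: "z \<noteq> 0 \<Longrightarrow> cmod (cpow_neg a z) = cmod z powr (- a)"
  by (simp add: cpow_neg_def powr_def)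

lemma cpow_neg_nonzero [simp]: "cpow_neg a z \<noteq> 0"
  by (simp add: cpow_neg_def)

text \<open>Cauchy's theorem is applied in this domain; the star centre -1 is the vertex of the
  contour.\<close>

lemma starlike_slit: "starlike (- \<real>\<^sub>\<ge>\<^sub>0 :: complex set)"
  unfolding starlike_def
proof (intro bexI[of _ "-1"] ballI subsetI)
  fix z p :: complex assume z: "z \<in> - \<real>\<^sub>\<ge>\<^sub>0" and "p \<in> closed_segment (- 1) z"
  then obtain u where u: "0 \<le> u" "u \<le> 1" "p = (1 - u) *\<^sub>R (- 1) + u *\<^sub>R z"
    by (auto simp: in_segment)
  show "p \<in> - \<real>\<^sub>\<ge>\<^sub>0"
  proof
    assume "p \<in> \<real>\<^sub>\<ge>\<^sub>0"
    then have p: "0 \<le> u - 1 + u * Re z" "u = 0 \<or> Im z = 0"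
      using u by (auto simp: complex_nonneg_Reals_iff algebra_simps)
    then have "u > 0" "Im z = 0" using u by (auto simp: less_le)
    then have "Re z < 0" using z by (auto simp: complex_nonneg_Reals_iff)
    then show False using p(1) u \<open>u > 0\<close> mult_pos_neg[of u "Re z"] by linarith
  qed
qed (auto simp: complex_nonneg_Reals_iff)

definition ray :: "real \<Rightarrow> real \<Rightarrow> complex"
  where "ray \<phi> t = - 1 + of_real t * cis \<phi>"

lemma continuous_on_ray [continuous_intros]: "continuous_on S (ray \<phi>)"
  unfolding ray_def by (intro continuous_intros)

text \<open>The inequality turns closedness of the sector and star-shapedness of its complement into
  linear estimates. In the converse direction the angle is recovered as an arctangent, which uses
  \<open>\<theta> < pi / 2\<close>.\<close>

lemma sector_iff:
  assumes "0 < \<theta>" "\<theta> < pi / 2"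
  shows "z \<in> sector \<theta> \<longleftrightarrow> \<bar>Im z\<bar> * cos \<theta> \<le> sin \<theta> * (Re z + 1)"
proof
  have c: "cos \<theta> > 0" "sin \<theta> > 0" using assms by (auto intro: cos_gt_zero sin_gt_zero)
  {
    assume "z \<in> sector \<theta>"
    then obtain r \<phi> where z: "z = - 1 + of_real r * cis \<phi>" "0 \<le> r" "\<bar>\<phi>\<bar> \<le> \<theta>"
      by (auto simp: sector_def)
    have "0 \<le> sin (\<theta> - \<bar>\<phi>\<bar>)" using z assms by (intro sin_ge_zero) auto
    then have "sin \<bar>\<phi>\<bar> * cos \<theta> \<le> sin \<theta> * cos \<phi>"
      by (simp add: sin_diff mult.commute)
    moreover have "sin \<bar>\<phi>\<bar> = \<bar>sin \<phi>\<bar>"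
    proof (cases "\<phi> \<ge> 0")
      case True
      then show ?thesis using z assms sin_ge_zero[of \<phi>] by simp
    next
      case False
      then show ?thesis using z assms sin_ge_zero[of "- \<phi>"] by simp
    qed
    ultimately have "r * (\<bar>sin \<phi>\<bar> * cos \<theta>) \<le> r * (sin \<theta> * cos \<phi>)"
      using z by (intro mult_left_mono) auto
    then show "\<bar>Im z\<bar> * cos \<theta> \<le> sin \<theta> * (Re z + 1)"
      using z by (simp add: abs_mult mult_ac)
  }
  assume *: "\<bar>Im z\<bar> * cos \<theta> \<le> sin \<theta> * (Re z + 1)"
  define w where "w = z + 1"
  have w: "\<bar>Im w\<bar> * cos \<theta> \<le> sin \<theta> * Re w" using * by (simp add: w_def)
  have "0 \<le> \<bar>Im w\<bar> * cos \<theta>" using c by simp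
  with w have "0 \<le> sin \<theta> * Re w" by linarith
  then have Re: "Re w \<ge> 0" using c by (simp add: zero_le_mult_iff)
  show "z \<in> sector \<theta>"
  proof (cases "w = 0")
    case True
    then have "z = - 1 + of_real 0 * cis 0" by (simp add: w_def eq_neg_iff_add_eq_0)
    then show ?thesis unfolding sector_def using assms
      by (intro CollectI exI[of _ 0] conjI) auto
  next
    case False
    have "Re w \<noteq> 0"
    proof
      assume "Re w = 0"
      then have "\<bar>Im w\<bar> * cos \<theta> \<le> 0" using w by simp
      then have "Im w = 0" using c by (simp add: mult_le_0_iff)
      then show False using \<open>Re w = 0\<close> False by (simp add: complex_eq_iff)
    qed
    with Re have Rw: "Re w > 0" by simp
    have "\<bar>Im w / Re w\<bar> \<le> tan \<theta>"
      using w Rw c by (simp add: tan_def field_simps abs_divide)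
    then have 1: "Im w / Re w \<le> tan \<theta>" "- (Im w / Re w) \<le> tan \<theta>" by linarith+
    have at: "arctan (tan \<theta>) = \<theta>" using assms by (intro arctan_tan) auto
    have "\<bar>arctan (Im w / Re w)\<bar> \<le> \<theta>"
      using arctan_monotone'[OF 1(1)] arctan_monotone'[OF 1(2)] at by (simp add: arctan_minus)
    moreover have "Arg w = arctan (Im w / Re w)" using Rw by (rule arg_conv_arctan)
    ultimately have "\<bar>Arg w\<bar> \<le> \<theta>" by simp
    moreover have "z = - 1 + of_real (cmod w) * cis (Arg w)"
      using rcis_cmod_Arg[of w] by (simp add: rcis_def w_def)
    ultimately show ?thesis unfolding sector_def by (blast intro: norm_ge_zero)
  qed
qed

locale contour_angle =
  fixes \<theta> :: real
  assumes \<theta>: "0 < \<theta>" "\<theta> < pi / 6"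
begin

lemma cos_sin_pos: "cos \<theta> > 0" "sin \<theta> > 0"
proof -
  have "\<theta> < pi / 2" "\<theta> < pi" using \<theta> pi_gt_zero by linarith+
  then show "cos \<theta> > 0" "sin \<theta> > 0" using \<theta> by (auto intro: cos_gt_zero sin_gt_zero)
qed

lemma sector_iff': "z \<in> sector \<theta> \<longleftrightarrow> \<bar>Im z\<bar> * cos \<theta> \<le> sin \<theta> * (Re z + 1)"
proof (rule sector_iff)
  show "\<theta> < pi / 2" using \<theta> pi_gt_zero by linarith
qed (rule \<theta>)

lemma closed_sector: "closed (sector \<theta>)"
proof -
  have "sector \<theta> = {z. \<bar>Im z\<bar> * cos \<theta> \<le> sin \<theta> * (Re z + 1)}" using sector_iff' by blast
  then show ?thesis by (auto intro!: closed_Collect_le continuous_intros)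
qed

text \<open>Connectedness, here through the star centre -2, is what the identity theorem in
  \<open>pow_transform_diff\<close> requires.\<close>

lemma connected_sector_compl: "connected (- sector \<theta>)"
proof (rule starlike_imp_connected)
  show "starlike (- sector \<theta>)" unfolding starlike_def
  proof (intro bexI[of _ "-2"] ballI subsetI)
    fix z p assume z: "z \<in> - sector \<theta>" and "p \<in> closed_segment (- 2) z"
    then obtain u where u: "0 \<le> u" "u \<le> 1" "p = (1 - u) *\<^sub>R (- 2) + u *\<^sub>R z"
      by (auto simp: in_segment)
    have z': "sin \<theta> * (Re z + 1) < \<bar>Im z\<bar> * cos \<theta>" using z by (simp add: sector_iff')
    have Rp: "Re p + 1 = u * (Re z + 1) - (1 - u)" unfolding u(3) by (simp add: algebra_simps)
    have Ip: "\<bar>Im p\<bar> = u * \<bar>Im z\<bar>" unfolding u(3) using u(1) by (simp add: abs_mult)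
    have "sin \<theta> * (u * (Re z + 1) - (1 - u)) < u * \<bar>Im z\<bar> * cos \<theta>"
    proof (cases "u = 0")
      case True
      then show ?thesis using cos_sin_pos by simp
    next
      case False
      then have "u * (sin \<theta> * (Re z + 1)) < u * (\<bar>Im z\<bar> * cos \<theta>)" using u z' by simp
      moreover have "sin \<theta> * (1 - u) \<ge> 0" using u cos_sin_pos by simp
      ultimately show ?thesis by (simp add: algebra_simps)
    qed
    then show "p \<in> - sector \<theta>" by (simp add: sector_iff' Rp Ip)
  qed (use cos_sin_pos in \<open>simp add: sector_iff'\<close>)
qed

lemma of_real_in_sector: "x \<ge> -1 \<Longrightarrow> of_real x \<in> sector \<theta>"
  using cos_sin_pos by (simp add: sector_iff')

lemma of_real_notin_sector: "x < -1 \<Longrightarrow> of_real x \<notin> sector \<theta>"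
  using cos_sin_pos by (simp add: sector_iff' not_le mult_pos_neg)

lemma sector_compl_subset_slit: "- sector \<theta> \<subseteq> - \<real>\<^sub>\<ge>\<^sub>0"
proof -
  have "x \<in> sector \<theta>" if "x \<in> \<real>\<^sub>\<ge>\<^sub>0" for x
    using that of_real_in_sector[of "Re x"] by (auto simp: nonneg_Reals_def)
  then show ?thesis by blast
qed

lemma ray_in_sector: "\<bar>\<phi>\<bar> = \<theta> \<Longrightarrow> t \<ge> 0 \<Longrightarrow> ray \<phi> t \<in> sector \<theta>"
  by (auto simp: sector_def ray_def)

lemma cos_ray: "\<bar>\<phi>\<bar> = \<theta> \<Longrightarrow> cos \<phi> = cos \<theta>"
  by (metis cos_abs_real)

lemma sin_ray: "\<bar>\<phi>\<bar> = \<theta> \<Longrightarrow> sin \<phi> \<noteq> 0"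
  using cos_sin_pos by (metis abs_if neg_equal_0_iff_equal order_less_irrefl sin_minus)

lemma ray_in_slit: "\<bar>\<phi>\<bar> = \<theta> \<Longrightarrow> t \<ge> 0 \<Longrightarrow> ray \<phi> t \<in> - \<real>\<^sub>\<ge>\<^sub>0"
  using sin_ray[of \<phi>] by (cases "t = 0") (auto simp: complex_nonneg_Reals_iff ray_def)

text \<open>The squared modulus is the combination of \<open>(1 + t)^2\<close> and
  \<open>(1 - t)^2\<close> with weights \<open>sin (\<theta> / 2)^2\<close> and
  \<open>cos (\<theta> / 2)^2\<close>; the second term is dropped. So the rays stay away from the
  branch point 0 and the power decays like \<open>(1 + t) powr (- a)\<close>.\<close>

lemma norm_ray_ge:
  assumes "\<bar>\<phi>\<bar> = \<theta>" "t \<ge> 0"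
  shows "sin (\<theta> / 2) * (1 + t) \<le> cmod (ray \<phi> t)"
proof (rule power2_le_imp_le)
  have "(cmod (ray \<phi> t))\<^sup>2 = (t * cos \<theta> - 1)\<^sup>2 + (t * sin \<phi>)\<^sup>2"
    by (simp add: cmod_power2 ray_def cos_ray[OF assms(1)])
  also have "\<dots> = 1 - 2 * t * cos \<theta> + t\<^sup>2 * ((cos \<phi>)\<^sup>2 + (sin \<phi>)\<^sup>2)"
    by (simp add: cos_ray[OF assms(1)] power2_eq_square algebra_simps)
  also have "\<dots> = 1 - 2 * t * cos \<theta> + t\<^sup>2" by simp
  also have "\<dots> = (1 - cos \<theta>) / 2 * (1 + t)\<^sup>2 + (1 + cos \<theta>) / 2 * (1 - t)\<^sup>2"
    by (simp add: power2_eq_square field_simps)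
  also have "\<dots> \<ge> (1 - cos \<theta>) / 2 * (1 + t)\<^sup>2"
    using cos_sin_pos by simp
  also have "(1 - cos \<theta>) / 2 = (sin (\<theta> / 2))\<^sup>2"
    using cos_double_sin[of "\<theta> / 2"] by simp
  finally show "(sin (\<theta> / 2) * (1 + t))\<^sup>2 \<le> (cmod (ray \<phi> t))\<^sup>2" by (simp add: power_mult_distrib)
qed simp

lemma sin_half_pos: "sin (\<theta> / 2) > 0"
  using \<theta> pi_gt_zero by (intro sin_gt_zero) linarith+

lemma norm_cpow_neg_ray_le:
  assumes "\<bar>\<phi>\<bar> = \<theta>" "t \<ge> 0" "a > 0"
  shows "cmod (cpow_neg a (ray \<phi> t)) \<le> sin (\<theta> / 2) powr (- a) * (1 + t) powr (- a)"
proof -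
  have *: "0 < sin (\<theta> / 2) * (1 + t)" using sin_half_pos assms by simp
  then have "ray \<phi> t \<noteq> 0" using norm_ray_ge[OF assms(1,2)] by auto
  then have "cmod (cpow_neg a (ray \<phi> t)) = cmod (ray \<phi> t) powr (- a)" by (rule norm_cpow_neg)
  also have "\<dots> \<le> (sin (\<theta> / 2) * (1 + t)) powr (- a)"
    using norm_ray_ge[OF assms(1,2)] * assms by (intro powr_mono2') auto
  also have "\<dots> = sin (\<theta> / 2) powr (- a) * (1 + t) powr (- a)"
    using sin_half_pos assms by (intro powr_mult)
  finally show ?thesis .
qed

lemma continuous_on_cpow_neg_ray:
  assumes "\<bar>\<phi>\<bar> = \<theta>"
  shows "continuous_on {0..} (\<lambda>t. cpow_neg a (ray \<phi> t))"
proof (rule continuous_on_compose2[OF holomorphic_on_imp_continuous_on[OF holomorphic_on_cpow_neg]])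
  show "ray \<phi> ` {0..} \<subseteq> - \<real>\<^sub>\<ge>\<^sub>0" using ray_in_slit[OF assms] by blast
qed (rule continuous_on_ray)

end

section \<open>The Cauchy integral of a power along the contour\<close>

text \<open>Stated for an abstract density \<open>\<psi>\<close> along a path \<open>p\<close> in a
  closed set \<open>S\<close>, because it is applied both to a damped power and to functionals of
  the resolvent integrand. Holomorphy comes from a direct estimate of the difference
  quotient.\<close>

lemma cauchy_kernel:
  fixes \<psi> p :: "real \<Rightarrow> complex" and g :: "real \<Rightarrow> real"
  assumes \<psi>: "continuous_on {0..} \<psi>" and p: "continuous_on {0..} p"
    and S: "closed S" "\<And>t. t \<ge> 0 \<Longrightarrow> p t \<in> S"
    and g: "g integrable_on {0..}" "\<And>t. t \<ge> 0 \<Longrightarrow> cmod (\<psi> t) \<le> g t"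
  shows cauchy_kernel_integrable: "l \<notin> S \<Longrightarrow> (\<lambda>t. \<psi> t / (p t - l)) integrable_on {0..}"
    and cauchy_kernel_bound: "d > 0 \<Longrightarrow> (\<And>z. z \<in> S \<Longrightarrow> d \<le> cmod (z - l))
      \<Longrightarrow> cmod (integral {0..} (\<lambda>t. \<psi> t / (p t - l))) \<le> integral {0..} g / d"
    and cauchy_kernel_holomorphic: "(\<lambda>l. integral {0..} (\<lambda>t. \<psi> t / (p t - l))) holomorphic_on - S"
proof -
  have g0: "g t \<ge> 0" if "t \<ge> 0" for t using g(2)[OF that] norm_ge_zero order_trans by blast
  have dist: "\<exists>d>0. \<forall>z\<in>S. d \<le> cmod (z - l)" if l: "l \<notin> S" for l
  proof -
    obtain d where "d > 0" "ball l d \<subseteq> - S" using S(1) l open_contains_ball[of "- S"] by auto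
    then show ?thesis by (intro exI[of _ d]) (force simp: subset_iff dist_norm norm_minus_commute not_less)
  qed
  have int: "(\<lambda>t. \<psi> t / (p t - l)) integrable_on {0..}" (is ?I)
    and bd: "cmod (integral {0..} (\<lambda>t. \<psi> t / (p t - l))) \<le> integral {0..} g / d" (is ?B)
    if d: "d > 0" "\<And>z. z \<in> S \<Longrightarrow> d \<le> cmod (z - l)" for l d
  proof -
    have le: "cmod (\<psi> t / (p t - l)) \<le> g t / d" if "t \<ge> 0" for t
      using g(2)[OF that] d(1) d(2)[OF S(2)[OF that]] g0[OF that]
      by (simp add: norm_divide frac_le)
    have nz: "p t - l \<noteq> 0" if "t \<ge> 0" for t using d(1) d(2)[OF S(2)[OF that]] by auto
    show ?I
      by (rule integrable_dominated_Ici[where g = "\<lambda>t. g t / d"])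
        (auto intro!: continuous_intros \<psi> p le g(1) integrable_on_divide simp: nz[simplified])
    then have "cmod (integral {0..} (\<lambda>t. \<psi> t / (p t - l))) \<le> integral {0..} (\<lambda>t. g t / d)"
      by (rule integral_norm_bound_integral) (auto intro!: le g(1) integrable_on_divide)
    then show ?B by simp
  qed
  show "l \<notin> S \<Longrightarrow> (\<lambda>t. \<psi> t / (p t - l)) integrable_on {0..}"
    using dist int by blast
  show "cmod (integral {0..} (\<lambda>t. \<psi> t / (p t - l))) \<le> integral {0..} g / d"
    if "d > 0" "\<And>z. z \<in> S \<Longrightarrow> d \<le> cmod (z - l)" using bd that by blast
  show "(\<lambda>l. integral {0..} (\<lambda>t. \<psi> t / (p t - l))) holomorphic_on - S" (is "?G holomorphic_on _")
  proof (rule holomorphic_onI)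
    fix l assume "l \<in> - S"
    then obtain d where d: "d > 0" "\<And>z. z \<in> S \<Longrightarrow> d \<le> cmod (z - l)" using dist by blast
    have ptl: "d \<le> cmod (p t - l)" "p t - l \<noteq> 0" if "t \<ge> 0" for t
      using d(1) d(2)[OF S(2)[OF that]] by auto
    define D where "D = integral {0..} (\<lambda>t. \<psi> t / (p t - l)\<^sup>2)"
    have Dint: "(\<lambda>t. \<psi> t / (p t - l)\<^sup>2) integrable_on {0..}"
    proof (rule integrable_dominated_Ici[where g = "\<lambda>t. g t / d\<^sup>2"])
      show "norm (\<psi> t / (p t - l)\<^sup>2) \<le> g t / d\<^sup>2" if "t \<ge> 0" for t
        using g(2)[OF that] d(1) ptl[OF that] g0[OF that]
        by (simp add: norm_divide norm_power frac_le power_mono)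
    qed (auto intro!: continuous_intros \<psi> p g(1) integrable_on_divide simp: ptl(2)[simplified])
    \<comment> \<open>The difference quotient minus its limit is \<open>m - l\<close> times the
      integral of \<open>\<psi> / ((p - m) * (p - l)^2)\<close>. For \<open>m\<close> within
      \<open>d / 2\<close> of \<open>l\<close> the path keeps distance \<open>d / 2\<close> from
      \<open>m\<close>, which gives this constant.\<close>
    define K where "K = integral {0..} g / (d / 2 * d\<^sup>2)"
    have est: "cmod ((?G m - ?G l) / (m - l) - D) \<le> K * cmod (m - l)" if m: "m \<noteq> l" "cmod (m - l) < d / 2" for m
    proof -
      have dm: "d / 2 \<le> cmod (z - m)" if "z \<in> S" for z
        using d(2)[OF that] m norm_triangle_ineq[of "z - m" "m - l"] by simp
      have ptm: "d / 2 \<le> cmod (p t - m)" "p t - m \<noteq> 0" if "t \<ge> 0" for t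
        using d(1) dm[OF S(2)[OF that]] by auto
      have im: "(\<lambda>t. \<psi> t / (p t - m)) integrable_on {0..}" using int[of "d / 2" m] d dm by simp
      have il: "(\<lambda>t. \<psi> t / (p t - l)) integrable_on {0..}" using int[of d l] d by simp
      have "((\<lambda>t. (\<psi> t / (p t - m) - \<psi> t / (p t - l)) / (m - l) - \<psi> t / (p t - l)\<^sup>2) has_integral
          (?G m - ?G l) / (m - l) - D) {0..}"
        unfolding D_def
        by (intro has_integral_diff has_integral_divide integrable_integral im il Dint)
      moreover have "(\<psi> t / (p t - m) - \<psi> t / (p t - l)) / (m - l) - \<psi> t / (p t - l)\<^sup>2
          = (m - l) * (\<psi> t / ((p t - m) * (p t - l)\<^sup>2))" if "t \<in> {0..}" for t
      proof -
        have alg: "(q / u - q / v) / (v - u) - q / v\<^sup>2 = (v - u) * (q / (u * v\<^sup>2))"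
          if "u \<noteq> 0" "v \<noteq> 0" "v - u \<noteq> 0" for q u v :: complex
        proof -
          have "q / u - q / v = (v - u) * (q / (u * v))"
            using that by (simp add: divide_simps) (simp add: algebra_simps)
          then have "(q / u - q / v) / (v - u) = q / (u * v)" using that(3) by simp
          then show ?thesis using that
            by (simp add: divide_simps power2_eq_square)
        qed
        have "(p t - l) - (p t - m) = m - l" by simp
        then show ?thesis using alg[of "p t - m" "p t - l" "\<psi> t"] ptm(2)[of t] ptl(2)[of t] that m by simp
      qed
      ultimately have hi: "((\<lambda>t. (m - l) * (\<psi> t / ((p t - m) * (p t - l)\<^sup>2))) has_integral
          (?G m - ?G l) / (m - l) - D) {0..}"
        by (rule has_integral_eq[rotated])
      have "cmod (integral {0..} (\<lambda>t. (m - l) * (\<psi> t / ((p t - m) * (p t - l)\<^sup>2))))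
          \<le> integral {0..} (\<lambda>t. cmod (m - l) * (g t / (d / 2 * d\<^sup>2)))"
      proof (rule integral_norm_bound_integral)
        show "(\<lambda>t. (m - l) * (\<psi> t / ((p t - m) * (p t - l)\<^sup>2))) integrable_on {0..}"
          using hi by blast
        show "(\<lambda>t. cmod (m - l) * (g t / (d / 2 * d\<^sup>2))) integrable_on {0..}"
          by (intro integrable_on_mult_right integrable_on_divide g)
        fix t :: real assume "t \<in> {0..}"
        then have t: "t \<ge> 0" by simp
        have "cmod (\<psi> t / ((p t - m) * (p t - l)\<^sup>2)) \<le> g t / (d / 2 * d\<^sup>2)"
          unfolding norm_divide norm_mult norm_power
          using g(2)[OF t] g0[OF t] ptm[OF t] ptl[OF t] d(1)
          by (intro frac_le mult_mono power_mono) auto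
        then show "cmod ((m - l) * (\<psi> t / ((p t - m) * (p t - l)\<^sup>2))) \<le> cmod (m - l) * (g t / (d / 2 * d\<^sup>2))"
          unfolding norm_mult by (intro mult_left_mono) auto
      qed
      also have "\<dots> = K * cmod (m - l)" by (simp add: K_def)
      finally show ?thesis using integral_unique[OF hi] by simp
    qed
    have "((\<lambda>m. (?G m - ?G l) / (m - l) - D) \<longlongrightarrow> 0) (at l)"
    proof (rule Lim_null_comparison)
      show "\<forall>\<^sub>F m in at l. norm ((?G m - ?G l) / (m - l) - D) \<le> K * cmod (m - l)"
        unfolding eventually_at using d(1) est by (intro exI[of _ "d / 2"]) (auto simp: dist_norm)
      have "((\<lambda>m. K * cmod (m - l)) \<longlongrightarrow> K * cmod (l - l)) (at l)" by (intro tendsto_intros)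
      then show "((\<lambda>m. K * cmod (m - l)) \<longlongrightarrow> 0) (at l)" by simp
    qed
    then have "(?G has_field_derivative D) (at l)"
      unfolding has_field_derivative_iff by (simp add: LIM_zero_iff)
    then show "?G field_differentiable at l within - S"
      using field_differentiable_at_within field_differentiable_def by blast
  qed
qed

lemma contour_integral_ray:
  assumes "r > 0" "(f has_contour_integral i) (linepath (- 1) (ray \<phi> r))"
  shows "((\<lambda>t. f (ray \<phi> t) * cis \<phi>) has_integral i) {0..r}"
proof -
  have "((\<lambda>x. f (linepath (- 1) (ray \<phi> r) x) * (of_real r * cis \<phi>)) has_integral i) (cbox 0 1)"
    using assms(2) unfolding has_contour_integral_linepath by (simp add: ray_def)
  from has_integral_affinity'[OF this, of "1 / r" 0] assms(1)
  have "((\<lambda>t. f (linepath (- 1) (ray \<phi> r) (t / r)) * (of_real r * cis \<phi>)) has_integral (r *\<^sub>R i)) {0..r}"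
    by (simp add: divide_inverse mult.commute)
  moreover have "linepath (- 1) (ray \<phi> r) (t / r) = ray \<phi> t" for t
    using assms(1) by (simp add: linepath_def ray_def algebra_simps scaleR_conv_of_real)
  ultimately have "((\<lambda>t. f (ray \<phi> t) * (of_real r * cis \<phi>)) has_integral (r *\<^sub>R i)) {0..r}"
    by simp
  from has_integral_cmul[OF this, of "1 / r"] show ?thesis
    using assms(1) by (simp add: scaleR_conv_of_real mult_ac)
qed

context contour_angle
begin

text \<open>The power alone decays like \<open>t powr (- a)\<close>, which is not integrable for
  small \<open>a\<close>. Division by \<open>z + 2\<close>, where -2 lies outside the sector,
  supplies one more order of decay, so that \<open>cauchy_kernel\<close> applies.\<close>

lemma cpow_kernel_bound:
  assumes "a > 0"
  obtains D where "D > 0"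
    "\<And>\<phi> t. \<bar>\<phi>\<bar> = \<theta> \<Longrightarrow> t \<ge> 0 \<Longrightarrow> cmod (cpow_neg a (ray \<phi> t) * cis \<phi> / (ray \<phi> t + 2)) \<le> D * (1 + t) powr (- a - 1)"
proof -
  define D where "D = sin (\<theta> / 2) powr (- a) / cos \<theta>"
  have "D > 0" using sin_half_pos cos_sin_pos by (simp add: D_def)
  moreover have "cmod (cpow_neg a (ray \<phi> t) * cis \<phi> / (ray \<phi> t + 2)) \<le> D * (1 + t) powr (- a - 1)"
    if \<phi>: "\<bar>\<phi>\<bar> = \<theta>" and t: "t \<ge> 0" for \<phi> t
  proof -
    have "cos \<theta> * (1 + t) \<le> Re (ray \<phi> t + 2)"
      using cos_ray[OF \<phi>] cos_le_one[of \<theta>] by (simp add: ray_def algebra_simps)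
    also have "\<dots> \<le> cmod (ray \<phi> t + 2)" by (rule complex_Re_le_cmod)
    finally have "cmod (cpow_neg a (ray \<phi> t)) / cmod (ray \<phi> t + 2)
        \<le> (sin (\<theta> / 2) powr (- a) * (1 + t) powr (- a)) / (cos \<theta> * (1 + t))"
      using norm_cpow_neg_ray_le[OF \<phi> t assms] cos_sin_pos t by (intro frac_le) auto
    also have "\<dots> = D * (1 + t) powr (- a - 1)"
      using t by (simp add: D_def powr_diff)
    finally show ?thesis by (simp add: norm_divide norm_mult)
  qed
  ultimately show ?thesis using that by blast
qed

definition pow_transform :: "real \<Rightarrow> real \<Rightarrow> complex \<Rightarrow> complex"
  where "pow_transform a \<phi> l = integral {0..} (\<lambda>t. cpow_neg a (ray \<phi> t) * cis \<phi> / (ray \<phi> t - l))"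

text \<open>Writing \<open>z + 2 = (z - l) + (l + 2)\<close> splits the kernel into the damped
  density \<open>\<psi>\<close> and \<open>l + 2\<close> times its Cauchy kernel, both of which are
  integrable.\<close>

lemma
  assumes a: "a > 0" and \<phi>: "\<bar>\<phi>\<bar> = \<theta>"
  shows pow_transform_integrable:
      "l \<notin> sector \<theta> \<Longrightarrow> (\<lambda>t. cpow_neg a (ray \<phi> t) * cis \<phi> / (ray \<phi> t - l)) integrable_on {0..}"
    and pow_transform_holomorphic: "pow_transform a \<phi> holomorphic_on - sector \<theta>"
proof -
  define \<psi> where "\<psi> t = cpow_neg a (ray \<phi> t) * cis \<phi> / (ray \<phi> t + 2)" for t
  obtain D where D: "D > 0" "\<And>t. t \<ge> 0 \<Longrightarrow> cmod (\<psi> t) \<le> D * (1 + t) powr (- a - 1)"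
    using cpow_kernel_bound[OF a] \<phi> unfolding \<psi>_def by metis
  have nz: "ray \<phi> t + 2 \<noteq> 0" if "t \<ge> 0" for t
  proof
    assume "ray \<phi> t + 2 = 0"
    then have "ray \<phi> t = of_real (- 2)" by (simp add: eq_neg_iff_add_eq_0)
    then show False using ray_in_sector[OF \<phi> that] of_real_notin_sector[of "-2"] by simp
  qed
  have c\<psi>: "continuous_on {0..} \<psi>"
    unfolding \<psi>_def using nz by (intro continuous_intros continuous_on_cpow_neg_ray \<phi>) auto
  have g: "(\<lambda>t. D * (1 + t) powr (- a - 1)) integrable_on {0..}"
    using has_integral_shifted_powr[OF a] by (intro integrable_on_mult_right) blast
  note kernel = cauchy_kernel[OF c\<psi> continuous_on_ray closed_sector ray_in_sector[OF \<phi>] g D(2)]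
  have \<psi>int: "\<psi> integrable_on {0..}"
    by (rule integrable_dominated_Ici[OF c\<psi> g]) (rule D(2))
  have eq: "\<psi> t + (l + 2) * (\<psi> t / (ray \<phi> t - l)) = cpow_neg a (ray \<phi> t) * cis \<phi> / (ray \<phi> t - l)"
    if "l \<notin> sector \<theta>" "t \<in> {0..}" for l t
  proof -
    have "ray \<phi> t - l \<noteq> 0" using ray_in_sector[OF \<phi>, of t] that by auto
    moreover have "q + w * (q / u) = q * (u + w) / u" if "u \<noteq> 0" for q u w :: complex
      using that by (simp add: field_simps)
    ultimately have "\<psi> t + (l + 2) * (\<psi> t / (ray \<phi> t - l)) = \<psi> t * (ray \<phi> t + 2) / (ray \<phi> t - l)"
      by (simp add: add.commute)
    also have "\<psi> t * (ray \<phi> t + 2) = cpow_neg a (ray \<phi> t) * cis \<phi>"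
      using nz[of t] that by (simp add: \<psi>_def)
    finally show ?thesis .
  qed
  have hi: "((\<lambda>t. cpow_neg a (ray \<phi> t) * cis \<phi> / (ray \<phi> t - l)) has_integral
      integral {0..} \<psi> + (l + 2) * integral {0..} (\<lambda>t. \<psi> t / (ray \<phi> t - l))) {0..}"
    if l: "l \<notin> sector \<theta>" for l
    by (rule has_integral_eq[OF eq[OF l]])
      (assumption, intro has_integral_add has_integral_mult_right integrable_integral \<psi>int kernel(1) l)
  show "l \<notin> sector \<theta> \<Longrightarrow> (\<lambda>t. cpow_neg a (ray \<phi> t) * cis \<phi> / (ray \<phi> t - l)) integrable_on {0..}"
    using hi by blast
  have "(\<lambda>l. integral {0..} \<psi> + (l + 2) * integral {0..} (\<lambda>t. \<psi> t / (ray \<phi> t - l))) holomorphic_on - sector \<theta>"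
    by (intro holomorphic_intros kernel(3))
  then show "pow_transform a \<phi> holomorphic_on - sector \<theta>"
    by (rule holomorphic_transform) (use integral_unique[OF hi] in \<open>auto simp: pow_transform_def\<close>)
qed

text \<open>In this range of angles the circle about -1 meets the real axis only at angle
  \<open>pi\<close>, in the point \<open>- 1 - r\<close>, which lies to the left of
  \<open>c\<close>.\<close>

lemma arc_slit:
  assumes "\<theta> \<le> x" "x \<le> 2 * pi - \<theta>" "r > 0" "c > - 1 - r"
  shows "- 1 + of_real r * cis x - of_real c \<notin> \<real>\<^sub>\<ge>\<^sub>0"
proof
  assume *: "- 1 + of_real r * cis x - of_real c \<in> \<real>\<^sub>\<ge>\<^sub>0"
  have x: "0 < x" "x < 2 * pi" using assms \<theta> by auto
  have "sin x = 0" using * assms by (auto simp: complex_nonneg_Reals_iff)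
  then have "x = pi"
    using x sin_gt_zero[of x] sin_lt_zero[of x] by (cases x pi rule: linorder_cases) auto
  then show False using * assms by (auto simp: complex_nonneg_Reals_iff)
qed

text \<open>On the closed curve made of both truncated rays and the circular arc to the left of them,
  Cauchy's theorem applies to the difference quotient of the power, and \<open>1 / (z - l)\<close> is
  integrated by means of \<open>Ln (z - l)\<close> on the rays and \<open>Ln (l - z)\<close> on the arc.\<close>

lemma pow_transform_truncated:
  assumes a: "a > 0" and l: "l < - 1" and r: "r > 1" "l > - 1 - r"
  shows "cmod (integral {0..r} (\<lambda>t. cpow_neg a (ray \<theta> t) * cis \<theta> / (ray \<theta> t - of_real l))
      - integral {0..r} (\<lambda>t. cpow_neg a (ray (- \<theta>) t) * cis (- \<theta>) / (ray (- \<theta>) t - of_real l))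
      - 2 * of_real pi * \<i> * cpow_neg a (of_real l))
    \<le> (r - 1) powr (- a) / (r + 1 + l) * r * (2 * pi)"
proof -
  define m where "m = cpow_neg a"
  define \<kappa> :: complex where "\<kappa> = of_real l"
  define F where "F z = m z / (z - \<kappa>)" for z
  \<comment> \<open>The difference quotient has a removable singularity at \<open>\<kappa>\<close>,
    so it is holomorphic on the whole slit plane and integrates to 0 around the closed
    curve.\<close>
  define H where "H z = (if z = \<kappa> then deriv m \<kappa> else (m z - m \<kappa>) / (z - \<kappa>))" for z
  define P Q where "P = ray \<theta> r" and "Q = ray (- \<theta>) r"
  define arc where "arc = part_circlepath (- 1) r \<theta> (2 * pi - \<theta>)"
  have Hh: "H holomorphic_on - \<real>\<^sub>\<ge>\<^sub>0"
    unfolding H_def m_def by (intro pole_lemma_open holomorphic_on_cpow_neg open_slit)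
  have FH: "F z = H z + m \<kappa> * (1 / (z - \<kappa>))" if "z \<noteq> \<kappa>" for z
    using that by (simp add: F_def H_def diff_divide_distrib)
  have arc_ends: "pathstart arc = P" "pathfinish arc = Q"
  proof -
    show "pathstart arc = P" by (simp add: arc_def P_def ray_def cis_conv_exp)
    have "cis (2 * pi - \<theta>) = cis (- \<theta>)" by (simp add: complex_eq_iff)
    then show "pathfinish arc = Q"
      by (simp only: arc_def Q_def ray_def pathfinish_part_circlepath flip: cis_conv_exp)
  qed
  have arc_pt: "\<exists>x. \<theta> \<le> x \<and> x \<le> 2 * pi - \<theta> \<and> z = - 1 + of_real r * cis x" if "z \<in> path_image arc" for z
    using that \<theta> unfolding arc_def by (subst (asm) path_image_part_circlepath) (auto simp: cis_conv_exp)
  have arc1: "z \<in> - \<real>\<^sub>\<ge>\<^sub>0" "\<kappa> - z \<notin> \<real>\<^sub>\<le>\<^sub>0" "z \<noteq> \<kappa>" if z: "z \<in> path_image arc" for z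
  proof -
    obtain x where x: "\<theta> \<le> x" "x \<le> 2 * pi - \<theta>" "z = - 1 + of_real r * cis x" using arc_pt[OF z] by blast
    show "z \<in> - \<real>\<^sub>\<ge>\<^sub>0" using arc_slit[OF x(1,2), of r 0] r x(3) by simp
    have "z - \<kappa> \<notin> \<real>\<^sub>\<ge>\<^sub>0" using arc_slit[OF x(1,2), of r l] r x(3) by (simp add: \<kappa>_def)
    then show "\<kappa> - z \<notin> \<real>\<^sub>\<le>\<^sub>0" "z \<noteq> \<kappa>"
      by (auto simp: complex_nonneg_Reals_iff complex_nonpos_Reals_iff)
  qed
  have seg_pt: "\<exists>t. 0 \<le> t \<and> z = ray \<phi> t" if z: "z \<in> closed_segment (- 1) (ray \<phi> r)" for z \<phi>
  proof -
    obtain u where "0 \<le> u" "z = (1 - u) *\<^sub>R (- 1) + u *\<^sub>R ray \<phi> r" using z by (auto simp: in_segment)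
    then have "z = ray \<phi> (u * r)" by (simp add: ray_def algebra_simps scaleR_conv_of_real)
    then show ?thesis using \<open>0 \<le> u\<close> r by (intro exI[of _ "u * r"]) auto
  qed
  have seg1: "z \<in> - \<real>\<^sub>\<ge>\<^sub>0" "z - \<kappa> \<notin> \<real>\<^sub>\<le>\<^sub>0" "z \<noteq> \<kappa>"
    if z: "z \<in> closed_segment (- 1) (ray \<phi> r)" and \<phi>: "\<bar>\<phi>\<bar> = \<theta>" for z \<phi>
  proof -
    obtain t where t: "0 \<le> t" "z = ray \<phi> t" using seg_pt[OF z] by blast
    show "z \<in> - \<real>\<^sub>\<ge>\<^sub>0" using ray_in_slit[OF \<phi> t(1)] t(2) by simp
    have "0 \<le> t * cos \<theta>" using t cos_sin_pos by simp
    then have "0 < Re (z - \<kappa>)" using t l cos_ray[OF \<phi>] by (simp add: ray_def \<kappa>_def)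
    then show "z - \<kappa> \<notin> \<real>\<^sub>\<le>\<^sub>0" "z \<noteq> \<kappa>" by (auto simp: complex_nonpos_Reals_iff)
  qed
  have abs: "\<bar>\<theta>\<bar> = \<theta>" "\<bar>- \<theta>\<bar> = \<theta>" using \<theta> by auto
  note segP = seg1[OF _ abs(1), folded P_def] and segQ = seg1[OF _ abs(2), folded Q_def]
  have Hc: "continuous_on S H" if "S \<subseteq> - \<real>\<^sub>\<ge>\<^sub>0" for S
    using holomorphic_on_imp_continuous_on[OF holomorphic_on_subset[OF Hh that]] .
  obtain hP where hP: "(H has_contour_integral hP) (linepath (- 1) P)"
    using contour_integrable_continuous_linepath[OF Hc, of "- 1" P] segP(1)
    unfolding contour_integrable_on_def by blast
  obtain hQ where hQ: "(H has_contour_integral hQ) (linepath (- 1) Q)"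
    using contour_integrable_continuous_linepath[OF Hc, of "- 1" Q] segQ(1)
    unfolding contour_integrable_on_def by blast
  obtain hA where hA: "(H has_contour_integral hA) arc"
    using contour_integrable_continuous_part_circlepath[OF Hc, of "- 1" r \<theta> "2 * pi - \<theta>"] arc1(1)
    unfolding contour_integrable_on_def arc_def by blast
  have va: "valid_path arc" by (simp add: arc_def)
  have "(H has_contour_integral (- hQ + (hP + hA))) (linepath Q (- 1) +++ linepath (- 1) P +++ arc)"
    using arc_ends va
    by (intro has_contour_integral_join hP hA has_contour_integral_reverse_linepath[OF hQ] valid_path_join) auto
  moreover have "(H has_contour_integral 0) (linepath Q (- 1) +++ linepath (- 1) P +++ arc)"
  proof (rule Cauchy_theorem_starlike_simple[OF open_slit starlike_slit Hh])
    show "valid_path (linepath Q (- 1) +++ linepath (- 1) P +++ arc)"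
      using arc_ends va by (intro valid_path_join) auto
    show "path_image (linepath Q (- 1) +++ linepath (- 1) P +++ arc) \<subseteq> - \<real>\<^sub>\<ge>\<^sub>0"
      using segP(1) segQ(1) arc1(1) arc_ends
      by (simp add: path_image_join closed_segment_commute[of Q] subset_iff)
  qed (use arc_ends in auto)
  ultimately have h0: "hP - hQ + hA = 0"
    using has_contour_integral_unique by fastforce
  have lin: "((\<lambda>z. 1 / (z - \<kappa>)) has_contour_integral (Ln (pathfinish g - \<kappa>) - Ln (pathstart g - \<kappa>))) g"
    if "valid_path g" "\<And>z. z \<in> path_image g \<Longrightarrow> z - \<kappa> \<notin> \<real>\<^sub>\<le>\<^sub>0" for g
    by (rule contour_integral_primitive[where f = "\<lambda>z. Ln (z - \<kappa>)" and S = "path_image g"])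
      (use that in \<open>auto intro!: derivative_eq_intros simp: divide_inverse\<close>)
  have circ: "((\<lambda>z. 1 / (z - \<kappa>)) has_contour_integral (Ln (\<kappa> - Q) - Ln (\<kappa> - P))) arc"
  proof -
    have "((\<lambda>z. 1 / (z - \<kappa>)) has_contour_integral (Ln (\<kappa> - pathfinish arc) - Ln (\<kappa> - pathstart arc))) arc"
    proof (rule contour_integral_primitive[where f = "\<lambda>z. Ln (\<kappa> - z)" and S = "path_image arc"])
      fix z assume "z \<in> path_image arc"
      then have "\<kappa> - z \<notin> \<real>\<^sub>\<le>\<^sub>0" "z \<noteq> \<kappa>" using arc1 by blast+
      then show "((\<lambda>z. Ln (\<kappa> - z)) has_field_derivative 1 / (z - \<kappa>)) (at z within path_image arc)"
        by (auto intro!: derivative_eq_intros simp: field_simps)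
    qed (use va in auto)
    then show ?thesis by (simp add: arc_ends)
  qed
  define LP LQ where "LP = Ln (P - \<kappa>) - Ln (- 1 - \<kappa>)" and "LQ = Ln (Q - \<kappa>) - Ln (- 1 - \<kappa>)"
  have FP: "(F has_contour_integral (hP + m \<kappa> * LP)) (linepath (- 1) P)"
  proof (rule has_contour_integral_eq)
    show "((\<lambda>z. H z + m \<kappa> * (1 / (z - \<kappa>))) has_contour_integral (hP + m \<kappa> * LP)) (linepath (- 1) P)"
      unfolding LP_def using lin[of "linepath (- 1) P"] segP(2)
      by (intro has_contour_integral_add hP has_contour_integral_lmul) auto
  qed (use FH segP(3) in auto)
  have FQ: "(F has_contour_integral (hQ + m \<kappa> * LQ)) (linepath (- 1) Q)"
  proof (rule has_contour_integral_eq)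
    show "((\<lambda>z. H z + m \<kappa> * (1 / (z - \<kappa>))) has_contour_integral (hQ + m \<kappa> * LQ)) (linepath (- 1) Q)"
      unfolding LQ_def using lin[of "linepath (- 1) Q"] segQ(2)
      by (intro has_contour_integral_add hQ has_contour_integral_lmul) auto
  qed (use FH segQ(3) in auto)
  define IA where "IA = hA + m \<kappa> * (Ln (\<kappa> - Q) - Ln (\<kappa> - P))"
  have FA: "(F has_contour_integral IA) arc"
  proof (rule has_contour_integral_eq)
    show "((\<lambda>z. H z + m \<kappa> * (1 / (z - \<kappa>))) has_contour_integral IA) arc"
      unfolding IA_def by (intro has_contour_integral_add hA has_contour_integral_lmul circ)
  qed (use FH arc1(3) in auto)
  \<comment> \<open>Each branch of the logarithm is used where it has no cut. Changing branch
    contributes \<open>- i * pi\<close> at \<open>P\<close>, above the axis, and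
    \<open>+ i * pi\<close> at \<open>Q\<close>, below it; their difference is the
    \<open>2 * pi * i\<close> of the residue.\<close>
  have logs: "LP - LQ + (Ln (\<kappa> - Q) - Ln (\<kappa> - P)) = 2 * of_real pi * \<i>"
  proof -
    have ImP: "Im (P - \<kappa>) > 0" "Im (Q - \<kappa>) < 0"
      using r cos_sin_pos by (auto simp: P_def Q_def ray_def \<kappa>_def)
    then have nz: "P - \<kappa> \<noteq> 0" "Q - \<kappa> \<noteq> 0" by force+
    have "Ln (\<kappa> - P) = Ln (P - \<kappa>) - \<i> * pi" "Ln (\<kappa> - Q) = Ln (Q - \<kappa>) + \<i> * pi"
      using Ln_minus[OF nz(1)] Ln_minus[OF nz(2)] ImP by auto
    then show ?thesis by (simp add: LP_def LQ_def)
  qed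
  have total: "(hP + m \<kappa> * LP) - (hQ + m \<kappa> * LQ) - 2 * of_real pi * \<i> * m \<kappa> = - IA"
  proof -
    have "(hP + m \<kappa> * LP) - (hQ + m \<kappa> * LQ) + IA
        = (hP - hQ + hA) + m \<kappa> * (LP - LQ + (Ln (\<kappa> - Q) - Ln (\<kappa> - P)))"
      by (simp add: IA_def algebra_simps)
    then show ?thesis unfolding h0 logs by (simp add: algebra_simps)
  qed
  \<comment> \<open>Length of the arc times a bound for the integrand: on the arc
    \<open>cmod z\<close> is at least \<open>r - 1\<close>, and the distance to
    \<open>\<kappa>\<close> is at least \<open>r + 1 + l\<close>.\<close>
  have "cmod IA \<le> ((r - 1) powr (- a) / (r + 1 + l)) * r * ((2 * pi - \<theta>) - \<theta>)"
  proof (rule has_contour_integral_bound_part_circlepath[OF FA[unfolded arc_def]])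
    show "0 \<le> (r - 1) powr (- a) / (r + 1 + l)" using r by simp
    show "\<theta> \<le> 2 * pi - \<theta>" using \<theta> by simp
    fix z assume "z \<in> path_image (part_circlepath (- 1) r \<theta> (2 * pi - \<theta>))"
    then have "z \<in> path_image arc" by (simp add: arc_def)
    then obtain x where x: "z = - 1 + of_real r * cis x" using arc_pt by blast
    have z1: "cmod (z + 1) = r" using r by (simp add: x norm_mult)
    have rz: "r - 1 \<le> cmod z"
      using z1 norm_triangle_ineq[of z 1] by simp
    have rl: "r + 1 + l \<le> cmod (z - \<kappa>)"
    proof -
      have "\<kappa> + 1 = of_real (l + 1)" by (simp add: \<kappa>_def)
      then have "cmod (\<kappa> + 1) = - (l + 1)"
        using l by (simp only: norm_of_real)
      then show ?thesis
        using z1 norm_triangle_ineq[of "z - \<kappa>" "\<kappa> + 1"] by simp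
    qed
    have "z \<noteq> 0" using rz r by auto
    then have "cmod (m z) \<le> (r - 1) powr (- a)"
      unfolding m_def using r a rz by (subst norm_cpow_neg) (auto intro: powr_mono2')
    then show "cmod (F z) \<le> (r - 1) powr (- a) / (r + 1 + l)"
      unfolding F_def norm_divide using r rl by (intro frac_le) auto
  qed (use r in simp)
  also have "\<dots> \<le> ((r - 1) powr (- a) / (r + 1 + l)) * r * (2 * pi)"
    using \<theta> r by (intro mult_left_mono) auto
  finally have bound: "cmod IA \<le> (r - 1) powr (- a) / (r + 1 + l) * r * (2 * pi)" .
  have "integral {0..r} (\<lambda>t. F (ray \<theta> t) * cis \<theta>) = hP + m \<kappa> * LP"
    using contour_integral_ray[of r F _ \<theta>] FP r unfolding P_def by (intro integral_unique) auto
  moreover have "integral {0..r} (\<lambda>t. F (ray (- \<theta>) t) * cis (- \<theta>)) = hQ + m \<kappa> * LQ"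
    using contour_integral_ray[of r F _ "- \<theta>"] FQ r unfolding Q_def by (intro integral_unique) auto
  ultimately have "cmod (integral {0..r} (\<lambda>t. F (ray \<theta> t) * cis \<theta>)
     - integral {0..r} (\<lambda>t. F (ray (- \<theta>) t) * cis (- \<theta>)) - 2 * of_real pi * \<i> * m \<kappa>) = cmod IA"
    using total by simp
  then show ?thesis using bound by (simp add: F_def m_def \<kappa>_def)
qed

text \<open>The arc error is of order \<open>r powr (- a)\<close> and disappears as the truncated
  rays are completed.\<close>

lemma pow_transform_real:
  assumes a: "a > 0" and l: "l < - 1"
  shows "pow_transform a \<theta> (of_real l) - pow_transform a (- \<theta>) (of_real l) = 2 * of_real pi * \<i> * cpow_neg a (of_real l)"
proof -
  define f where "f \<phi> t = cpow_neg a (ray \<phi> t) * cis \<phi> / (ray \<phi> t - of_real l)" for \<phi> t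
  have abs: "\<bar>\<theta>\<bar> = \<theta>" "\<bar>- \<theta>\<bar> = \<theta>" using \<theta> by auto
  have "(\<lambda>n. integral {0..real n} (f \<phi>)) \<longlonglongrightarrow> pow_transform a \<phi> (of_real l)" if "\<bar>\<phi>\<bar> = \<theta>" for \<phi>
    unfolding pow_transform_def f_def
    by (intro integral_Ici_tendsto pow_transform_integrable a that of_real_notin_sector l)
  then have lim: "(\<lambda>n. integral {0..real n} (f \<theta>) - integral {0..real n} (f (- \<theta>)) - 2 * of_real pi * \<i> * cpow_neg a (of_real l))
      \<longlonglongrightarrow> pow_transform a \<theta> (of_real l) - pow_transform a (- \<theta>) (of_real l) - 2 * of_real pi * \<i> * cpow_neg a (of_real l)"
    using abs by (intro tendsto_intros) auto
  have "(\<lambda>n. integral {0..real n} (f \<theta>) - integral {0..real n} (f (- \<theta>)) - 2 * of_real pi * \<i> * cpow_neg a (of_real l)) \<longlonglongrightarrow> 0"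
  proof (rule Lim_null_comparison)
    obtain N :: nat where N: "real N > max 1 (- 1 - l)" using reals_Archimedean2 by blast
    show "\<forall>\<^sub>F n in sequentially. norm (integral {0..real n} (f \<theta>) - integral {0..real n} (f (- \<theta>)) - 2 * of_real pi * \<i> * cpow_neg a (of_real l))
        \<le> (real n - 1) powr (- a) / (real n + 1 + l) * real n * (2 * pi)"
      using eventually_ge_at_top[of N]
    proof eventually_elim
      case (elim n)
      then have "real n > 1" "l > - 1 - real n" using N by auto
      from pow_transform_truncated[OF a l this] show ?case unfolding f_def .
    qed
    show "(\<lambda>n. (real n - 1) powr (- a) / (real n + 1 + l) * real n * (2 * pi)) \<longlonglongrightarrow> 0"
      using a by real_asymp
  qed
  from LIMSEQ_unique[OF lim this] show ?thesis by simp
qed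

text \<open>Identity theorem on the connected complement of the sector: both sides are holomorphic
  there and agree on the real half line \<open>l < - 1\<close>, which accumulates at -2.\<close>

lemma pow_transform_diff:
  assumes a: "a > 0" and l: "l \<notin> sector \<theta>"
  shows "pow_transform a \<theta> l - pow_transform a (- \<theta>) l = 2 * of_real pi * \<i> * cpow_neg a l"
proof -
  define h where "h l = pow_transform a \<theta> l - pow_transform a (- \<theta>) l - 2 * of_real pi * \<i> * cpow_neg a l" for l
  have abs: "\<bar>\<theta>\<bar> = \<theta>" "\<bar>- \<theta>\<bar> = \<theta>" using \<theta> by auto
  have "h holomorphic_on - sector \<theta>"
    unfolding h_def
    by (intro holomorphic_intros pow_transform_holomorphic a abs
        holomorphic_on_subset[OF holomorphic_on_cpow_neg sector_compl_subset_slit])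
  moreover have "open (- sector \<theta>)" using closed_sector by (simp add: open_Compl)
  moreover have "(of_real ` {..< -1} :: complex set) \<subseteq> - sector \<theta>"
    using of_real_notin_sector by auto
  moreover have "(of_real (- 2) :: complex) \<in> - sector \<theta>" using of_real_notin_sector[of "-2"] by simp
  moreover have "(of_real (- 2) :: complex) islimpt of_real ` {..< -1}"
    unfolding islimpt_approachable
  proof (intro allI impI)
    fix e :: real assume e: "e > 0"
    have "dist (of_real (- 2 - e / 2)) (of_real (- 2) :: complex) = e / 2"
      unfolding dist_norm of_real_diff[symmetric] norm_of_real using e by simp
    then show "\<exists>x'\<in>of_real ` {..< -1}. x' \<noteq> (of_real (- 2) :: complex) \<and> dist x' (of_real (- 2)) < e"
      using e by (intro bexI[of _ "of_real (- 2 - e / 2)"] imageI conjI) (auto simp flip: of_real_diff)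
  qed
  moreover have "h z = 0" if "z \<in> of_real ` {..< -1}" for z
    using that pow_transform_real[OF a] by (auto simp: h_def)
  ultimately have "h l = 0"
    using analytic_continuation[of h "- sector \<theta>" "of_real ` {..< -1}" "of_real (- 2)" l]
      connected_sector_compl l by blast
  then show ?thesis by (simp add: h_def)
qed

end

section \<open>Fractional powers\<close>

locale fractional_power =
  fixes A :: "'a::complex_banach operator" and \<alpha> \<omega> \<theta> :: real
  assumes alpha: "\<alpha> > 0" and adm: "admissible A \<omega> \<theta>"

sublocale fractional_power \<subseteq> contour_angle \<theta>
  using adm by unfold_locales (auto simp: admissible_def)

context fractional_power
begin

abbreviation R\<^sub>\<omega> :: "complex \<Rightarrow> 'a \<Rightarrow> 'a"
  where "R\<^sub>\<omega> \<mu> \<equiv> resolvent A (\<mu> + of_real \<omega>)"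

lemma sector_resolvent: "\<mu> \<in> sector \<theta> \<Longrightarrow> \<mu> + of_real \<omega> \<in> resolvent_set A"
  using adm by (auto simp: admissible_def)

lemmas R\<^sub>\<omega>_lin = bounded_clinearD[OF resolvent_clinear[OF sector_resolvent]]

lemma sector_bound:
  obtains C where "C > 0" "\<And>\<mu> x. \<mu> \<in> sector \<theta> \<Longrightarrow> norm (R\<^sub>\<omega> \<mu> x) \<le> C / (1 + cmod \<mu>) * norm x"
proof -
  obtain C where C: "\<And>\<mu>. \<mu> \<in> sector \<theta> \<Longrightarrow> onorm (R\<^sub>\<omega> \<mu>) \<le> C / (1 + cmod \<mu>)"
    using adm by (auto simp: admissible_def)
  have "norm (R\<^sub>\<omega> \<mu> x) \<le> (\<bar>C\<bar> + 1) / (1 + cmod \<mu>) * norm x" if "\<mu> \<in> sector \<theta>" for \<mu> x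
  proof -
    have "norm (R\<^sub>\<omega> \<mu> x) \<le> onorm (R\<^sub>\<omega> \<mu>) * norm x" by (rule onorm[OF R\<^sub>\<omega>_lin(1)[OF that]])
    also have "onorm (R\<^sub>\<omega> \<mu>) \<le> C / (1 + cmod \<mu>)" by (rule C[OF that])
    also have "\<dots> \<le> (\<bar>C\<bar> + 1) / (1 + cmod \<mu>)"
      by (intro divide_right_mono) (auto simp: add_nonneg_nonneg)
    finally show ?thesis by (simp add: mult_right_mono)
  qed
  then show ?thesis using that[of "\<bar>C\<bar> + 1"] by simp
qed

definition integrand :: "real \<Rightarrow> 'a \<Rightarrow> real \<Rightarrow> 'a"
  where "integrand \<phi> x t = (cpow_neg \<alpha> (ray \<phi> t) * cis \<phi>) *\<^sub>C R\<^sub>\<omega> (ray \<phi> t) x"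

lemma ray_integral_eq: "ray_integral A \<omega> \<alpha> \<phi> x = integral {0..} (integrand \<phi> x)"
  by (simp add: ray_integral_def Let_def ray_def integrand_def [abs_def])

lemma integrand_bound:
  obtains D where "D > 0"
    "\<And>\<phi> x t. \<bar>\<phi>\<bar> = \<theta> \<Longrightarrow> t \<ge> 0 \<Longrightarrow> norm (integrand \<phi> x t) \<le> D * (1 + t) powr (- \<alpha> - 1) * norm x"
proof -
  obtain C where C: "C > 0" "\<And>\<mu> x. \<mu> \<in> sector \<theta> \<Longrightarrow> norm (R\<^sub>\<omega> \<mu> x) \<le> C / (1 + cmod \<mu>) * norm x"
    using sector_bound by blast
  define s where "s = sin (\<theta> / 2)"
  have s: "s > 0" using sin_half_pos by (simp add: s_def)
  define D where "D = s powr (- \<alpha>) * (C / s)"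
  have "D > 0" using s C by (simp add: D_def)
  moreover have "norm (integrand \<phi> x t) \<le> D * (1 + t) powr (- \<alpha> - 1) * norm x"
    if \<phi>: "\<bar>\<phi>\<bar> = \<theta>" and t: "t \<ge> 0" for \<phi> x t
  proof -
    have "norm (integrand \<phi> x t) = cmod (cpow_neg \<alpha> (ray \<phi> t)) * norm (R\<^sub>\<omega> (ray \<phi> t) x)"
      by (simp add: integrand_def norm_scaleC norm_mult)
    also have "\<dots> \<le> (s powr (- \<alpha>) * (1 + t) powr (- \<alpha>)) * (C / (s * (1 + t)) * norm x)"
    proof (rule mult_mono)
      show "cmod (cpow_neg \<alpha> (ray \<phi> t)) \<le> s powr (- \<alpha>) * (1 + t) powr (- \<alpha>)"
        unfolding s_def by (rule norm_cpow_neg_ray_le[OF \<phi> t alpha])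
      have "s * (1 + t) \<le> 1 + cmod (ray \<phi> t)" using norm_ray_ge[OF \<phi> t] by (simp add: s_def)
      then have "C / (1 + cmod (ray \<phi> t)) \<le> C / (s * (1 + t))"
        using s t C by (intro divide_left_mono mult_pos_pos) (auto intro: add_pos_nonneg)
      then show "norm (R\<^sub>\<omega> (ray \<phi> t) x) \<le> C / (s * (1 + t)) * norm x"
        using C(2)[OF ray_in_sector[OF \<phi> t], of x] by (meson mult_right_mono norm_ge_zero order_trans)
    qed (use s t in auto)
    also have "\<dots> = D * (1 + t) powr (- \<alpha> - 1) * norm x"
      using t by (simp add: D_def powr_diff)
    finally show ?thesis .
  qed
  ultimately show ?thesis using that by blast
qed

lemma continuous_on_integrand:
  assumes "\<bar>\<phi>\<bar> = \<theta>"
  shows "continuous_on {0..} (integrand \<phi> x)"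
  unfolding integrand_def
proof (intro continuous_intros continuous_on_cpow_neg_ray assms)
  show "continuous_on {0..} (\<lambda>t. R\<^sub>\<omega> (ray \<phi> t) x)"
    by (rule continuous_on_compose2[OF continuous_on_resolvent])
      (auto intro!: continuous_intros sector_resolvent ray_in_sector assms)
qed

lemma bound_integrable: "(\<lambda>t. D * (1 + t) powr (- \<alpha> - 1) * c) integrable_on {0..}"
  using has_integral_shifted_powr[OF alpha]
  by (intro integrable_on_mult_left integrable_on_mult_right) blast

lemma integrand_integrable:
  assumes "\<bar>\<phi>\<bar> = \<theta>"
  shows "integrand \<phi> x integrable_on {0..}"
proof -
  obtain D where D: "\<And>x t. t \<ge> 0 \<Longrightarrow> norm (integrand \<phi> x t) \<le> D * (1 + t) powr (- \<alpha> - 1) * norm x"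
    using integrand_bound assms by metis
  show ?thesis
    by (rule integrable_dominated_Ici[OF continuous_on_integrand[OF assms] bound_integrable D])
qed

lemma ray_integral_clinear:
  assumes \<phi>: "\<bar>\<phi>\<bar> = \<theta>"
  shows "bounded_clinear (ray_integral A \<omega> \<alpha> \<phi>)"
proof -
  obtain D where D: "\<And>x t. t \<ge> 0 \<Longrightarrow> norm (integrand \<phi> x t) \<le> D * (1 + t) powr (- \<alpha> - 1) * norm x"
    using integrand_bound assms by metis
  note lin = R\<^sub>\<omega>_lin[OF ray_in_sector[OF \<phi>]]
  show ?thesis
  proof (rule bounded_clinearI)
    fix x y
    have "((\<lambda>t. integrand \<phi> x t + integrand \<phi> y t) has_integral ray_integral A \<omega> \<alpha> \<phi> x + ray_integral A \<omega> \<alpha> \<phi> y) {0..}"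
      unfolding ray_integral_eq by (intro has_integral_add integrable_integral integrand_integrable \<phi>)
    then have "((integrand \<phi> (x + y)) has_integral ray_integral A \<omega> \<alpha> \<phi> x + ray_integral A \<omega> \<alpha> \<phi> y) {0..}"
      by (rule has_integral_eq[rotated]) (simp add: integrand_def lin(2) scaleC_add_right)
    then show "ray_integral A \<omega> \<alpha> \<phi> (x + y) = ray_integral A \<omega> \<alpha> \<phi> x + ray_integral A \<omega> \<alpha> \<phi> y"
      unfolding ray_integral_eq[of \<phi> "x + y"] by (rule integral_unique)
  next
    fix c x
    have "((\<lambda>t. c *\<^sub>C integrand \<phi> x t) has_integral c *\<^sub>C ray_integral A \<omega> \<alpha> \<phi> x) {0..}"
      using has_integral_linear[OF integrable_integral[OF integrand_integrable[OF \<phi>]] scaleC.bounded_linear_right]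
      by (simp add: o_def ray_integral_eq)
    then have "((integrand \<phi> (c *\<^sub>C x)) has_integral c *\<^sub>C ray_integral A \<omega> \<alpha> \<phi> x) {0..}"
      by (rule has_integral_eq[rotated]) (simp add: integrand_def lin(6) scaleC_scaleC mult_ac)
    then show "ray_integral A \<omega> \<alpha> \<phi> (c *\<^sub>C x) = c *\<^sub>C ray_integral A \<omega> \<alpha> \<phi> x"
      unfolding ray_integral_eq[of \<phi> "c *\<^sub>C x"] by (rule integral_unique)
  next
    fix x
    have "norm (ray_integral A \<omega> \<alpha> \<phi> x) \<le> integral {0..} (\<lambda>t. D * (1 + t) powr (- \<alpha> - 1) * norm x)"
      unfolding ray_integral_eq
      by (rule integral_norm_bound_integral[OF integrand_integrable[OF \<phi>] bound_integrable]) (use D in auto)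
    also have "\<dots> = norm x * integral {0..} (\<lambda>t. D * (1 + t) powr (- \<alpha> - 1))"
      by simp
    finally show "norm (ray_integral A \<omega> \<alpha> \<phi> x) \<le> norm x * integral {0..} (\<lambda>t. D * (1 + t) powr (- \<alpha> - 1))" .
  qed
qed

abbreviation J :: "'a \<Rightarrow> 'a"
  where "J \<equiv> frac_neg_power A \<omega> \<theta> \<alpha>"

lemma abs_angle: "\<bar>\<theta>\<bar> = \<theta>" "\<bar>- \<theta>\<bar> = \<theta>"
  using \<theta> by auto

lemma J_clinear: "bounded_clinear J"
proof -
  note I = ray_integral_clinear[OF abs_angle(1)] ray_integral_clinear[OF abs_angle(2)]
  have "bounded_linear J"
    unfolding frac_neg_power_def
    by (intro bounded_linear_compose[OF scaleC.bounded_linear_right] bounded_linear_sub bounded_clinearD(1) I)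
  moreover have "J (c *\<^sub>C x) = c *\<^sub>C J x" for c x
    by (simp add: frac_neg_power_def bounded_clinearD(6)[OF I(1)] bounded_clinearD(6)[OF I(2)]
        scaleC_scaleC mult.commute flip: scaleC.diff_right)
  ultimately show ?thesis by (simp add: bounded_clinear_def)
qed

text \<open>A bounded operator passes under the contour integral. Applied to \<open>T t\<close>,
  this makes \<open>J\<close> commute with the semigroup.\<close>

lemma J_commute:
  assumes B: "bounded_clinear B" and com: "\<And>\<mu> x. \<mu> \<in> sector \<theta> \<Longrightarrow> B (R\<^sub>\<omega> \<mu> x) = R\<^sub>\<omega> \<mu> (B x)"
  shows "B (J x) = J (B x)"
proof -
  have "B (ray_integral A \<omega> \<alpha> \<phi> x) = ray_integral A \<omega> \<alpha> \<phi> (B x)" if \<phi>: "\<bar>\<phi>\<bar> = \<theta>" for \<phi>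
  proof -
    have "((B \<circ> integrand \<phi> x) has_integral B (ray_integral A \<omega> \<alpha> \<phi> x)) {0..}"
      unfolding ray_integral_eq
      by (intro has_integral_linear integrable_integral integrand_integrable \<phi> bounded_clinearD(1) B)
    then have "(integrand \<phi> (B x) has_integral B (ray_integral A \<omega> \<alpha> \<phi> x)) {0..}"
      by (rule has_integral_eq[rotated])
        (simp add: integrand_def bounded_clinearD(6)[OF B] com[OF ray_in_sector[OF \<phi>]])
    then show ?thesis unfolding ray_integral_eq[of \<phi> "B x"] by (rule integral_unique[symmetric])
  qed
  then show ?thesis using abs_angle
    by (simp add: frac_neg_power_def bounded_clinearD(3,6)[OF B])
qed

section \<open>Injectivity of the negative fractional power\<close>

definition resolvent_transform :: "('a \<Rightarrow> complex) \<Rightarrow> 'a \<Rightarrow> real \<Rightarrow> complex \<Rightarrow> complex"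
  where "resolvent_transform x' x \<phi> l = integral {0..} (\<lambda>t. x' (integrand \<phi> x t) / (ray \<phi> t - l))"

context
  fixes x' :: "'a \<Rightarrow> complex" and x :: 'a
  assumes x': "bounded_clinear x'"
begin

lemma resolvent_transform:
  assumes \<phi>: "\<bar>\<phi>\<bar> = \<theta>"
  shows resolvent_transform_integrable:
      "l \<notin> sector \<theta> \<Longrightarrow> (\<lambda>t. x' (integrand \<phi> x t) / (ray \<phi> t - l)) integrable_on {0..}"
    and resolvent_transform_holomorphic: "resolvent_transform x' x \<phi> holomorphic_on - sector \<theta>"
    and resolvent_transform_bound: "\<exists>B. \<forall>d l. d > 0 \<longrightarrow> (\<forall>z\<in>sector \<theta>. d \<le> cmod (z - l)) \<longrightarrow>
      cmod (resolvent_transform x' x \<phi> l) \<le> B / d"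
proof -
  obtain D where D: "\<And>t. t \<ge> 0 \<Longrightarrow> norm (integrand \<phi> x t) \<le> D * (1 + t) powr (- \<alpha> - 1) * norm x"
    using integrand_bound assms by metis
  obtain K where K: "K > 0" "\<And>y. norm (x' y) \<le> norm y * K"
    using bounded_linear.pos_bounded[OF bounded_clinearD(1)[OF x']] by blast
  have le: "cmod (x' (integrand \<phi> x t)) \<le> D * (1 + t) powr (- \<alpha> - 1) * (norm x * K)" if "t \<ge> 0" for t
    using order_trans[OF K(2)[of "integrand \<phi> x t"] mult_right_mono[OF D[OF that], of K]] K(1)
    by (simp add: mult.assoc)
  have c: "continuous_on {0..} (\<lambda>t. x' (integrand \<phi> x t))"
    by (rule bounded_linear.continuous_on[OF bounded_clinearD(1)[OF x'] continuous_on_integrand[OF \<phi>]])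
  note kernel = cauchy_kernel[OF c continuous_on_ray closed_sector ray_in_sector[OF \<phi>] bound_integrable le]
  show "l \<notin> sector \<theta> \<Longrightarrow> (\<lambda>t. x' (integrand \<phi> x t) / (ray \<phi> t - l)) integrable_on {0..}"
    by (rule kernel(1))
  show "resolvent_transform x' x \<phi> holomorphic_on - sector \<theta>"
    unfolding resolvent_transform_def [abs_def] by (rule kernel(3))
  show "\<exists>B. \<forall>d l. d > 0 \<longrightarrow> (\<forall>z\<in>sector \<theta>. d \<le> cmod (z - l)) \<longrightarrow>
      cmod (resolvent_transform x' x \<phi> l) \<le> B / d"
    unfolding resolvent_transform_def using kernel(2) by blast
qed

text \<open>The resolvent at \<open>l\<close> is applied to the vanishing contour integral
  \<open>J x\<close>. The resolvent identity acts as a partial fraction decomposition,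
  \<open>R l (R \<mu> x) = (R l x - R \<mu> x) / (\<mu> - l)\<close>: the first part yields the
  power of \<open>l\<close> by \<open>pow_transform_diff\<close>, the second is the resolvent
  transform.\<close>

lemma resolvent_transform_eq:
  assumes J0: "J x = 0" and l: "l \<notin> sector \<theta>" "l + of_real \<omega> \<in> resolvent_set A"
  shows "resolvent_transform x' x \<theta> l - resolvent_transform x' x (- \<theta>) l
    = 2 * of_real pi * \<i> * cpow_neg \<alpha> l * x' (R\<^sub>\<omega> l x)"
proof -
  define r where "r = x' (R\<^sub>\<omega> l x)"
  have Rl: "bounded_clinear (R\<^sub>\<omega> l)" by (rule resolvent_clinear[OF l(2)])
  have main: "x' (R\<^sub>\<omega> l (ray_integral A \<omega> \<alpha> \<phi> x)) = pow_transform \<alpha> \<phi> l * r - resolvent_transform x' x \<phi> l"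
    if \<phi>: "\<bar>\<phi>\<bar> = \<theta>" for \<phi>
  proof -
    have 1: "((\<lambda>t. x' (R\<^sub>\<omega> l (integrand \<phi> x t))) has_integral x' (R\<^sub>\<omega> l (ray_integral A \<omega> \<alpha> \<phi> x))) {0..}"
      using has_integral_linear[OF has_integral_linear[OF integrable_integral[OF integrand_integrable[OF \<phi>]]
          bounded_clinearD(1)[OF Rl]] bounded_clinearD(1)[OF x']]
      by (simp add: o_def ray_integral_eq)
    have 2: "((\<lambda>t. cpow_neg \<alpha> (ray \<phi> t) * cis \<phi> / (ray \<phi> t - l) * r - x' (integrand \<phi> x t) / (ray \<phi> t - l))
        has_integral pow_transform \<alpha> \<phi> l * r - resolvent_transform x' x \<phi> l) {0..}"
      unfolding pow_transform_def resolvent_transform_def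
      by (intro has_integral_diff has_integral_mult_left integrable_integral
          pow_transform_integrable resolvent_transform_integrable alpha \<phi> l)
    have "cpow_neg \<alpha> (ray \<phi> t) * cis \<phi> / (ray \<phi> t - l) * r - x' (integrand \<phi> x t) / (ray \<phi> t - l)
        = x' (R\<^sub>\<omega> l (integrand \<phi> x t))" if "t \<in> {0..}" for t
    proof -
      define \<mu> where "\<mu> = ray \<phi> t"
      have \<mu>: "\<mu> \<in> sector \<theta>" using ray_in_sector[OF \<phi>] that by (simp add: \<mu>_def)
      then have ne: "\<mu> - l \<noteq> 0" using l by auto
      have "R\<^sub>\<omega> l x - R\<^sub>\<omega> \<mu> x = (\<mu> - l) *\<^sub>C R\<^sub>\<omega> l (R\<^sub>\<omega> \<mu> x)"
        using resolvent_identity[OF sector_resolvent[OF \<mu>] l(2), of x] by simp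
      then have "r - x' (R\<^sub>\<omega> \<mu> x) = (\<mu> - l) * x' (R\<^sub>\<omega> l (R\<^sub>\<omega> \<mu> x))"
        unfolding r_def using bounded_clinearD(3,6)[OF x'] by (metis scaleC_complex_def)
      then have v: "x' (R\<^sub>\<omega> l (R\<^sub>\<omega> \<mu> x)) = (r - x' (R\<^sub>\<omega> \<mu> x)) / (\<mu> - l)"
        using ne by simp
      have "q / (\<mu> - l) * r - q * x' (R\<^sub>\<omega> \<mu> x) / (\<mu> - l) = q * ((r - x' (R\<^sub>\<omega> \<mu> x)) / (\<mu> - l))" for q
        by (simp add: diff_divide_distrib right_diff_distrib)
      then show ?thesis
        by (simp only: integrand_def bounded_clinearD(6)[OF Rl] bounded_clinearD(6)[OF x'] scaleC_complex_def v
            flip: \<mu>_def)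
    qed
    from has_integral_eq[OF this 2] 1 show ?thesis
      by (rule has_integral_unique[rotated])
  qed
  have "ray_integral A \<omega> \<alpha> \<theta> x - ray_integral A \<omega> \<alpha> (- \<theta>) x = (2 * of_real pi * \<i>) *\<^sub>C J x"
    by (simp add: frac_neg_power_def scaleC_scaleC)
  then have "ray_integral A \<omega> \<alpha> \<theta> x = ray_integral A \<omega> \<alpha> (- \<theta>) x" using J0 by simp
  then have "(pow_transform \<alpha> \<theta> l - pow_transform \<alpha> (- \<theta>) l) * r
      = resolvent_transform x' x \<theta> l - resolvent_transform x' x (- \<theta>) l"
    using main[OF abs_angle(1)] main[OF abs_angle(2)] by (simp add: algebra_simps)
  then show ?thesis using pow_transform_diff[OF alpha l(1)] by (simp add: r_def)
qed

text \<open>If \<open>J x = 0\<close>, the resolvent applied to \<open>x\<close> extends across the contour to an entire function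
  of polynomial growth, which vanishes since it tends to zero along the positive axis.\<close>

lemma J_kernel_functional:
  assumes J0: "J x = 0"
  shows "x' (R\<^sub>\<omega> 0 x) = 0"
proof -
  define N where "N = {l. l + of_real \<omega> \<in> resolvent_set A}"
  define r where "r l = x' (R\<^sub>\<omega> l x)" for l
  define G where "G l = (resolvent_transform x' x \<theta> l - resolvent_transform x' x (- \<theta>) l)
    / (2 * of_real pi * \<i> * cpow_neg \<alpha> l)" for l
  \<comment> \<open>The two expressions agree on \<open>N\<close> minus the sector, and
    \<open>N\<close> together with the complement of the sector covers the plane, so
    \<open>H\<close> is entire.\<close>
  define H where "H l = (if l \<in> N then r l else G l)" for l
  have openN: "open N"
    unfolding N_def using open_vimage[OF open_resolvent_set[of A], of "\<lambda>l. l + of_real \<omega>"]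
    by (simp add: vimage_def continuous_intros)
  have secN: "sector \<theta> \<subseteq> N" unfolding N_def using sector_resolvent by blast
  have rG: "r l = G l" if "l \<in> N" "l \<notin> sector \<theta>" for l
    using resolvent_transform_eq[OF J0 that(2)] that by (simp add: G_def r_def N_def)
  have HG: "H l = G l" if "l \<notin> sector \<theta>" for l using rG that by (simp add: H_def)
  have rh: "r holomorphic_on N"
  proof -
    have "((\<lambda>l. x' (resolvent A l x)) \<circ> (\<lambda>l. l + of_real \<omega>)) holomorphic_on N"
      by (rule holomorphic_on_compose_gen[OF _ holomorphic_on_resolvent[OF x']])
        (auto simp: N_def intro!: holomorphic_intros)
    then show ?thesis by (simp add: r_def [abs_def] o_def)
  qed
  have Gh: "G holomorphic_on - sector \<theta>"
    unfolding G_def [abs_def]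
    by (intro holomorphic_intros resolvent_transform_holomorphic abs_angle
        holomorphic_on_subset[OF holomorphic_on_cpow_neg sector_compl_subset_slit]) simp
  have Hh: "H holomorphic_on UNIV"
  proof -
    have "H holomorphic_on N"
      by (rule holomorphic_transform[OF rh]) (simp add: H_def)
    moreover have "H holomorphic_on - sector \<theta>"
      by (rule holomorphic_transform[OF Gh]) (simp add: HG)
    ultimately have "H holomorphic_on N \<union> - sector \<theta>"
      using openN closed_sector by (intro holomorphic_on_Un) (auto simp: open_Compl)
    moreover have "N \<union> - sector \<theta> = UNIV" using secN by blast
    ultimately show ?thesis by simp
  qed
  obtain C where C: "C > 0" "\<And>\<mu> x. \<mu> \<in> sector \<theta> \<Longrightarrow> norm (R\<^sub>\<omega> \<mu> x) \<le> C / (1 + cmod \<mu>) * norm x"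
    using sector_bound by blast
  obtain K where K: "K > 0" "\<And>y. norm (x' y) \<le> norm y * K"
    using bounded_linear.pos_bounded[OF bounded_clinearD(1)[OF x']] by blast
  \<comment> \<open>Within distance \<open>d\<close> of the sector the Neumann estimate with bound
    \<open>C\<close> still controls the resolvent; farther away the Cauchy integrals are at most
    \<open>B1 / d\<close> and \<open>B2 / d\<close>.\<close>
  define d where "d = 1 / (2 * C)"
  have d: "d > 0" using C by (simp add: d_def)
  obtain B1 B2 where B:
    "\<And>l. (\<And>z. z \<in> sector \<theta> \<Longrightarrow> d \<le> cmod (z - l)) \<Longrightarrow> cmod (resolvent_transform x' x \<theta> l) \<le> B1 / d"
    "\<And>l. (\<And>z. z \<in> sector \<theta> \<Longrightarrow> d \<le> cmod (z - l)) \<Longrightarrow> cmod (resolvent_transform x' x (- \<theta>) l) \<le> B2 / d"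
    using resolvent_transform_bound[OF abs_angle(1)] resolvent_transform_bound[OF abs_angle(2)] d by metis
  define M where "M = 2 * C * norm x * K + (\<bar>B1 / d\<bar> + \<bar>B2 / d\<bar>)"
  \<comment> \<open>Dividing by the power costs \<open>cmod l powr \<alpha>\<close>; the polynomial
    form of Liouville's theorem asks for an integer exponent.\<close>
  define n where "n = nat \<lceil>\<alpha>\<rceil>"
  have growth: "cmod (H l) \<le> M * cmod l ^ n" if l: "1 \<le> cmod l" for l
  proof (cases "\<exists>z\<in>sector \<theta>. cmod (z - l) < d")
    case True
    then obtain z where z: "z \<in> sector \<theta>" "cmod (z - l) < d" by blast
    have Cz: "norm (R\<^sub>\<omega> z y) \<le> C * norm y" for y
    proof -
      have "C / (1 + cmod z) \<le> C / 1"
        using C(1) by (intro divide_left_mono) (auto intro: add_pos_nonneg)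
      then have "C / (1 + cmod z) \<le> C" by simp
      then show ?thesis using C(2)[OF z(1), of y] by (meson mult_right_mono norm_ge_zero order_trans)
    qed
    have "cmod ((l + of_real \<omega>) - (z + of_real \<omega>)) * C \<le> 1 / 2"
      using z(2) C(1) by (simp add: d_def norm_minus_commute field_simps)
    note nm = resolvent_neumann[OF sector_resolvent[OF z(1)] Cz this]
    have "cmod (H l) = cmod (x' (R\<^sub>\<omega> l x))" using nm(1) by (simp add: H_def N_def r_def)
    also have "\<dots> \<le> norm (R\<^sub>\<omega> l x) * K" by (rule K(2))
    also have "\<dots> \<le> 2 * C * norm x * K" using nm(2) K(1) by (intro mult_right_mono) auto
    also have "\<dots> \<le> M" by (simp add: M_def)
    also have "M * 1 \<le> M * cmod l ^ n"
      using l C K by (intro mult_left_mono) (auto simp: M_def one_le_power)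
    finally show ?thesis by simp
  next
    case False
    then have far: "\<And>z. z \<in> sector \<theta> \<Longrightarrow> d \<le> cmod (z - l)" by force
    have ln: "l \<notin> sector \<theta>" using far[of l] d by auto
    have l0: "l \<noteq> 0" using l by auto
    have "cmod (resolvent_transform x' x \<theta> l - resolvent_transform x' x (- \<theta>) l) \<le> \<bar>B1 / d\<bar> + \<bar>B2 / d\<bar>"
      using B(1)[OF far] B(2)[OF far]
        norm_triangle_ineq4[of "resolvent_transform x' x \<theta> l" "resolvent_transform x' x (- \<theta>) l"] by linarith
    also have "\<dots> \<le> M" using C K by (simp add: M_def)
    finally have num: "cmod (resolvent_transform x' x \<theta> l - resolvent_transform x' x (- \<theta>) l) \<le> M" .
    have den: "cmod (2 * of_real pi * \<i> * cpow_neg \<alpha> l) \<ge> cmod l powr (- \<alpha>)"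
    proof -
      have "cmod (2 * of_real pi * \<i> * cpow_neg \<alpha> l) = 2 * pi * cmod l powr (- \<alpha>)"
        using l0 by (simp add: norm_mult norm_cpow_neg)
      then show ?thesis using pi_gt3 by (simp add: mult_le_cancel_right1)
    qed
    have "cmod (H l) \<le> M / cmod l powr (- \<alpha>)"
      unfolding HG[OF ln] G_def norm_divide
      using num den l0 order_trans[OF norm_ge_zero num] by (intro frac_le) auto
    also have "\<dots> = M * cmod l powr \<alpha>" by (simp add: powr_minus divide_inverse)
    also have "\<dots> \<le> M * cmod l powr real n"
    proof -
      have "\<alpha> \<le> real n" unfolding n_def by linarith
      then show ?thesis using l order_trans[OF norm_ge_zero num] by (intro mult_left_mono powr_mono) auto
    qed
    also have "cmod l powr real n = cmod l ^ n" using l0 by (simp add: powr_realpow)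
    finally show ?thesis .
  qed
  define c where "c k = (deriv ^^ k) H 0 / fact k" for k
  have poly: "H z = (\<Sum>k\<le>n. c k * z ^ k)" for z
    unfolding c_def by (rule Liouville_polynomial[OF Hh growth])
  have decay: "cmod (H (of_real t)) \<le> C * norm x * K / (1 + t)" if "t \<ge> 0" for t
  proof -
    have t: "of_real t \<in> sector \<theta>" using of_real_in_sector[of t] that by simp
    then have "cmod (H (of_real t)) \<le> norm (R\<^sub>\<omega> (of_real t) x) * K"
      using secN K(2) by (auto simp: H_def r_def)
    also have "\<dots> \<le> (C / (1 + cmod (of_real t)) * norm x) * K"
      using C(2)[OF t] K(1) by (intro mult_right_mono) auto
    finally show ?thesis using that by simp
  qed
  \<comment> \<open>A nonconstant polynomial is large near infinity in every direction, against the
    decay on the positive axis.\<close>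
  have c0: "c k = 0" if "1 \<le> k" "k \<le> n" for k
  proof (rule ccontr)
    assume "c k \<noteq> 0"
    then have "\<forall>\<^sub>F z in at_infinity. norm (\<Sum>i\<le>n. c i * z ^ i) \<ge> C * norm x * K + 1"
      using Limits.polyfun_extremal[of c k n "C * norm x * K + 1"] that by simp
    then obtain b where b: "\<And>z. b \<le> cmod z \<Longrightarrow> cmod (H z) \<ge> C * norm x * K + 1"
      unfolding eventually_at_infinity poly by blast
    have "C * norm x * K / (1 + \<bar>b\<bar>) \<le> C * norm x * K"
      using C K by (simp add: field_simps mult_le_cancel_left1)
    then show False using b[of "of_real \<bar>b\<bar>"] decay[of "\<bar>b\<bar>"] abs_ge_self[of b] by simp
  qed
  have const: "H z = c 0" for z
  proof -
    have "(\<Sum>k\<le>n. c k * z ^ k) = (\<Sum>k\<in>{0}. c k * z ^ k)"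
      using c0 by (intro sum.mono_neutral_right) (auto simp: not_less_eq_eq Suc_le_eq)
    then show ?thesis by (simp add: poly)
  qed
  have "c 0 = 0"
  proof (rule ccontr)
    assume ne: "c 0 \<noteq> 0"
    define t where "t = C * norm x * K / cmod (c 0)"
    have t: "t \<ge> 0" using C K by (simp add: t_def)
    then have "cmod (c 0) * (1 + t) \<le> C * norm x * K"
      using decay[OF t] unfolding const by (simp add: field_simps)
    then have "cmod (c 0) + C * norm x * K \<le> C * norm x * K" using ne by (simp add: t_def distrib_left)
    then show False using ne by simp
  qed
  moreover have "0 \<in> N" using secN of_real_in_sector[of 0] by auto
  ultimately show ?thesis using const[of 0] by (simp add: H_def r_def)
qed

end

text \<open>A norming functional upgrades the scalar statement to
  \<open>R\<^sub>\<omega> 0 x = 0\<close>, and a resolvent is injective.\<close>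

lemma J_inj: "inj J"
proof -
  have "x = 0" if "J x = 0" for x
  proof -
    obtain x' :: "'a \<Rightarrow> complex" where x': "bounded_clinear x'" "x' (R\<^sub>\<omega> 0 x) = of_real (norm (R\<^sub>\<omega> 0 x))"
      using hahn_banach by blast
    have "R\<^sub>\<omega> 0 x = 0" using J_kernel_functional[OF x'(1) that] x'(2) by simp
    moreover have "0 + of_real \<omega> \<in> resolvent_set A"
      using of_real_in_sector[of 0] by (intro sector_resolvent) simp
    ultimately show "x = 0" using resolvent_eq_0_iff by blast
  qed
  then show ?thesis
    using linear_injective_0[OF bounded_linear.linear[OF bounded_clinearD(1)[OF J_clinear]]] by blast
qed

lemma X_space_eq: "X_space A \<omega> \<theta> \<alpha> = range J"
  by (simp add: X_space_def)

lemma frac_power_J [simp]: "frac_power A \<omega> \<theta> \<alpha> (J x) = x"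
  by (simp add: frac_power_def inv_f_f[OF J_inj])

lemma X_norm_J [simp]: "X_norm A \<omega> \<theta> \<alpha> (J x) = norm x"
  by (simp add: X_norm_def)

end

section \<open>Strongly measurable functions on the circle\<close>

lemma space_circle [simp]: "space circle = {0..<2 * pi}"
  by (simp add: space_restrict_space)

lemma AE_circle: "(AE t in circle. P t) \<longleftrightarrow> (AE t in lebesgue. t \<in> {0..<2 * pi} \<longrightarrow> P t)"
  by (subst AE_restrict_space_iff) auto

lemma finite_measure_circle: "finite_measure circle"
  by (rule finite_measureI) (simp add: emeasure_restrict_space)

lemma measure_circle [simp]: "measure circle {0..<2 * pi} = 2 * pi"
  by (simp add: measure_restrict_space)

lemma integrable_circle_bounded:
  assumes "f \<in> borel_measurable circle" "\<And>t. t \<in> {0..<2 * pi} \<Longrightarrow> \<bar>f t\<bar> \<le> (B :: real)"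
  shows "integrable circle f"
  using assms by (intro finite_measure.integrable_const_bound[OF finite_measure_circle, where B = B]) auto

lemma integral_circle_le:
  assumes "f \<in> borel_measurable circle" "\<And>t. t \<in> {0..<2 * pi} \<Longrightarrow> \<bar>f t\<bar> \<le> (B :: real)"
  shows "(\<integral>t. f t \<partial>circle) \<le> 2 * pi * B"
proof -
  have "f t \<le> B" if "t \<in> space circle" for t
    using assms(2)[of t] that unfolding space_circle by (auto dest: abs_le_D1)
  then have "(\<integral>t. f t \<partial>circle) \<le> (\<integral>t. B \<partial>circle)"
    by (intro integral_mono integrable_circle_bounded[OF assms] finite_measure.integrable_const[OF finite_measure_circle])
  then show ?thesis by simp
qed

text \<open>Extension by 0 moves the question to Lebesgue measure on the line, whose completeness
  makes an almost everywhere limit measurable.\<close>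

lemma borel_measurable_circle_limit:
  fixes f :: "real \<Rightarrow> real"
  assumes s: "\<And>n. s n \<in> borel_measurable circle" and lim: "AE t in circle. (\<lambda>n. s n t) \<longlonglongrightarrow> f t"
  shows "f \<in> borel_measurable circle"
proof -
  let ?C = "{0..<2 * pi}"
  have "(\<lambda>t. if t \<in> ?C then s n t else 0) \<in> borel_measurable lebesgue" for n
    using s[of n] by (subst (asm) borel_measurable_if[symmetric]) auto
  then have "(\<lambda>t. lim (\<lambda>n. if t \<in> ?C then s n t else 0)) \<in> borel_measurable lebesgue"
    by (rule borel_measurable_lim_metric)
  moreover have "AE t in lebesgue. lim (\<lambda>n. if t \<in> ?C then s n t else 0) = (if t \<in> ?C then f t else 0)"
    using lim unfolding AE_circle by eventually_elim (auto simp: limI lim_const)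
  ultimately have "(\<lambda>t. if t \<in> ?C then f t else 0) \<in> borel_measurable lebesgue"
    by (rule borel_measurable_AE)
  then show ?thesis by (subst borel_measurable_if[symmetric]) auto
qed

abbreviation SM :: "(real \<Rightarrow> 'a::real_normed_vector) \<Rightarrow> bool"
  where "SM \<equiv> strongly_measurable UNIV norm"

lemma SM_iff: "SM f \<longleftrightarrow> (\<exists>s. (\<forall>n. simple_function circle (s n)) \<and> (AE t in circle. (\<lambda>n. s n t) \<longlonglongrightarrow> f t))"
proof -
  have "(\<lambda>n. norm (s n t - f t)) \<longlonglongrightarrow> 0 \<longleftrightarrow> (\<lambda>n. s n t) \<longlonglongrightarrow> f t" for s :: "nat \<Rightarrow> real \<Rightarrow> 'a" and t
    by (simp add: tendsto_norm_zero_iff LIM_zero_iff)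
  then show ?thesis by (simp add: strongly_measurable_def)
qed

lemma SM_simple: "simple_function circle f \<Longrightarrow> SM f"
  unfolding SM_iff by (intro exI[of _ "\<lambda>n. f"]) auto

lemma SM_compose2:
  assumes "SM f" "SM g" and h: "continuous_on UNIV (\<lambda>(x, y). h x y)"
  shows "SM (\<lambda>t. h (f t) (g t))"
proof -
  obtain s r where s: "\<And>n. simple_function circle (s n)" "AE t in circle. (\<lambda>n. s n t) \<longlonglongrightarrow> f t"
    and r: "\<And>n. simple_function circle (r n)" "AE t in circle. (\<lambda>n. r n t) \<longlonglongrightarrow> g t"
    using assms(1,2) unfolding SM_iff by blast
  show ?thesis unfolding SM_iff
  proof (intro exI conjI allI)
    show "simple_function circle (\<lambda>t. h (s n t) (r n t))" for n
      by (rule simple_function_compose2[OF s(1) r(1)])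
    show "AE t in circle. (\<lambda>n. h (s n t) (r n t)) \<longlonglongrightarrow> h (f t) (g t)"
      using s(2) r(2)
    proof eventually_elim
      case (elim t)
      have "isCont (\<lambda>(x, y). h x y) (f t, g t)" using h by (simp add: continuous_on_eq_continuous_at)
      from isCont_tendsto_compose[OF this tendsto_Pair[OF elim]] show ?case by simp
    qed
  qed
qed

lemma SM_add: "SM f \<Longrightarrow> SM g \<Longrightarrow> SM (\<lambda>t. f t + g t)"
  by (rule SM_compose2) (auto simp: case_prod_beta intro!: continuous_intros)

lemma SM_diff: "SM f \<Longrightarrow> SM g \<Longrightarrow> SM (\<lambda>t. f t - g t)"
  by (rule SM_compose2) (auto simp: case_prod_beta intro!: continuous_intros)

lemma SM_norm_measurable:
  assumes "SM f"
  shows "(\<lambda>t. norm (f t)) \<in> borel_measurable circle"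
proof -
  obtain s where s: "\<And>n. simple_function circle (s n)" "AE t in circle. (\<lambda>n. s n t) \<longlonglongrightarrow> f t"
    using assms unfolding SM_iff by blast
  show ?thesis
  proof (rule borel_measurable_circle_limit)
    show "(\<lambda>t. norm (s n t)) \<in> borel_measurable circle" for n
      by (intro borel_measurable_simple_function simple_function_compose1[OF s(1)])
    show "AE t in circle. (\<lambda>n. norm (s n t)) \<longlonglongrightarrow> norm (f t)"
      using s(2) by eventually_elim (rule tendsto_norm)
  qed
qed

lemma SM_continuous:
  assumes "continuous_on {0..2 * pi} f"
  shows "SM f"
proof -
  \<comment> \<open>Rounding \<open>t\<close> down to a multiple of \<open>1 / (n + 1)\<close> takes
    finitely many values on the circle and stays in the interval where \<open>f\<close> is
    continuous.\<close>
  define p where "p n t = of_int \<lfloor>real (Suc n) * t\<rfloor> / real (Suc n)" for n and t :: real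
  have p: "p n t \<in> {0..2 * pi}" "\<bar>p n t - t\<bar> \<le> 1 / real (Suc n)" if "t \<in> {0..<2 * pi}" for n t
  proof -
    have le: "of_int \<lfloor>real (Suc n) * t\<rfloor> \<le> real (Suc n) * t" "real (Suc n) * t < of_int \<lfloor>real (Suc n) * t\<rfloor> + 1"
      by linarith+
    have a: "p n t \<le> t" using le(1) unfolding p_def by (simp add: divide_le_eq mult.commute del: of_nat_Suc)
    have b: "t \<le> p n t + 1 / real (Suc n)"
      using le(2) unfolding p_def by (simp add: pos_le_divide_eq mult.commute del: of_nat_Suc flip: add_divide_distrib)
    have "0 \<le> \<lfloor>real (Suc n) * t\<rfloor>" using that by simp
    then have "0 \<le> p n t" by (simp add: p_def)
    then show "p n t \<in> {0..2 * pi}" "\<bar>p n t - t\<bar> \<le> 1 / real (Suc n)" using a b that by auto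
  qed
  have "simple_function circle (\<lambda>t. \<lfloor>real (Suc n) * t\<rfloor>)" for n
    unfolding simple_function_eq_measurable
  proof
    have "(\<lambda>t. \<lfloor>real (Suc n) * t\<rfloor>) ` space circle \<subseteq> {0..\<lfloor>real (Suc n) * (2 * pi)\<rfloor>}"
      by (auto intro!: floor_mono mult_left_mono simp del: of_nat_Suc)
    then show "finite ((\<lambda>t. \<lfloor>real (Suc n) * t\<rfloor>) ` space circle)" by (rule finite_subset) simp
    have "(\<lambda>t. \<lfloor>real (Suc n) * t\<rfloor>) \<in> measurable borel (count_space UNIV)"
      by measurable
    then show "(\<lambda>t. \<lfloor>real (Suc n) * t\<rfloor>) \<in> measurable circle (count_space UNIV)"
      by (metis measurable_completion measurable_lborel2 measurable_restrict_space1)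
  qed
  then have "simple_function circle (\<lambda>t. f (of_int \<lfloor>real (Suc n) * t\<rfloor> / real (Suc n)))" for n
    by (rule simple_function_compose1)
  then have "simple_function circle (\<lambda>t. f (p n t))" for n by (simp only: p_def)
  moreover have "(\<lambda>n. f (p n t)) \<longlonglongrightarrow> f t" if t: "t \<in> {0..<2 * pi}" for t
  proof (rule continuous_on_tendsto_compose[OF assms])
    have "(\<lambda>n. p n t - t) \<longlonglongrightarrow> 0"
      by (rule Lim_null_comparison[OF _ LIMSEQ_inverse_real_of_nat])
        (use p(2)[OF t] in \<open>auto simp: divide_inverse\<close>)
    then show "(\<lambda>n. p n t) \<longlonglongrightarrow> t" by (simp add: LIM_zero_iff)
  qed (use t p(1)[OF t] in auto)
  ultimately show ?thesis unfolding SM_iff by (intro exI[of _ "\<lambda>n t. f (p n t)"]) auto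
qed

lemma SM_trig: "is_trig f \<Longrightarrow> SM f"
  by (intro SM_continuous continuous_on_trig)

lemma bounded_trig:
  assumes "is_trig f"
  obtains B where "B \<ge> 0" "\<And>t. norm (f t) \<le> B"
proof -
  obtain S c where S: "finite S" "f = trig_poly S c" using assms by (auto simp: is_trig_def)
  have "norm (f t) \<le> (\<Sum>k\<in>S. norm (c k))" for t
    unfolding S trig_poly_def by (rule order_trans[OF norm_sum]) (simp add: norm_scaleC)
  then show ?thesis using that[of "\<Sum>k\<in>S. norm (c k)"] by (simp add: sum_nonneg)
qed

lemma integrable_norm_trig: "is_trig f \<Longrightarrow> integrable circle (\<lambda>t. norm (f t))"
  by (rule bounded_trig) (auto intro!: integrable_circle_bounded SM_norm_measurable SM_trig)

section \<open>Density of trigonometric polynomials\<close>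

text \<open>Measurability provides continuous functions converging almost everywhere. They are
  clipped to \<open>[0, 1]\<close> for dominated convergence and cut off at the ends to become
  periodic, so that \<open>is_trig_dense\<close> applies.\<close>

lemma indicator_approx:
  assumes E: "E \<in> sets circle" and e: "e > 0"
  obtains h :: "real \<Rightarrow> complex" where "is_trig h" "(\<integral>t. cmod (indicator E t - h t) \<partial>circle) \<le> e"
proof -
  have "E \<in> sets lebesgue" using E by (subst (asm) sets_restrict_space_iff) auto
  then have "(indicator E :: real \<Rightarrow> real) measurable_on UNIV"
    by (intro lebesgue_measurable_imp_measurable_on) auto
  then obtain N g where N: "negligible N" and g: "\<And>n. continuous_on UNIV (g n)"
    and lim: "\<And>x. x \<notin> N \<Longrightarrow> (\<lambda>n. g n x) \<longlonglongrightarrow> (indicator E x :: real)"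
    unfolding measurable_on_def by auto
  \<comment> \<open>Vanishes at 0 and at \<open>2 * pi\<close>, and is eventually 1 at each interior
    point.\<close>
  define c where "c n t = min 1 (real n * min t (2 * pi - t))" for n t
  define h where "h n t = max 0 (min 1 (g n t)) * c n t" for n t
  have hcont: "continuous_on S (h n)" for S n
    unfolding h_def c_def by (intro continuous_intros continuous_on_subset[OF g]) auto
  have hbd: "\<bar>h n t\<bar> \<le> 1" if "t \<in> {0..<2 * pi}" for n t
  proof -
    have "0 \<le> c n t" "c n t \<le> 1" using that by (auto simp: c_def)
    then show ?thesis unfolding h_def abs_mult by (intro mult_le_one) auto
  qed
  have hmeas: "h n \<in> borel_measurable circle" for n
    by (rule continuous_imp_measurable_on_sets_lebesgue[OF hcont]) auto
  have hlim: "(\<lambda>n. h n t) \<longlonglongrightarrow> indicator E t" if t: "t \<in> {0<..<2 * pi}" "t \<notin> N" for t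
  proof -
    define m where "m = min t (2 * pi - t)"
    have m: "m > 0" using t by (simp add: m_def)
    have "\<forall>\<^sub>F n in sequentially. c n t = 1"
    proof -
      obtain k :: nat where k: "real k > 1 / m" using reals_Archimedean2 by blast
      show ?thesis using eventually_ge_at_top[of k]
      proof eventually_elim
        case (elim n)
        then have "1 / m < real n" using k by linarith
        then have "1 \<le> real n * m" using m by (simp add: field_simps)
        then show ?case by (simp add: c_def m_def)
      qed
    qed
    then have "(\<lambda>n. c n t) \<longlonglongrightarrow> 1" by (rule tendsto_eventually)
    moreover have "(\<lambda>n. max 0 (min 1 (g n t))) \<longlonglongrightarrow> max 0 (min 1 (indicator E t))"
      by (intro tendsto_intros lim t)
    moreover have "max 0 (min 1 (indicator E t)) = (indicator E t :: real)" by (simp add: indicator_def)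
    ultimately show ?thesis unfolding h_def using tendsto_mult by fastforce
  qed
  have ae: "AE t in circle. (\<lambda>n. \<bar>indicator E t - h n t\<bar>) \<longlonglongrightarrow> 0"
    unfolding AE_circle
  proof (rule AE_I')
    \<comment> \<open>At 0 the cut-off is 0 for every \<open>n\<close>, so this point joins the
      exceptional set.\<close>
    show "insert 0 N \<in> null_sets lebesgue"
      using N by (simp flip: negligible_iff_null_sets)
    show "{t \<in> space lebesgue. \<not> (t \<in> {0..<2 * pi} \<longrightarrow> (\<lambda>n. \<bar>indicator E t - h n t\<bar>) \<longlonglongrightarrow> 0)} \<subseteq> insert 0 N"
    proof clarsimp
      fix t assume t: "0 \<le> t" "t < 2 * pi" "t \<notin> N" "\<not> (\<lambda>n. \<bar>indicator E t - h n t\<bar>) \<longlonglongrightarrow> 0"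
      have "(\<lambda>n. \<bar>indicator E t - h n t\<bar>) \<longlonglongrightarrow> 0" if "t \<noteq> 0"
        using tendsto_rabs[OF tendsto_diff[OF tendsto_const[of "indicator E t"] hlim[of t]]] t that by simp
      then show "t = 0" using t by blast
    qed
  qed
  have Emeas: "(indicator E :: real \<Rightarrow> real) \<in> borel_measurable circle" using E by simp
  have "(\<lambda>n. \<integral>t. \<bar>indicator E t - h n t\<bar> \<partial>circle) \<longlonglongrightarrow> (\<integral>t. 0 \<partial>circle)"
  proof (rule integral_dominated_convergence[where w = "\<lambda>_. 2"])
    show "integrable circle (\<lambda>_. 2 :: real)"
      by (rule finite_measure.integrable_const[OF finite_measure_circle])
    show "(\<lambda>t. \<bar>indicator E t - h n t\<bar>) \<in> borel_measurable circle" for n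
      using Emeas hmeas[of n] by measurable
    show "AE t in circle. norm \<bar>indicator E t - h n t\<bar> \<le> 2" for n
    proof (rule AE_I2)
      fix t assume "t \<in> space circle"
      then have "\<bar>h n t\<bar> \<le> 1" using hbd by simp
      then show "norm \<bar>indicator E t - h n t\<bar> \<le> 2" by (auto simp: indicator_def)
    qed
  qed (use ae in auto)
  then obtain n where n: "(\<integral>t. \<bar>indicator E t - h n t\<bar> \<partial>circle) < e / 2"
    using e LIMSEQ_D[of _ 0 "e / 2"] by (fastforce simp: abs_less_iff)
  have "complex_of_real (h n 0) = complex_of_real (h n (2 * pi))" by (simp add: h_def c_def)
  moreover have "continuous_on {0..2 * pi} (\<lambda>t. of_real (h n t) :: complex)"
    by (intro continuous_intros hcont)
  \<comment> \<open>A uniform error of this size over length \<open>2 * pi\<close> adds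
    \<open>e / 2\<close> to the integral.\<close>
  moreover have "e / (4 * pi) > 0" using e by simp
  ultimately obtain f :: "real \<Rightarrow> complex"
    where f: "is_trig f" "\<And>t. t \<in> {0..2 * pi} \<Longrightarrow> cmod (of_real (h n t) - f t) \<le> e / (4 * pi)"
    using is_trig_dense[of "\<lambda>t. of_real (h n t) :: complex" "e / (4 * pi)"] by blast
  have SMd: "SM (\<lambda>t. of_real (h n t) - f t)"
    by (intro SM_diff SM_trig f SM_continuous continuous_intros hcont)
  have SMi: "SM (\<lambda>t. indicator E t - f t)"
    by (intro SM_diff SM_trig f SM_simple simple_function_indicator E)
  have i1: "integrable circle (\<lambda>t. \<bar>indicator E t - h n t\<bar>)"
  proof (rule integrable_circle_bounded)
    show "(\<lambda>t. \<bar>indicator E t - h n t\<bar>) \<in> borel_measurable circle"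
      using Emeas hmeas[of n] by measurable
    show "\<bar>\<bar>indicator E t - h n t\<bar>\<bar> \<le> 2" if "t \<in> {0..<2 * pi}" for t
      using hbd[OF that, of n] by (auto simp: indicator_def)
  qed
  have i2: "integrable circle (\<lambda>t. cmod (of_real (h n t) - f t))"
    using f(2) by (intro integrable_circle_bounded[where B = "e / (4 * pi)"] SM_norm_measurable SMd) auto
  have pt: "cmod (indicator E t - f t) \<le> \<bar>indicator E t - h n t\<bar> + cmod (of_real (h n t) - f t)" for t
  proof -
    have "indicator E t - f t = of_real (indicator E t - h n t) + (of_real (h n t) - f t)"
      by (simp add: indicator_def)
    then have "cmod (indicator E t - f t) \<le> cmod (of_real (indicator E t - h n t)) + cmod (of_real (h n t) - f t)"
      by (simp only: norm_triangle_ineq)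
    then show ?thesis by (simp only: norm_of_real)
  qed
  have "(\<integral>t. cmod (indicator E t - f t) \<partial>circle) \<le> (\<integral>t. \<bar>indicator E t - h n t\<bar> + cmod (of_real (h n t) - f t) \<partial>circle)"
  proof (rule integral_mono)
    show "integrable circle (\<lambda>t. cmod (indicator E t - f t))"
      by (rule Bochner_Integration.integrable_bound[OF Bochner_Integration.integrable_add[OF i1 i2] SM_norm_measurable[OF SMi]])
        (use pt in auto)
  qed (use pt i1 i2 in auto)
  also have "\<dots> = (\<integral>t. \<bar>indicator E t - h n t\<bar> \<partial>circle) + (\<integral>t. cmod (of_real (h n t) - f t) \<partial>circle)"
    by (rule Bochner_Integration.integral_add[OF i1 i2])
  also have "\<dots> \<le> e / 2 + 2 * pi * (e / (4 * pi))"
    using n f(2) by (intro add_mono integral_circle_le SM_norm_measurable SMd) auto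
  finally show ?thesis using that[OF f(1)] by simp
qed

lemma simple_approx:
  fixes s :: "real \<Rightarrow> 'a::complex_banach"
  assumes s: "simple_function circle s" and e: "e > 0"
  obtains h where "is_trig h" "(\<integral>t. norm (s t - h t) \<partial>circle) \<le> e"
proof -
  define V where "V = s ` space circle"
  have V: "finite V" using simple_functionD(1)[OF s] by (simp add: V_def)
  define E where "E v = s -` {v} \<inter> space circle" for v
  have E: "E v \<in> sets circle" for v
    unfolding E_def using simple_functionD(2)[OF s] by blast
  \<comment> \<open>The denominator is positive in all cases and at least the sum of the norms of
    the values, which is the factor that the errors of the indicators pick up.\<close>
  define \<epsilon> where "\<epsilon> = e / ((real (card V) + 1) * (\<Sum>v\<in>V. norm v + 1) + 1)"
  have den: "(real (card V) + 1) * (\<Sum>v\<in>V. norm v + 1) + 1 > 0"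
    by (intro add_nonneg_pos mult_nonneg_nonneg sum_nonneg) auto
  have \<epsilon>: "\<epsilon> > 0" using e den by (simp add: \<epsilon>_def)
  have "\<exists>h :: real \<Rightarrow> complex. is_trig h \<and> (\<integral>t. cmod (indicator (E v) t - h t) \<partial>circle) \<le> \<epsilon>" for v
    using indicator_approx[OF E \<epsilon>] by metis
  then obtain g :: "'a \<Rightarrow> real \<Rightarrow> complex" where g: "\<And>v. is_trig (g v)"
    "\<And>v. (\<integral>t. cmod (indicator (E v) t - g v t) \<partial>circle) \<le> \<epsilon>" by metis
  define h where "h t = (\<Sum>v\<in>V. g v t *\<^sub>C v)" for t
  have h: "is_trig h"
    unfolding h_def
  proof (intro is_trig_sum is_trig_linear[OF g(1)])
    show "bounded_clinear (\<lambda>c. c *\<^sub>C v)" for v :: 'a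
      by (simp add: bounded_clinear_def scaleC.bounded_linear_left scaleC_complex_def scaleC_scaleC)
  qed
  have SMi: "SM (\<lambda>t. indicator (E v) t - g v t)" for v
    by (intro SM_diff SM_trig g SM_simple simple_function_indicator E)
  have int: "integrable circle (\<lambda>t. cmod (indicator (E v) t - g v t))" for v
  proof -
    obtain B where B: "\<And>t. norm (g v t) \<le> B" using bounded_trig[OF g(1)] by blast
    have "cmod (indicator (E v) t - g v t) \<le> 1 + B" for t
      using norm_triangle_ineq4[of "indicator (E v) t" "g v t"] B[of t]
      by (auto simp: indicator_def split: if_splits)
    then show ?thesis by (intro integrable_circle_bounded[where B = "1 + B"] SM_norm_measurable SMi) auto
  qed
  have seq: "s t = (\<Sum>v\<in>V. indicator (E v) t *\<^sub>C v)" if "t \<in> space circle" for t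
  proof -
    have "(\<Sum>v\<in>V. indicator (E v) t *\<^sub>C v) = (\<Sum>v\<in>V. if v = s t then v else 0)"
      using that by (intro sum.cong) (auto simp: E_def indicator_def)
    also have "\<dots> = s t" using that V by (simp add: sum.delta' V_def)
    finally show ?thesis by simp
  qed
  have pt: "norm (s t - h t) \<le> (\<Sum>v\<in>V. cmod (indicator (E v) t - g v t) * norm v)" if "t \<in> space circle" for t
  proof -
    have "s t - h t = (\<Sum>v\<in>V. (indicator (E v) t - g v t) *\<^sub>C v)"
      by (simp add: seq[OF that] h_def scaleC.diff_left sum_subtractf)
    then show ?thesis using norm_sum[of "\<lambda>v. (indicator (E v) t - g v t) *\<^sub>C v" V] by (simp add: norm_scaleC)
  qed
  have isum: "integrable circle (\<lambda>t. \<Sum>v\<in>V. cmod (indicator (E v) t - g v t) * norm v)"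
    by (intro Bochner_Integration.integrable_sum integrable_mult_left int)
  have "(\<integral>t. norm (s t - h t) \<partial>circle) \<le> (\<integral>t. (\<Sum>v\<in>V. cmod (indicator (E v) t - g v t) * norm v) \<partial>circle)"
  proof (rule integral_mono[OF _ isum])
    show "integrable circle (\<lambda>t. norm (s t - h t))"
      by (rule Bochner_Integration.integrable_bound[OF isum SM_norm_measurable[OF SM_diff[OF SM_simple[OF s] SM_trig[OF h]]]])
        (use pt in \<open>auto intro!: AE_I2 simp: sum_nonneg abs_of_nonneg\<close>)
  qed (use pt in auto)
  also have "\<dots> = (\<Sum>v\<in>V. (\<integral>t. cmod (indicator (E v) t - g v t) \<partial>circle) * norm v)"
    by (subst Bochner_Integration.integral_sum) (auto intro!: integrable_mult_left int)
  also have "\<dots> \<le> (\<Sum>v\<in>V. \<epsilon> * norm v)"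
    by (intro sum_mono mult_right_mono g) auto
  also have "\<dots> = \<epsilon> * (\<Sum>v\<in>V. norm v)" by (simp add: sum_distrib_left)
  also have "\<dots> \<le> \<epsilon> * ((real (card V) + 1) * (\<Sum>v\<in>V. norm v + 1) + 1)"
  proof (intro mult_left_mono)
    have "(\<Sum>v\<in>V. norm v) \<le> (\<Sum>v\<in>V. norm v + 1)" by (intro sum_mono) auto
    also have "\<dots> \<le> (real (card V) + 1) * (\<Sum>v\<in>V. norm v + 1)"
      by (simp add: distrib_right sum_nonneg add_nonneg_nonneg)
    finally show "(\<Sum>v\<in>V. norm v) \<le> (real (card V) + 1) * (\<Sum>v\<in>V. norm v + 1) + 1" by simp
  qed (use \<epsilon> in simp)
  also have "\<dots> = e" using den by (simp add: \<epsilon>_def)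
  finally show ?thesis using that[OF h] by blast
qed

lemma trig_dense_L1:
  fixes f :: "real \<Rightarrow> 'a::complex_banach"
  assumes f: "SM f" and int: "integrable circle (\<lambda>t. norm (f t))" and e: "e > 0"
  obtains h where "is_trig h" "(\<integral>t. norm (f t - h t) \<partial>circle) \<le> e"
proof -
  obtain s where s: "\<And>n. simple_function circle (s n)" "AE t in circle. (\<lambda>n. s n t) \<longlonglongrightarrow> f t"
    using f unfolding SM_iff by blast
  \<comment> \<open>The truncation provides the dominating function \<open>3 * norm (f t)\<close>
    without disturbing the limit: where \<open>f t\<close> is not 0 it is eventually inactive, and
    where \<open>f t = 0\<close> it returns 0.\<close>
  define r where "r n t = (if norm (s n t) \<le> 2 * norm (f t) then s n t else 0)" for n t
  have [measurable]: "(\<lambda>t. norm (f t)) \<in> borel_measurable circle" by (rule SM_norm_measurable[OF f])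
  have [measurable]: "(\<lambda>t. norm (s n t)) \<in> borel_measurable circle" for n
    by (intro SM_norm_measurable SM_simple s)
  have rs: "simple_function circle (r n)" for n
    unfolding r_def by (intro simple_function_If s simple_function_const) measurable
  have lim: "AE t in circle. (\<lambda>n. norm (f t - r n t)) \<longlonglongrightarrow> 0"
    using s(2)
  proof eventually_elim
    case (elim t)
    have "(\<lambda>n. r n t) \<longlonglongrightarrow> f t"
    proof (cases "f t = 0")
      case True
      then have "r n t = f t" for n by (simp add: r_def)
      then show ?thesis by simp
    next
      case False
      have "\<forall>\<^sub>F n in sequentially. norm (s n t) < 2 * norm (f t)"
        using False by (intro order_tendstoD(2)[OF tendsto_norm[OF elim]]) simp
      then have "\<forall>\<^sub>F n in sequentially. s n t = r n t"
        by eventually_elim (simp add: r_def)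
      then show ?thesis by (rule Lim_transform_eventually[OF elim])
    qed
    from tendsto_diff[OF tendsto_const[of "f t"] this] show ?case
      by (intro tendsto_norm_zero) simp
  qed
  have bd: "norm (f t - r n t) \<le> 3 * norm (f t)" for n t
    using norm_triangle_ineq4[of "f t" "r n t"] by (auto simp: r_def)
  have meas: "(\<lambda>t. norm (f t - r n t)) \<in> borel_measurable circle" for n
    by (intro SM_norm_measurable SM_diff f SM_simple rs)
  have "(\<lambda>n. \<integral>t. norm (f t - r n t) \<partial>circle) \<longlonglongrightarrow> (\<integral>t. 0 \<partial>circle)"
    by (rule integral_dominated_convergence[where w = "\<lambda>t. 3 * norm (f t)"])
      (use lim bd meas int in auto)
  then obtain n where n: "(\<integral>t. norm (f t - r n t) \<partial>circle) < e / 2"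
    using e LIMSEQ_D[of _ 0 "e / 2"] by (fastforce simp: abs_less_iff)
  obtain h where h: "is_trig h" "(\<integral>t. norm (r n t - h t) \<partial>circle) \<le> e / 2"
    using simple_approx[OF rs, of "e / 2" n] e by auto
  have i1: "integrable circle (\<lambda>t. norm (f t - r n t))"
    by (rule Bochner_Integration.integrable_bound[OF integrable_mult_right[OF int, of 3] meas]) (use bd in auto)
  have i3: "integrable circle (\<lambda>t. norm (f t - h t))"
    by (rule Bochner_Integration.integrable_bound[OF
          Bochner_Integration.integrable_add[OF int integrable_norm_trig[OF h(1)]]
          SM_norm_measurable[OF SM_diff[OF f SM_trig[OF h(1)]]]])
      (auto simp: norm_triangle_ineq4)
  have i2: "integrable circle (\<lambda>t. norm (r n t - h t))"
  proof (rule Bochner_Integration.integrable_bound[OF Bochner_Integration.integrable_add[OF i1 i3]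
        SM_norm_measurable[OF SM_diff[OF SM_simple[OF rs] SM_trig[OF h(1)]]]], rule AE_I2)
    fix t
    show "norm (norm (r n t - h t)) \<le> norm (norm (f t - r n t) + norm (f t - h t))"
      using norm_triangle_ineq4[of "f t - h t" "f t - r n t"] by simp
  qed
  have "(\<integral>t. norm (f t - h t) \<partial>circle) \<le> (\<integral>t. norm (f t - r n t) + norm (r n t - h t) \<partial>circle)"
  proof (rule integral_mono[OF i3 Bochner_Integration.integrable_add[OF i1 i2]])
    show "norm (f t - h t) \<le> norm (f t - r n t) + norm (r n t - h t)" for t
      using norm_triangle_ineq[of "f t - r n t" "r n t - h t"] by simp
  qed
  also have "\<dots> = (\<integral>t. norm (f t - r n t) \<partial>circle) + (\<integral>t. norm (r n t - h t) \<partial>circle)"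
    by (rule Bochner_Integration.integral_add[OF i1 i2])
  also have "\<dots> \<le> e" using n h(2) by simp
  finally show ?thesis using that[OF h(1)] by blast
qed

text \<open>The pointwise bound \<open>y \<le> l + l powr (1 - p) * y powr p\<close> with the optimal \<open>l\<close>
  replaces Hoelder's inequality.\<close>

lemma L1_le_Lp:
  fixes y :: "real \<Rightarrow> real"
  assumes p: "p \<ge> 1" and y: "y \<in> borel_measurable circle" "\<And>t. y t \<ge> 0"
    and int: "integrable circle (\<lambda>t. y t powr p)"
  shows "integrable circle y" "(\<integral>t. y t \<partial>circle) \<le> (2 * pi + 1) * (\<integral>t. y t powr p \<partial>circle) powr (1 / p)"
proof -
  define a where "a = (\<integral>t. y t powr p \<partial>circle)"
  have a: "a \<ge> 0" by (simp add: a_def)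
  have pt: "y t \<le> l + l powr (1 - p) * y t powr p" if l: "l > 0" for l t
  proof (cases "y t \<le> l")
    case True
    then show ?thesis by (simp add: add_increasing2)
  next
    case False
    then have yl: "y t > l" by simp
    then have "l powr (p - 1) \<le> y t powr (p - 1)" using l p by (intro powr_mono2) auto
    then have "l powr (1 - p) * l powr (p - 1) \<le> l powr (1 - p) * y t powr (p - 1)"
      by (intro mult_left_mono) auto
    moreover have "l powr (1 - p) * l powr (p - 1) = 1" using l by (simp flip: powr_add)
    ultimately have "1 \<le> l powr (1 - p) * y t powr (p - 1)" by simp
    then have "y t * 1 \<le> y t * (l powr (1 - p) * y t powr (p - 1))"
      using y(2) by (intro mult_left_mono) auto
    also have "\<dots> = l powr (1 - p) * y t powr p"
      using yl l by (simp add: powr_diff)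
    finally show ?thesis using l by simp
  qed
  have ub: "integrable circle (\<lambda>t. l + l powr (1 - p) * y t powr p)" for l
    by (intro Bochner_Integration.integrable_add integrable_mult_right int
        finite_measure.integrable_const[OF finite_measure_circle])
  show i: "integrable circle y"
    by (rule Bochner_Integration.integrable_bound[OF ub[of 1] y(1)]) (use pt[of 1] y(2) in auto)
  have le: "(\<integral>t. y t \<partial>circle) \<le> 2 * pi * l + l powr (1 - p) * a" if "l > 0" for l
  proof -
    have "(\<integral>t. y t \<partial>circle) \<le> (\<integral>t. l + l powr (1 - p) * y t powr p \<partial>circle)"
      by (rule integral_mono[OF i ub]) (use pt[OF that] in auto)
    also have "\<dots> = (\<integral>t. l \<partial>circle) + (\<integral>t. l powr (1 - p) * y t powr p \<partial>circle)"
      by (intro Bochner_Integration.integral_add integrable_mult_right int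
          finite_measure.integrable_const[OF finite_measure_circle])
    finally show ?thesis by (simp add: a_def)
  qed
  show "(\<integral>t. y t \<partial>circle) \<le> (2 * pi + 1) * (\<integral>t. y t powr p \<partial>circle) powr (1 / p)"
  proof (cases "a = 0")
    case True
    then have "(\<integral>t. y t \<partial>circle) \<le> 2 * pi * l" if "l > 0" for l using le[OF that] by simp
    then have "(\<integral>t. y t \<partial>circle) \<le> 0 + e" if "e > 0" for e
      using that pi_gt_zero by (metis (no_types, opaque_lifting) add_0 mult_2 mult_pos_pos nonzero_mult_div_cancel_left
          order_less_irrefl times_divide_eq_right zero_less_divide_iff zero_less_numeral)
    then have "(\<integral>t. y t \<partial>circle) \<le> 0" by (rule field_le_epsilon)
    then show ?thesis using True by (simp add: a_def)
  next
    case False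
    with a have a: "a > 0" by simp
    \<comment> \<open>With this \<open>l\<close> the term \<open>l powr (1 - p) * a\<close> becomes
      \<open>l\<close> itself, whence the constant \<open>2 * pi + 1\<close>.\<close>
    define l where "l = a powr (1 / p)"
    have l: "l > 0" using a by (simp add: l_def)
    have "a = l powr p" using a p by (simp add: l_def powr_powr)
    then have "l powr (1 - p) * a = l" using l by (simp flip: powr_add)
    then show ?thesis using le[OF l] by (simp add: l_def a_def distrib_right)
  qed
qed

section \<open>Function lattices\<close>

context
  fixes F :: "(real \<Rightarrow> real) set" and q :: "(real \<Rightarrow> real) \<Rightarrow> real"
  assumes lattice: "quasi_normed_function_lattice F q"
begin

lemma lattice_add: "f \<in> F \<Longrightarrow> g \<in> F \<Longrightarrow> (\<lambda>t. f t + g t) \<in> F"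
  and lattice_scale: "f \<in> F \<Longrightarrow> (\<lambda>t. c * f t) \<in> F"
  and lattice_ideal: "f \<in> F \<Longrightarrow> g \<in> borel_measurable circle \<Longrightarrow> AE t in circle. \<bar>g t\<bar> \<le> \<bar>f t\<bar> \<Longrightarrow> g \<in> F \<and> q g \<le> q f"
  and lattice_nonneg: "f \<in> F \<Longrightarrow> 0 \<le> q f"
  and lattice_zero_iff: "f \<in> F \<Longrightarrow> q f = 0 \<longleftrightarrow> (AE t in circle. f t = 0)"
  and lattice_homogeneous: "f \<in> F \<Longrightarrow> q (\<lambda>t. c * f t) = \<bar>c\<bar> * q f"
  using lattice unfolding quasi_normed_function_lattice_def by blast+

lemma lattice_triangle:
  obtains K where "K \<ge> 1" "\<And>f g. f \<in> F \<Longrightarrow> g \<in> F \<Longrightarrow> q (\<lambda>t. f t + g t) \<le> K * (q f + q g)"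
proof -
  obtain K where K: "\<And>f g. f \<in> F \<Longrightarrow> g \<in> F \<Longrightarrow> q (\<lambda>t. f t + g t) \<le> K * (q f + q g)"
    using lattice unfolding quasi_normed_function_lattice_def by blast
  have "q (\<lambda>t. f t + g t) \<le> max K 1 * (q f + q g)" if "f \<in> F" "g \<in> F" for f g
    using K[OF that] lattice_nonneg[OF that(1)] lattice_nonneg[OF that(2)]
      mult_right_mono[of K "max K 1" "q f + q g"] by simp
  then show ?thesis using that[of "max K 1"] by simp
qed

text \<open>A Borel-Cantelli lemma without completeness or a Fatou property: the limit superior
  is reduced to a set inside finite unions, losing only half of its measure.\<close>

lemma lattice_borel_cantelli:
  obtains \<kappa> :: real where "0 < \<kappa>" "\<kappa> \<le> 1 / 2"
    "\<And>E D. (\<And>n. E n \<in> sets circle) \<Longrightarrow> (\<And>n. indicator (E n) \<in> F) \<Longrightarrow>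
       (\<And>n. q (indicator (E n)) \<le> D * \<kappa> ^ n) \<Longrightarrow> \<exists>t\<in>{0..<2 * pi}. \<forall>\<^sub>F n in sequentially. t \<notin> E n"
proof -
  obtain K where K: "K \<ge> 1" "\<And>f g. f \<in> F \<Longrightarrow> g \<in> F \<Longrightarrow> q (\<lambda>t. f t + g t) \<le> K * (q f + q g)"
    using lattice_triangle by blast
  \<comment> \<open>Each use of the quasi-triangle inequality costs a factor \<open>K\<close>. With
    \<open>K * \<kappa> = 1 / 2\<close>, peeling off one term at a time keeps every finite sum from
    index \<open>m\<close> on below \<open>2 * K * D * \<kappa> ^ m\<close>, whatever its
    length.\<close>
  define \<kappa> where "\<kappa> = 1 / (2 * K)"
  have \<kappa>: "0 < \<kappa>" "\<kappa> \<le> 1 / 2" "K * \<kappa> = 1 / 2" using K(1) by (auto simp: \<kappa>_def)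
  moreover have "\<exists>t\<in>{0..<2 * pi}. \<forall>\<^sub>F n in sequentially. t \<notin> E n"
    if E: "\<And>n. E n \<in> sets circle" and EF: "\<And>n. indicator (E n) \<in> F"
      and qE: "\<And>n. q (indicator (E n)) \<le> D * \<kappa> ^ n" for E D
  proof (rule ccontr)
    assume none: "\<not> ?thesis"
    interpret finite_measure circle by (rule finite_measure_circle)
    define s where "s m j t = (\<Sum>i\<le>j. indicator (E (m + i)) t :: real)" for m j t
    have sF: "s m j \<in> F" for m j
      unfolding s_def by (induction j) (auto intro: EF lattice_add)
    have D0: "D \<ge> 0" using order_trans[OF lattice_nonneg[OF EF] qE[of 0]] by simp
    have qs: "q (s m j) \<le> 2 * K * (D * \<kappa> ^ m)" for m j
    proof (induction j arbitrary: m)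
      case 0
      have "s m 0 = indicator (E m)" by (auto simp: s_def)
      then have "q (s m 0) \<le> D * \<kappa> ^ m" using qE[of m] by simp
      also have "\<dots> = 1 * (D * \<kappa> ^ m)" by simp
      also have "\<dots> \<le> 2 * K * (D * \<kappa> ^ m)"
        using K(1) D0 \<kappa>(1) by (intro mult_right_mono mult_nonneg_nonneg) auto
      finally show ?case .
    next
      case (Suc j)
      have "s m (Suc j) = (\<lambda>t. indicator (E m) t + s (Suc m) j t)"
        unfolding s_def sum.atMost_Suc_shift by (simp add: o_def)
      then have "q (s m (Suc j)) \<le> K * (q (indicator (E m)) + q (s (Suc m) j))"
        using K(2)[OF EF sF] by simp
      also have "\<dots> \<le> K * (D * \<kappa> ^ m + 2 * K * (D * \<kappa> ^ Suc m))"
        using qE[of m] Suc.IH[of "Suc m"] K(1) by (intro mult_left_mono add_mono) auto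
      also have "2 * K * (D * \<kappa> ^ Suc m) = 2 * (K * \<kappa>) * (D * \<kappa> ^ m)" by simp
      also have "\<dots> = D * \<kappa> ^ m" using \<kappa>(3) by simp
      finally show ?case by (simp add: algebra_simps)
    qed
    define G where "G = {t \<in> {0..<2 * pi}. \<exists>\<^sub>F n in sequentially. t \<in> E n}"
    have "G = {0..<2 * pi}" using none by (auto simp: G_def not_eventually)
    define A where "A m j = {0..<2 * pi} - (\<Union>i\<le>j. E (m + i))" for m j
    have Ameas: "A m j \<in> sets circle" for m j
      unfolding A_def using sets.top[of circle] E by (intro sets.Diff sets.finite_UN) auto
    \<comment> \<open>Under the contrary assumption every point lies in infinitely many
      \<open>E n\<close>, so the finite unions from index \<open>m\<close> on exhaust the circle.
      The uncovered measures are chosen to sum to at most \<open>pi\<close>, half of the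
      total.\<close>
    have "\<exists>j. measure circle (A m j) \<le> pi / 2 * (1 / 2) ^ m" for m
    proof -
      have "(\<lambda>j. measure circle (A m j)) \<longlonglongrightarrow> measure circle (\<Inter>j. A m j)"
        using Ameas by (intro finite_Lim_measure_decseq) (auto simp: decseq_def A_def)
      moreover have "(\<Inter>j. A m j) = {}"
      proof -
        have "t \<notin> (\<Inter>j. A m j)" for t
        proof
          assume t: "t \<in> (\<Inter>j. A m j)"
          then have "t \<in> G" using \<open>G = {0..<2 * pi}\<close> by (auto simp: A_def)
          then obtain n where "n \<ge> m" "t \<in> E n" by (auto simp: G_def frequently_sequentially)
          then have "t \<notin> A m (n - m)" by (auto simp: A_def intro!: bexI[of _ "n - m"])
          then show False using t by blast
        qed
        then show ?thesis by blast
      qed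
      ultimately have "(\<lambda>j. measure circle (A m j)) \<longlonglongrightarrow> 0" by simp
      then have "\<forall>\<^sub>F j in sequentially. measure circle (A m j) < pi / 2 * (1 / 2) ^ m"
        by (rule order_tendstoD) simp
      then show ?thesis by (auto simp: eventually_sequentially intro: less_imp_le)
    qed
    then obtain j where j: "\<And>m. measure circle (A m (j m)) \<le> pi / 2 * (1 / 2) ^ m" by metis
    have "measure circle (\<Union>m. A m (j m)) \<le> (\<Sum>m. measure circle (A m (j m)))"
      and "(\<Sum>m. measure circle (A m (j m))) \<le> (\<Sum>m. pi / 2 * (1 / 2) ^ m)"
    proof -
      have geo: "summable (\<lambda>m. pi / 2 * (1 / 2 :: real) ^ m)"
        by (intro summable_mult summable_geometric) simp
      then have sm: "summable (\<lambda>m. measure circle (A m (j m)))"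
        by (rule summable_comparison_test'[of _ 0]) (use j in auto)
      show "measure circle (\<Union>m. A m (j m)) \<le> (\<Sum>m. measure circle (A m (j m)))"
        using Ameas by (intro finite_measure_subadditive_countably sm) auto
      show "(\<Sum>m. measure circle (A m (j m))) \<le> (\<Sum>m. pi / 2 * (1 / 2) ^ m)"
        by (intro suminf_le j sm geo)
    qed
    moreover have "(\<Sum>m. pi / 2 * (1 / 2 :: real) ^ m) = pi"
      by (subst suminf_mult) (auto simp: suminf_geometric)
    ultimately have small: "measure circle (\<Union>m. A m (j m)) \<le> pi" by linarith
    \<comment> \<open>For every \<open>m\<close>, \<open>H\<close> lies in a finite union of sets
      with indices at least \<open>m\<close>; so its indicator has quasi-norm 0, although its
      measure is at least \<open>pi\<close>.\<close>
    define H where "H = {0..<2 * pi} - (\<Union>m. A m (j m))"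
    have Un: "(\<Union>m. A m (j m)) \<in> sets circle" using Ameas by blast
    have Hs: "H \<in> sets circle" unfolding H_def using sets.top[of circle] Un by auto
    have "measure circle H = 2 * pi - measure circle (\<Union>m. A m (j m))"
      unfolding H_def using finite_measure_compl[OF Un] by simp
    then have Hpos: "measure circle H > 0" using small pi_gt_zero by linarith
    have HF: "indicator H \<in> F \<and> q (indicator H) \<le> 2 * K * (D * \<kappa> ^ m)" for m
    proof -
      have "\<bar>indicator H t\<bar> \<le> \<bar>s m (j m) t\<bar>" for t
      proof (cases "t \<in> H")
        case True
        then obtain i where i: "i \<le> j m" "t \<in> E (m + i)" by (auto simp: H_def A_def)
        have "indicator (E (m + i)) t \<le> s m (j m) t"
          unfolding s_def using i by (intro member_le_sum) auto
        then show ?thesis using i True by simp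
      qed simp
      then have "indicator H \<in> F \<and> q (indicator H) \<le> q (s m (j m))"
        using Hs by (intro lattice_ideal[OF sF]) auto
      then show ?thesis using qs[of m "j m"] by simp
    qed
    have "(\<lambda>m. 2 * K * (D * \<kappa> ^ m)) \<longlonglongrightarrow> 2 * K * (D * 0)"
      using \<kappa> by (intro tendsto_intros LIMSEQ_realpow_zero) auto
    then have "q (indicator H) \<le> 0"
      using HF by (intro LIMSEQ_le_const[where X = "\<lambda>m. 2 * K * (D * \<kappa> ^ m)"]) auto
    then have "q (indicator H) = 0" using lattice_nonneg HF by (intro antisym) auto
    then have "AE t in circle. (indicator H t :: real) = 0" using lattice_zero_iff HF by blast
    then have "AE t in circle. t \<notin> H" by eventually_elim (auto simp: indicator_def split: if_splits)
    then have "measure circle H = 0"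
      using AE_iff_null_sets[OF Hs] by (intro measure_eq_0_null_sets) auto
    then show False using Hpos by simp
  qed
  ultimately show ?thesis using that by blast
qed

end

section \<open>Scalar Lebesgue spaces as function lattices\<close>

definition Lp_fun :: "real \<Rightarrow> (real \<Rightarrow> real) set"
  where "Lp_fun p = {f \<in> borel_measurable circle. integrable circle (\<lambda>t. \<bar>f t\<bar> powr p)}"

definition Lp_fun_norm :: "real \<Rightarrow> (real \<Rightarrow> real) \<Rightarrow> real"
  where "Lp_fun_norm p f = (\<integral>t. \<bar>f t\<bar> powr p \<partial>circle) powr (1 / p)"

lemma powr_add_le:
  assumes "p \<ge> 1" "0 \<le> (a :: real)" "0 \<le> b"
  shows "(a + b) powr p \<le> 2 powr p * (a powr p + b powr p)"
proof -
  have "(a + b) powr p \<le> (2 * max a b) powr p" using assms by (intro powr_mono2) auto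
  also have "\<dots> = 2 powr p * max a b powr p" using assms by (simp add: powr_mult)
  also have "\<dots> \<le> 2 powr p * (a powr p + b powr p)"
    by (intro mult_left_mono) (auto simp: max_def)
  finally show ?thesis .
qed

text \<open>Only a quasi-norm is asked for, so the crude pointwise bound \<open>powr_add_le\<close>
  suffices. It leads to the constant 4, since \<open>2 powr (1 / p)\<close> is at most 2.\<close>

lemma Lp_lattice:
  assumes p: "p \<ge> 1"
  shows "quasi_normed_function_lattice (Lp_fun p) (Lp_fun_norm p)"
proof -
  have inner: "integrable circle (\<lambda>t. \<bar>f t + g t\<bar> powr p) \<and>
      (\<integral>t. \<bar>f t + g t\<bar> powr p \<partial>circle) \<le> 2 powr p * ((\<integral>t. \<bar>f t\<bar> powr p \<partial>circle) + (\<integral>t. \<bar>g t\<bar> powr p \<partial>circle))"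
    if "f \<in> Lp_fun p" "g \<in> Lp_fun p" for f g
  proof -
    have [measurable]: "f \<in> borel_measurable circle" "g \<in> borel_measurable circle"
      and i: "integrable circle (\<lambda>t. \<bar>f t\<bar> powr p)" "integrable circle (\<lambda>t. \<bar>g t\<bar> powr p)"
      using that by (auto simp: Lp_fun_def)
    have i2: "integrable circle (\<lambda>t. 2 powr p * (\<bar>f t\<bar> powr p + \<bar>g t\<bar> powr p))"
      by (intro integrable_mult_right Bochner_Integration.integrable_add i)
    have le: "\<bar>f t + g t\<bar> powr p \<le> 2 powr p * (\<bar>f t\<bar> powr p + \<bar>g t\<bar> powr p)" for t
      by (rule order_trans[OF powr_mono2 powr_add_le]) (use p in auto)
    have i3: "integrable circle (\<lambda>t. \<bar>f t + g t\<bar> powr p)"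
      by (rule Bochner_Integration.integrable_bound[OF i2]) (use le in auto)
    have "(\<integral>t. \<bar>f t + g t\<bar> powr p \<partial>circle) \<le> (\<integral>t. 2 powr p * (\<bar>f t\<bar> powr p + \<bar>g t\<bar> powr p) \<partial>circle)"
      by (rule integral_mono[OF i3 i2 le])
    then show ?thesis using i i3 by simp
  qed
  have scale: "\<bar>c * f t\<bar> powr p = \<bar>c\<bar> powr p * \<bar>f t\<bar> powr p" for c f and t :: real
    by (simp add: abs_mult powr_mult)
  have tri: "\<exists>K. \<forall>f\<in>Lp_fun p. \<forall>g\<in>Lp_fun p. Lp_fun_norm p (\<lambda>t. f t + g t) \<le> K * (Lp_fun_norm p f + Lp_fun_norm p g)"
  proof (intro exI[of _ 4] ballI)
    fix f g assume fg: "f \<in> Lp_fun p" "g \<in> Lp_fun p"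
    define a b where "a = (\<integral>t. \<bar>f t\<bar> powr p \<partial>circle)" and "b = (\<integral>t. \<bar>g t\<bar> powr p \<partial>circle)"
    have ab: "a \<ge> 0" "b \<ge> 0" by (simp_all add: a_def b_def)
    have "Lp_fun_norm p (\<lambda>t. f t + g t) \<le> (2 powr p * (a + b)) powr (1 / p)"
      unfolding Lp_fun_norm_def a_def b_def using inner[OF fg] p by (intro powr_mono2) auto
    also have "\<dots> \<le> (2 powr p * (2 * max a b)) powr (1 / p)"
      using ab p by (intro powr_mono2 mult_left_mono) auto
    also have "\<dots> = 2 * (2 powr (1 / p) * max a b powr (1 / p))"
      using ab p by (simp add: powr_mult powr_powr)
    also have "\<dots> \<le> 2 * (2 * (a powr (1 / p) + b powr (1 / p)))"
    proof (intro mult_left_mono mult_mono)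
      have "2 powr (1 / p) \<le> 2 powr (1 :: real)" using p by (intro powr_mono) auto
      then show "2 powr (1 / p) \<le> (2 :: real)" by simp
      show "max a b powr (1 / p) \<le> a powr (1 / p) + b powr (1 / p)" by (auto simp: max_def)
    qed auto
    finally show "Lp_fun_norm p (\<lambda>t. f t + g t) \<le> 4 * (Lp_fun_norm p f + Lp_fun_norm p g)"
      by (simp add: Lp_fun_norm_def a_def b_def)
  qed
  have ideal: "g \<in> Lp_fun p \<and> Lp_fun_norm p g \<le> Lp_fun_norm p f"
    if f: "f \<in> Lp_fun p" and g[measurable]: "g \<in> borel_measurable circle" and le: "AE t in circle. \<bar>g t\<bar> \<le> \<bar>f t\<bar>" for f g
  proof -
    have i: "integrable circle (\<lambda>t. \<bar>f t\<bar> powr p)" using f by (simp add: Lp_fun_def)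
    have le': "AE t in circle. \<bar>g t\<bar> powr p \<le> \<bar>f t\<bar> powr p"
      using le by eventually_elim (use p in \<open>auto intro: powr_mono2\<close>)
    have i2: "integrable circle (\<lambda>t. \<bar>g t\<bar> powr p)"
      by (rule Bochner_Integration.integrable_bound[OF i]) (use le' in auto)
    then show ?thesis
      unfolding Lp_fun_norm_def using p integral_mono_AE[OF i2 i le']
      by (auto simp: Lp_fun_def g intro!: powr_mono2)
  qed
  have zero: "Lp_fun_norm p f = 0 \<longleftrightarrow> (AE t in circle. f t = 0)" if "f \<in> Lp_fun p" for f
  proof -
    have "Lp_fun_norm p f = 0 \<longleftrightarrow> (\<integral>t. \<bar>f t\<bar> powr p \<partial>circle) = 0" by (simp add: Lp_fun_norm_def)
    also have "\<dots> \<longleftrightarrow> (AE t in circle. \<bar>f t\<bar> powr p = 0)"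
      using that by (intro integral_nonneg_eq_0_iff_AE) (auto simp: Lp_fun_def)
    finally show ?thesis by simp
  qed
  have hom: "Lp_fun_norm p (\<lambda>t. c * f t) = \<bar>c\<bar> * Lp_fun_norm p f" for c f
    using p by (simp add: Lp_fun_norm_def scale powr_mult powr_powr)
  have sc: "(\<lambda>t. c * f t) \<in> Lp_fun p" if "f \<in> Lp_fun p" for c f
    using that by (auto simp: Lp_fun_def scale intro!: borel_measurable_times)
  have ad: "(\<lambda>t. f t + g t) \<in> Lp_fun p" if "f \<in> Lp_fun p" "g \<in> Lp_fun p" for f g
    using inner[OF that] that by (auto simp: Lp_fun_def intro!: borel_measurable_add)
  have nn: "0 \<le> Lp_fun_norm p f" for f by (simp add: Lp_fun_norm_def)
  have z: "(\<lambda>t. 0) \<in> Lp_fun p" "Lp_fun p \<subseteq> borel_measurable circle"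
    using p by (auto simp: Lp_fun_def)
  show ?thesis
    unfolding quasi_normed_function_lattice_def
    by (intro conjI ballI allI impI)
      ((rule z sc ad nn hom zero tri ideal[THEN conjunct1] ideal[THEN conjunct2]; assumption?)+)
qed

lemma Lp_space_lattice: "Lp_space UNIV norm p = lattice_space (Lp_fun p)"
  using SM_norm_measurable by (auto simp: Lp_space_def lattice_space_def Lp_fun_def)

lemma Lp_norm_lattice: "Lp_norm norm p = lattice_norm (Lp_fun_norm p)"
  by (auto simp: Lp_norm_def lattice_norm_def Lp_fun_norm_def)

section \<open>Periodic functions and trigonometric polynomials\<close>

text \<open>Bridge between the Lebesgue integral of the norms and the gauge integral used for
  convolutions; the domains differ by the point \<open>2 * pi\<close>.\<close>

lemma integral_circle_eq:
  assumes "continuous_on {0..2 * pi} (u :: real \<Rightarrow> real)"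
  shows "(\<integral>t. u t \<partial>circle) = integral {0..2 * pi} u"
proof -
  have "u absolutely_integrable_on {0..2 * pi}"
    by (rule absolutely_integrable_continuous_real[OF assms])
  then have "u absolutely_integrable_on {0..<2 * pi}"
    by (rule set_integrable_subset) auto
  then have "integrable circle u"
    by (simp add: set_integrable_def integrable_restrict_space)
  then have "(\<integral>t. u t \<partial>circle) = integral {0..<2 * pi} u"
    by (rule lebesgue_integral_eq_integral) auto
  also have "\<dots> = integral {0..2 * pi} u"
    by (rule integral_spike_set[OF negligible_subset[OF negligible_sing[of "2 * pi"]]
          negligible_subset[OF negligible_sing[of "2 * pi"]]]) auto
  finally show ?thesis .
qed

text \<open>Reflection leads to the interval from \<open>s - 2 * pi\<close> to \<open>s\<close>,
  which is cut at 0 and its left part moved by one period.\<close>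

lemma integral_periodic_reflect:
  assumes cont: "continuous_on UNIV (u :: real \<Rightarrow> real)" and per: "\<And>t. u (t + 2 * pi) = u t"
    and s: "s \<in> {0..2 * pi}"
  shows "integral {0..2 * pi} (\<lambda>t. u (s - t)) = integral {0..2 * pi} u"
proof -
  have int: "v integrable_on {a..b}" if "continuous_on UNIV v" for v :: "real \<Rightarrow> real" and a b
    by (intro integrable_continuous_interval continuous_on_subset[OF that]) auto
  have "integral {0..2 * pi} (\<lambda>t. u (s - t)) = integral {- (2 * pi)..- 0} (\<lambda>t. u (s + t))"
    using Henstock_Kurzweil_Integration.integral_reflect_real[where a = 0 and b = "2 * pi" and f = "\<lambda>t. u (s - t)"] by simp
  also have "\<dots> = integral {s - 2 * pi..s} u"
    using integral_shift_Icc_real[where a = "- (2 * pi)" and b = 0 and c = s and f = u] by (simp add: o_def)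
  also have "\<dots> = integral {s - 2 * pi..0} u + integral {0..s} u"
    using s by (intro Henstock_Kurzweil_Integration.integral_combine[symmetric] int cont) auto
  also have "integral {s - 2 * pi..0} u = integral {s - 2 * pi..0} (\<lambda>t. u (t + 2 * pi))"
    by (simp add: per)
  also have "\<dots> = integral {s..2 * pi} u"
    using integral_shift_Icc_real[where a = "s - 2 * pi" and b = 0 and c = "2 * pi" and f = u]
    by (simp add: o_def add.commute)
  also have "integral {s..2 * pi} u + integral {0..s} u = integral {0..2 * pi} u"
    using s Henstock_Kurzweil_Integration.integral_combine[of 0 s "2 * pi" u] int[OF cont] by simp
  finally show ?thesis .
qed

lemma smooth_trig:
  assumes "is_trig (f :: real \<Rightarrow> complex)"
  shows "smooth f"
proof -
  obtain S c where S: "finite S" "f = trig_poly S c" using assms by (auto simp: is_trig_def)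
  define D where "D n t = (\<Sum>k\<in>S. (\<i> * of_int k) ^ n * (cis (of_int k * t) * c k))" for n :: nat and t :: real
  have cis_der: "((\<lambda>t. cis (of_int k * t)) has_vector_derivative (\<i> * of_int k) * cis (of_int k * t)) (at t)"
    for k :: int and t :: real
  proof -
    have "((\<lambda>z. exp ((\<i> * of_int k) * z)) has_field_derivative (\<i> * of_int k) * exp ((\<i> * of_int k) * of_real t)) (at (of_real t))"
      by (auto intro!: derivative_eq_intros)
    from has_vector_derivative_real_field[OF this] show ?thesis by (simp add: cis_conv_exp mult.assoc)
  qed
  have "(D n has_vector_derivative (\<Sum>k\<in>S. (\<i> * of_int k) ^ n * (((\<i> * of_int k) * cis (of_int k * t)) * c k))) (at t)" for n t
    unfolding D_def
    by (intro has_vector_derivative_sum has_vector_derivative_mult_right has_vector_derivative_mult_left cis_der)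
  then have "(D n has_vector_derivative D (Suc n) t) (at t)" for n t
    by (simp add: D_def mult_ac)
  moreover have "D 0 = f" by (auto simp: D_def S trig_poly_def scaleC_complex_def)
  ultimately show ?thesis unfolding smooth_def by blast
qed

lemma smooth_imp_continuous: "smooth f \<Longrightarrow> continuous_on A f"
  unfolding smooth_def
  by (metis continuous_at_imp_continuous_on has_vector_derivative_continuous)

text \<open>Brings two polynomials to a common frequency set so that taking differences commutes
  with applying the multiplier; \<open>Q k 0 = 0\<close> makes the padding by 0 harmless.\<close>

lemma trig_poly_diff_multiplier:
  assumes "finite S" "finite S'" and Q: "\<And>k :: int. bounded_clinear (Q k)"
  obtains S'' d where "finite S''" "\<And>t. trig_poly S'' d t = trig_poly S c t - trig_poly S' c' t"
    "\<And>t. trig_poly S'' (\<lambda>k. Q k (d k)) t = trig_poly S (\<lambda>k. Q k (c k)) t - trig_poly S' (\<lambda>k. Q k (c' k)) t"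
proof -
  define e where "e k = (if k \<in> S then c k else 0)" for k
  define e' where "e' k = (if k \<in> S' then c' k else 0)" for k
  let ?S = "S \<union> S'"
  have fin: "finite ?S" using assms by simp
  have 1: "trig_poly S c = trig_poly ?S e" "trig_poly S' c' = trig_poly ?S e'"
    unfolding e_def e'_def by (rule trig_poly_extend[OF fin]; simp)+
  have "(\<lambda>k. if k \<in> S then Q k (c k) else 0) = (\<lambda>k. Q k (e k))"
    "(\<lambda>k. if k \<in> S' then Q k (c' k) else 0) = (\<lambda>k. Q k (e' k))"
    by (auto simp: e_def e'_def bounded_clinearD(4)[OF Q])
  then have 2: "trig_poly S (\<lambda>k. Q k (c k)) = trig_poly ?S (\<lambda>k. Q k (e k))"
    "trig_poly S' (\<lambda>k. Q k (c' k)) = trig_poly ?S (\<lambda>k. Q k (e' k))"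
    using trig_poly_extend[OF fin, of S "\<lambda>k. Q k (c k)"] trig_poly_extend[OF fin, of S' "\<lambda>k. Q k (c' k)"]
    by simp_all
  show ?thesis
    by (rule that[OF fin, of "\<lambda>k. e k - e' k"])
      (simp_all add: 1 2 trig_poly_def bounded_clinearD(3)[OF Q] scaleC.diff_right sum_subtractf)
qed

section \<open>The semigroup together with its fractional power\<close>

locale fractional_semigroup = exp_bounded_semigroup T + fractional_power "generator T" \<alpha> \<omega> \<theta>
  for T :: "real \<Rightarrow> 'a::complex_banach \<Rightarrow> 'a" and \<alpha> \<omega> \<theta> :: real +
  assumes spec: "\<forall>k::int. \<i> * of_int k \<in> resolvent_set (generator T)"
begin

abbreviation R :: "int \<Rightarrow> 'a \<Rightarrow> 'a"
  where "R k \<equiv> resolvent (generator T) (\<i> * of_int k)"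

abbreviation X_nrm :: "'a \<Rightarrow> real"
  where "X_nrm \<equiv> X_norm (generator T) \<omega> \<theta> \<alpha>"

abbreviation J_inv :: "'a \<Rightarrow> 'a"
  where "J_inv \<equiv> frac_power (generator T) \<omega> \<theta> \<alpha>"

definition P :: "'a \<Rightarrow> 'a"
  where "P x = x - T (2 * pi) x"

lemmas R_clinear = resolvent_clinear[OF spec[rule_format]]
lemmas R_lin = bounded_clinearD[OF R_clinear]
lemmas J_lin = bounded_clinearD[OF J_clinear]

lemma P_clinear: "bounded_clinear P"
proof -
  have "bounded_linear P"
    unfolding P_def by (intro bounded_linear_sub bounded_linear_ident T_lin) simp
  then show ?thesis by (simp add: bounded_clinear_def P_def T_lin scaleC.diff_right)
qed

lemmas P_lin = bounded_clinearD[OF P_clinear]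

lemma J_T: "t \<ge> 0 \<Longrightarrow> J (T t x) = T t (J x)"
  by (rule J_commute[OF clin, symmetric]) (auto simp: resolvent_T sector_resolvent)

lemma J_P: "J (P x) = P (J x)"
  by (simp add: P_def J_lin J_T)

lemma R_P: "R k (P x) = P (R k x)"
  using spec by (simp add: P_def R_lin resolvent_T)

lemma T_P: "t \<ge> 0 \<Longrightarrow> T t (P x) = P (T t x)"
  using T_add[of t "2 * pi" x] T_add[of "2 * pi" t x] by (simp add: P_def T_lin add.commute)

lemma cesaro_P: "cesaro N (P x) = P (cesaro N x)"
  using bounded_clinearD(3)[OF cesaro_clinear[OF spec]] cesaro_T[OF spec]
  by (simp add: P_def)

lemma cesaro_P_tendsto: "(\<lambda>N. cesaro N (P x)) \<longlonglongrightarrow> pi *\<^sub>R (x + T (2 * pi) x)"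
  using cesaro_range_tendsto[OF spec] by (simp add: P_def)

lemma C1_summable_iff: "C1_summable (\<lambda>k. R k x) \<longleftrightarrow> convergent (\<lambda>N. cesaro N x)"
  by (simp add: C1_summable_def cesaro_def)

subsection \<open>Cesaro summability\<close>

lemma cesaro_convergentI: "z \<in> range P \<Longrightarrow> convergent (\<lambda>N. cesaro N z)"
  using cesaro_P_tendsto by (auto simp: convergent_def)

lemma range_P_if_convergent:
  assumes "convergent (\<lambda>N. cesaro N z)"
  shows "z \<in> range P"
proof -
  obtain y where y: "(\<lambda>N. cesaro N z) \<longlonglongrightarrow> y" using assms by (auto simp: convergent_def)
  have "(\<lambda>N. P (cesaro N z)) \<longlonglongrightarrow> P y"
    by (rule bounded_linear.tendsto[OF P_lin(1) y])
  then have Py: "P y = pi *\<^sub>R (z + T (2 * pi) z)"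
    using cesaro_P_tendsto[of z] by (auto simp: cesaro_P intro: LIMSEQ_unique)
  \<comment> \<open>The preimage is read off from \<open>z\<close> as the mean of
    \<open>z + T (2 * pi) z\<close> and \<open>z - T (2 * pi) z\<close>.\<close>
  have "P ((1 / (2 * pi)) *\<^sub>R y + (1 / 2) *\<^sub>R z) = (1 / 2) *\<^sub>R (z + T (2 * pi) z) + (1 / 2) *\<^sub>R (z - T (2 * pi) z)"
    by (simp add: P_lin(2,5) Py) (simp add: P_def)
  also have "\<dots> = z"
    by (simp add: scaleR_add_right scaleR_diff_right flip: scaleR_left_distrib)
  finally show ?thesis by (metis rangeI)
qed

text \<open>The Cesaro means of \<open>J\<close> are pointwise bounded, hence bounded by the uniform
  boundedness principle; their limit is \<open>pi (S + T S)\<close>, while \<open>S - T S = J\<close>.\<close>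

lemma bounded_inverse:
  assumes "range J \<subseteq> range P"
  obtains S where "bounded_clinear S" "\<And>y. P (S y) = J y"
proof -
  have "\<exists>z. P z = J y" for y using assms by (metis rangeE rangeI subsetD)
  then obtain S where S: "\<And>y. P (S y) = J y" by metis
  have inj: "u = v" if "P u = P v" for u v
  proof -
    have "P (u - v) = 0" using that by (simp add: P_lin(3))
    then have "u - v = 0" by (rule inj_period[OF spec, folded P_def])
    then show ?thesis by simp
  qed
  have add: "S (x + y) = S x + S y" for x y
    by (rule inj) (simp add: S P_lin(2) J_lin(2))
  have scale: "S (c *\<^sub>C x) = c *\<^sub>C S x" for c x
    by (rule inj) (simp add: S P_lin(6) J_lin(6))
  have "\<exists>M. \<forall>N x. norm (cesaro N (J x)) \<le> M * norm x"
  proof (rule uniform_boundedness)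
    show "bounded_linear (\<lambda>x. cesaro N (J x))" for N
      by (rule bounded_linear_compose[OF bounded_clinearD(1)[OF cesaro_clinear[OF spec]] J_lin(1)])
    show "\<exists>M. \<forall>N. norm (cesaro N (J x)) \<le> M" for x
    proof -
      have "J x \<in> range P" using assms by blast
      from convergent_imp_Bseq[OF cesaro_convergentI[OF this]] show ?thesis by (auto simp: Bseq_def)
    qed
  qed
  then obtain M where M: "\<And>N x. norm (cesaro N (J x)) \<le> M * norm x" by blast
  obtain K where K: "\<And>x. norm (J x) \<le> norm x * K"
    using bounded_linear.pos_bounded[OF J_lin(1)] by blast
  have "norm (S x) \<le> norm x * ((M / pi + K) / 2)" for x
  proof -
    have "norm (pi *\<^sub>R (S x + T (2 * pi) (S x))) \<le> M * norm x"
      using Lim_bounded[OF tendsto_norm[OF cesaro_P_tendsto[of "S x"]], of 0 "M * norm x"] M[of _ x]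
      by (simp add: S)
    then have "pi * norm (S x + T (2 * pi) (S x)) \<le> M * norm x" by (simp only: norm_scaleR abs_of_pos[OF pi_gt_zero])
    then have "norm (S x + T (2 * pi) (S x)) \<le> norm x * (M / pi)" by (simp add: field_simps)
    moreover have "2 *\<^sub>R S x = (S x + T (2 * pi) (S x)) + J x"
      using S[of x] by (simp add: P_def scaleR_2 algebra_simps)
    then have "2 * norm (S x) = norm ((S x + T (2 * pi) (S x)) + J x)"
      by (metis abs_numeral norm_scaleR)
    ultimately have "2 * norm (S x) \<le> norm x * (M / pi) + norm x * K"
      using norm_triangle_ineq[of "S x + T (2 * pi) (S x)" "J x"] K[of x] by linarith
    then show ?thesis by (simp add: distrib_left)
  qed
  then have "bounded_clinear S" by (intro bounded_clinearI add scale)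
  then show ?thesis using that S by blast
qed

subsection \<open>Convolution with the semigroup\<close>

text \<open>Kept general in \<open>B\<close> and \<open>Q\<close> because it serves twice: for
  \<open>S\<close>, where \<open>Q k\<close> is \<open>R k J\<close>, and for \<open>J\<close>,
  where \<open>Q k\<close> is \<open>R k P J\<close>.\<close>

lemma trig_convolution:
  assumes B: "bounded_clinear B"
    and Q: "\<And>k y. ((\<lambda>t. cis (of_int k * (- t)) *\<^sub>C T t (B y)) has_integral Q k y) {0..2 * pi}"
    and S: "finite S"
  shows "((\<lambda>t. T t (B (trig_poly S c (s - t)))) has_integral trig_poly S (\<lambda>k. Q k (c k)) s) {0..2 * pi}"
proof -
  have "((\<lambda>t. \<Sum>k\<in>S. cis (of_int k * s) *\<^sub>C cis (of_int k * (- t)) *\<^sub>C T t (B (c k)))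
      has_integral trig_poly S (\<lambda>k. Q k (c k)) s) {0..2 * pi}"
    unfolding trig_poly_def
    using has_integral_linear[OF Q scaleC.bounded_linear_right]
    by (intro has_integral_sum S) (simp add: o_def)
  then show ?thesis
  proof (rule has_integral_eq[rotated])
    fix t assume "t \<in> {0..2 * pi}"
    then have t: "t \<ge> 0" by simp
    have "cis (of_int k * (s - t)) = cis (of_int k * s) * cis (of_int k * (- t))" for k :: int
      by (simp add: cis_mult algebra_simps)
    then show "(\<Sum>k\<in>S. cis (of_int k * s) *\<^sub>C cis (of_int k * (- t)) *\<^sub>C T t (B (c k))) = T t (B (trig_poly S c (s - t)))"
      by (simp add: trig_poly_def bounded_clinearD(6,8)[OF B] T_lin(6,8)[OF t] scaleC_scaleC)
  qed
qed

text \<open>The operators \<open>T t B\<close> are bounded uniformly over one period, and reflection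
  and translation do not change the integral of a periodic function.\<close>

lemma trig_convolution_bound:
  assumes B: "bounded_clinear B"
    and Q: "\<And>k y. ((\<lambda>t. cis (of_int k * (- t)) *\<^sub>C T t (B y)) has_integral Q k y) {0..2 * pi}"
  obtains M where "M \<ge> 0" "\<And>S c s. finite S \<Longrightarrow> s \<in> {0..2 * pi} \<Longrightarrow>
    norm (trig_poly S (\<lambda>k. Q k (c k)) s) \<le> M * (\<integral>t. norm (trig_poly S c t) \<partial>circle)"
proof -
  obtain K where K: "K > 0" "\<And>t x. 0 \<le> t \<Longrightarrow> t \<le> 2 * pi \<Longrightarrow> norm (T t x) \<le> K * norm x"
    using local_bound by blast
  obtain L where L: "L > 0" "\<And>x. norm (B x) \<le> norm x * L"
    using bounded_linear.pos_bounded[OF bounded_clinearD(1)[OF B]] by blast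
  have TB: "norm (T t (B x)) \<le> K * L * norm x" if "t \<in> {0..2 * pi}" for t x
  proof -
    have "norm (T t (B x)) \<le> K * norm (B x)" using K(2) that by simp
    also have "\<dots> \<le> K * (norm x * L)" using L(2) K(1) by (intro mult_left_mono) auto
    finally show ?thesis by (simp add: mult_ac)
  qed
  have "norm (trig_poly S (\<lambda>k. Q k (c k)) s) \<le> K * L * (\<integral>t. norm (trig_poly S c t) \<partial>circle)"
    if S: "finite S" and s: "s \<in> {0..2 * pi}" for S c s
  proof -
    define u where "u t = norm (trig_poly S c t)" for t
    have trig: "is_trig (trig_poly S c)" using S by (rule is_trigI)
    have cont: "continuous_on A u" for A
      unfolding u_def by (intro continuous_intros continuous_on_trig trig)
    have per: "u (t + 2 * pi) = u t" for t unfolding u_def by (simp add: is_trig_periodic[OF trig])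
    have cs: "continuous_on {0..2 * pi} (\<lambda>t. u (s - t))"
      by (rule continuous_on_compose2[OF cont[of UNIV]]) (auto intro!: continuous_intros)
    note conv = trig_convolution[OF B Q S, of c s]
    have "norm (trig_poly S (\<lambda>k. Q k (c k)) s) \<le> integral {0..2 * pi} (\<lambda>t. K * L * u (s - t))"
      unfolding integral_unique[OF conv, symmetric]
    proof (rule integral_norm_bound_integral)
      show "(\<lambda>t. T t (B (trig_poly S c (s - t)))) integrable_on {0..2 * pi}" using conv by blast
      show "(\<lambda>t. K * L * u (s - t)) integrable_on {0..2 * pi}"
        by (intro integrable_continuous_interval continuous_intros cs)
    qed (auto simp: u_def intro: TB)
    also have "\<dots> = K * L * integral {0..2 * pi} u"
      using integral_periodic_reflect[OF cont per s] by simp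
    finally show ?thesis using integral_circle_eq[OF cont] by (simp add: u_def [abs_def])
  qed
  then show ?thesis using that[of "K * L"] K L by simp
qed

subsection \<open>Strong measurability with respect to the fractional domain\<close>

lemma X_nrm_diff: "x \<in> range J \<Longrightarrow> y \<in> range J \<Longrightarrow> X_nrm (x - y) = norm (J_inv x - J_inv y)"
  by (auto simp flip: J_lin(3))

text \<open>\<open>J_inv\<close> is an isometry from \<open>range J\<close> with
  \<open>X_nrm\<close> onto the space with its own norm, so the approximating simple functions are
  carried over.\<close>

lemma SM_J_inv:
  assumes "strongly_measurable (range J) X_nrm f"
  shows "SM (\<lambda>t. J_inv (f t))" "\<And>t. t \<in> {0..<2 * pi} \<Longrightarrow> J (J_inv (f t)) = f t"
proof -
  have f: "\<And>t. t \<in> {0..<2 * pi} \<Longrightarrow> f t \<in> range J"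
    using assms by (simp add: strongly_measurable_def)
  show "\<And>t. t \<in> {0..<2 * pi} \<Longrightarrow> J (J_inv (f t)) = f t" using f by force
  obtain s where "\<forall>n. simple_function circle (s n) \<and> (\<forall>t\<in>space circle. s n t \<in> range J)"
    and s3: "AE t in circle. (\<lambda>n. X_nrm (s n t - f t)) \<longlonglongrightarrow> 0"
    using assms unfolding strongly_measurable_def by blast
  then have s: "\<And>n. simple_function circle (s n)" "\<And>n t. t \<in> {0..<2 * pi} \<Longrightarrow> s n t \<in> range J"
    by auto
  show "SM (\<lambda>t. J_inv (f t))"
    unfolding SM_iff
  proof (intro exI conjI allI)
    show "simple_function circle (\<lambda>t. J_inv (s n t))" for n by (rule simple_function_compose1[OF s(1)])
    show "AE t in circle. (\<lambda>n. J_inv (s n t)) \<longlonglongrightarrow> J_inv (f t)"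
      using s3 AE_space
    proof eventually_elim
      case (elim t)
      then have "(\<lambda>n. norm (J_inv (s n t) - J_inv (f t))) \<longlonglongrightarrow> 0"
        using s(2) f by (simp add: X_nrm_diff)
      then show ?case by (simp add: tendsto_norm_zero_iff LIM_zero_iff)
    qed
  qed
qed

lemma SM_J:
  assumes "SM g"
  shows "strongly_measurable (range J) X_nrm (\<lambda>t. J (g t))"
proof -
  obtain s where s: "\<And>n. simple_function circle (s n)" "AE t in circle. (\<lambda>n. s n t) \<longlonglongrightarrow> g t"
    using assms unfolding SM_iff by blast
  have "AE t in circle. (\<lambda>n. X_nrm (J (s n t) - J (g t))) \<longlonglongrightarrow> 0"
    using s(2) by eventually_elim (simp add: tendsto_norm_zero_iff LIM_zero_iff flip: J_lin(3))
  then show ?thesis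
    unfolding strongly_measurable_def
    by (intro conjI exI[of _ "\<lambda>n t. J (s n t)"] allI simple_function_compose1[OF s(1)]) auto
qed

subsection \<open>From the range condition to multipliers\<close>

context
  fixes S
  assumes S: "bounded_clinear S" and PS: "\<And>y. P (S y) = J y"
begin

lemma R_J_integral: "((\<lambda>t. cis (of_int k * (- t)) *\<^sub>C T t (S y)) has_integral R k (J y)) {0..2 * pi}"
  using fourier_resolvent[OF spec[rule_format, of k], of "S y"] PS[of y] by (simp add: P_def)

text \<open>Convolution over one period with the operator function \<open>T t S\<close>. It is
  evaluated at trigonometric polynomials only, where the integrand is known to be integrable;
  \<open>conv_ext\<close> carries it further.\<close>

definition conv :: "(real \<Rightarrow> 'a) \<Rightarrow> real \<Rightarrow> 'a"
  where "conv h s = integral {0..2 * pi} (\<lambda>t. T t (S (h (s - t))))"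

lemma conv_trig_poly: "finite F \<Longrightarrow> conv (trig_poly F c) = trig_poly F (\<lambda>k. R k (J (c k)))"
  unfolding conv_def by (rule ext, rule integral_unique, rule trig_convolution[OF S R_J_integral])

lemma conv_integrable:
  assumes "is_trig h"
  shows "(\<lambda>t. T t (S (h (s - t)))) integrable_on {0..2 * pi}"
  using assms trig_convolution[OF S R_J_integral] unfolding is_trig_def by blast

lemma is_trig_conv: "is_trig h \<Longrightarrow> is_trig (conv h)"
  by (metis conv_trig_poly is_trig_def)

lemma conv_add: "is_trig h \<Longrightarrow> is_trig k \<Longrightarrow> conv (\<lambda>t. h t + k t) s = conv h s + conv k s"
  unfolding conv_def
  by (subst Henstock_Kurzweil_Integration.integral_add[symmetric])
    (auto intro!: conv_integrable Henstock_Kurzweil_Integration.integral_cong simp: bounded_clinearD(2)[OF S] T_lin)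

lemma conv_diff: "is_trig h \<Longrightarrow> is_trig k \<Longrightarrow> conv (\<lambda>t. h t - k t) s = conv h s - conv k s"
  unfolding conv_def
  by (subst Henstock_Kurzweil_Integration.integral_diff[symmetric])
    (auto intro!: conv_integrable Henstock_Kurzweil_Integration.integral_cong simp: bounded_clinearD(3)[OF S] T_lin)

lemma conv_scaleC:
  assumes "is_trig h"
  shows "conv (\<lambda>t. c *\<^sub>C h t) s = c *\<^sub>C conv h s"
proof -
  have "((\<lambda>t. c *\<^sub>C T t (S (h (s - t)))) has_integral c *\<^sub>C conv h s) {0..2 * pi}"
    using has_integral_linear[OF integrable_integral[OF conv_integrable[OF assms]] scaleC.bounded_linear_right]
    by (simp add: o_def conv_def)
  then have "((\<lambda>t. T t (S (c *\<^sub>C h (s - t)))) has_integral c *\<^sub>C conv h s) {0..2 * pi}"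
    by (rule has_integral_eq[rotated]) (simp add: bounded_clinearD(6)[OF S] T_lin(6))
  then show ?thesis unfolding conv_def[of "\<lambda>t. c *\<^sub>C h t"] by (rule integral_unique)
qed

text \<open>A constant fixed once and for all, so that it can occur in the definition of
  \<open>conv_ext\<close>.\<close>

definition conv_bound :: real
  where "conv_bound = (SOME M. M \<ge> 0 \<and> (\<forall>h s. is_trig h \<longrightarrow> s \<in> {0..2 * pi} \<longrightarrow>
    norm (conv h s) \<le> M * (\<integral>t. norm (h t) \<partial>circle)))"

lemma conv_bound: "conv_bound \<ge> 0"
  "is_trig h \<Longrightarrow> s \<in> {0..2 * pi} \<Longrightarrow> norm (conv h s) \<le> conv_bound * (\<integral>t. norm (h t) \<partial>circle)"
proof -
  obtain M where "M \<ge> 0" "\<And>F c s. finite F \<Longrightarrow> s \<in> {0..2 * pi} \<Longrightarrow>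
    norm (trig_poly F (\<lambda>k. R k (J (c k))) s) \<le> M * (\<integral>t. norm (trig_poly F c t) \<partial>circle)"
    using trig_convolution_bound[OF S R_J_integral] by blast
  then have "M \<ge> 0 \<and> (\<forall>h s. is_trig h \<longrightarrow> s \<in> {0..2 * pi} \<longrightarrow> norm (conv h s) \<le> M * (\<integral>t. norm (h t) \<partial>circle))"
    by (auto simp: is_trig_def conv_trig_poly)
  then have *: "conv_bound \<ge> 0 \<and> (\<forall>h s. is_trig h \<longrightarrow> s \<in> {0..2 * pi} \<longrightarrow>
      norm (conv h s) \<le> conv_bound * (\<integral>t. norm (h t) \<partial>circle))"
    unfolding conv_bound_def by (rule someI)
  show "conv_bound \<ge> 0"
    "is_trig h \<Longrightarrow> s \<in> {0..2 * pi} \<Longrightarrow> norm (conv h s) \<le> conv_bound * (\<integral>t. norm (h t) \<partial>circle)"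
    using * by blast+
qed

text \<open>The continuous extension of \<open>conv\<close> to integrable \<open>g\<close>, encoded
  by its distance to the convolution of every trigonometric polynomial. Density determines
  \<open>u\<close> at each point of the closed interval, so linearity holds everywhere there and not
  just almost everywhere.\<close>

definition conv_ext :: "(real \<Rightarrow> 'a) \<Rightarrow> (real \<Rightarrow> 'a) \<Rightarrow> bool"
  where "conv_ext g u \<longleftrightarrow> (\<forall>k. is_trig k \<longrightarrow> (\<forall>s\<in>{0..2 * pi}.
    norm (u s - conv k s) \<le> conv_bound * (\<integral>t. norm (g t - k t) \<partial>circle)))"

lemma L1_triangle:
  fixes f g h :: "real \<Rightarrow> 'a"
  assumes "SM f" "integrable circle (\<lambda>t. norm (g t))" "integrable circle (\<lambda>t. norm (h t))"
    "\<And>t. t \<in> {0..<2 * pi} \<Longrightarrow> norm (f t) \<le> norm (g t) + norm (h t)"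
  shows "(\<integral>t. norm (f t) \<partial>circle) \<le> (\<integral>t. norm (g t) \<partial>circle) + (\<integral>t. norm (h t) \<partial>circle)"
proof -
  note i = Bochner_Integration.integrable_add[OF assms(2,3)]
  have "integrable circle (\<lambda>t. norm (f t))"
    by (rule Bochner_Integration.integrable_bound[OF i SM_norm_measurable[OF assms(1)]]) (use assms(4) in auto)
  then have "(\<integral>t. norm (f t) \<partial>circle) \<le> (\<integral>t. norm (g t) + norm (h t) \<partial>circle)"
    by (rule integral_mono[OF _ i]) (use assms(4) in auto)
  then show ?thesis by (simp add: Bochner_Integration.integral_add[OF assms(2,3)])
qed

lemma integrable_L1_diff:
  assumes "SM g" "integrable circle (\<lambda>t. norm (g t))" "is_trig k"
  shows "integrable circle (\<lambda>t. norm (g t - k t :: 'a))"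
  by (rule Bochner_Integration.integrable_bound[OF Bochner_Integration.integrable_add[OF assms(2) integrable_norm_trig[OF assms(3)]]
        SM_norm_measurable[OF SM_diff[OF assms(1) SM_trig[OF assms(3)]]]])
    (auto simp: norm_triangle_ineq4)

text \<open>Polynomials approaching \<open>g\<close> in mean with error \<open>1 / (n + 1)\<close>
  have convolutions that are Cauchy at each point; letting \<open>n\<close> grow in the estimate
  against a fixed \<open>k\<close> leaves \<open>conv_ext\<close>.\<close>

lemma conv_ext_exists:
  fixes g :: "real \<Rightarrow> 'a"
  assumes g: "SM g" "integrable circle (\<lambda>t. norm (g t))"
  shows "\<exists>u. conv_ext g u"
proof -
  have "\<exists>h. is_trig h \<and> (\<integral>t. norm (g t - h t) \<partial>circle) \<le> inverse (real (Suc n))" for n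
    using trig_dense_L1[OF g, of "inverse (real (Suc n))"] by (metis inverse_positive_iff_positive of_nat_0_less_iff zero_less_Suc)
  then obtain h where h: "\<And>n. is_trig (h n)" "\<And>n. (\<integral>t. norm (g t - h n t) \<partial>circle) \<le> inverse (real (Suc n))"
    by metis
  have close: "norm (conv (h n) s - conv k s) \<le> conv_bound * (inverse (real (Suc n)) + (\<integral>t. norm (g t - k t) \<partial>circle))"
    if k: "is_trig k" and s: "s \<in> {0..2 * pi}" for n s and k :: "real \<Rightarrow> 'a"
  proof -
    have "norm (conv (h n) s - conv k s) \<le> conv_bound * (\<integral>t. norm (h n t - k t) \<partial>circle)"
      using conv_bound(2)[OF is_trig_diff[OF h(1) k] s] by (simp add: conv_diff[OF h(1) k])
    also have "(\<integral>t. norm (h n t - k t) \<partial>circle) \<le> (\<integral>t. norm (g t - h n t) \<partial>circle) + (\<integral>t. norm (g t - k t) \<partial>circle)"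
    proof (rule L1_triangle)
      show "norm (h n t - k t) \<le> norm (g t - h n t) + norm (g t - k t)" for t
        using norm_triangle_ineq4[of "g t - k t" "g t - h n t"] by simp
    qed (intro SM_trig is_trig_diff h k integrable_L1_diff g)+
    finally show ?thesis
      using h(2)[of n] conv_bound(1) by (meson add_right_mono mult_left_mono order_trans)
  qed
  have "\<exists>l. (\<lambda>n. conv (h n) s) \<longlonglongrightarrow> l" if s: "s \<in> {0..2 * pi}" for s
  proof -
    have "Cauchy (\<lambda>n. conv (h n) s)"
    proof (rule metric_CauchyI)
      fix e :: real assume e: "e > 0"
      obtain N :: nat where N: "inverse (real (Suc N)) < e / (2 * (conv_bound + 1))"
        using reals_Archimedean[of "e / (2 * (conv_bound + 1))"] e conv_bound(1) by auto
      show "\<exists>M. \<forall>m\<ge>M. \<forall>n\<ge>M. dist (conv (h m) s) (conv (h n) s) < e"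
      proof (intro exI[of _ N] allI impI)
        fix m n assume mn: "m \<ge> N" "n \<ge> N"
        have inv: "inverse (real (Suc i)) \<le> inverse (real (Suc N))" if "i \<ge> N" for i
          using that by (intro le_imp_inverse_le) auto
        have "dist (conv (h m) s) (conv (h n) s) \<le> conv_bound * (inverse (real (Suc m)) + (\<integral>t. norm (g t - h n t) \<partial>circle))"
          unfolding dist_norm by (rule close[OF h(1) s])
        also have "\<dots> \<le> conv_bound * (inverse (real (Suc N)) + inverse (real (Suc N)))"
          by (intro mult_left_mono add_mono inv mn order_trans[OF h(2)] conv_bound(1))
        also have "\<dots> \<le> (conv_bound + 1) * (inverse (real (Suc N)) + inverse (real (Suc N)))"
          by (intro mult_right_mono) auto
        also have "\<dots> < (conv_bound + 1) * (e / (2 * (conv_bound + 1)) + e / (2 * (conv_bound + 1)))"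
          using conv_bound(1) N by (intro mult_strict_left_mono add_strict_mono) auto
        also have "\<dots> = e"
        proof -
          have "x * (e / (2 * x) + e / (2 * x)) = e" if "x \<noteq> 0" for x :: real using that by simp
          then show ?thesis using conv_bound(1) by (metis add_nonneg_pos less_numeral_extra(1) less_numeral_extra(3))
        qed
        finally show "dist (conv (h m) s) (conv (h n) s) < e" .
      qed
    qed
    then show ?thesis by (simp add: Cauchy_convergent_iff convergent_def)
  qed
  then obtain u where u: "\<And>s. s \<in> {0..2 * pi} \<Longrightarrow> (\<lambda>n. conv (h n) s) \<longlonglongrightarrow> u s" by metis
  have "conv_ext g u"
    unfolding conv_ext_def
  proof (intro allI impI ballI)
    fix k :: "real \<Rightarrow> 'a" and s assume k: "is_trig k" and s: "s \<in> {0..2 * pi}"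
    have "(\<lambda>n. conv_bound * (inverse (real (Suc n)) + (\<integral>t. norm (g t - k t) \<partial>circle)))
        \<longlonglongrightarrow> conv_bound * (0 + (\<integral>t. norm (g t - k t) \<partial>circle))"
      by (intro tendsto_intros LIMSEQ_inverse_real_of_nat)
    moreover have "(\<lambda>n. norm (conv (h n) s - conv k s)) \<longlonglongrightarrow> norm (u s - conv k s)"
      by (intro tendsto_intros u s)
    ultimately show "norm (u s - conv k s) \<le> conv_bound * (\<integral>t. norm (g t - k t) \<partial>circle)"
      using LIMSEQ_le[of "\<lambda>n. norm (conv (h n) s - conv k s)"] close[OF k s] by fastforce
  qed
  then show ?thesis by blast
qed

lemma conv_extD:
  "conv_ext g u \<Longrightarrow> is_trig k \<Longrightarrow> s \<in> {0..2 * pi} \<Longrightarrow>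
    norm (u s - conv k s) \<le> conv_bound * (\<integral>t. norm (g t - k t) \<partial>circle)"
  by (simp add: conv_ext_def)

text \<open>A function in \<open>Lp_space\<close> is known to take values in \<open>range J\<close>
  only on the circle, so identities for \<open>J_inv\<close> along it are available only
  there.\<close>

lemma conv_ext_cong:
  assumes "\<And>t. t \<in> {0..<2 * pi} \<Longrightarrow> g t = g' t"
  shows "conv_ext g = conv_ext g'"
proof -
  have "(\<integral>t. norm (g t - k t) \<partial>circle) = (\<integral>t. norm (g' t - k t) \<partial>circle)" for k :: "real \<Rightarrow> 'a"
    by (intro Bochner_Integration.integral_cong) (auto simp: assms)
  then show ?thesis by (auto simp: conv_ext_def)
qed

text \<open>The polynomial itself is admissible in \<open>conv_ext\<close>, with right-hand side
  0.\<close>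

lemma conv_ext_trig:
  assumes "conv_ext g u" "is_trig k" "\<And>t. t \<in> {0..<2 * pi} \<Longrightarrow> g t = k t" "s \<in> {0..2 * pi}"
  shows "u s = conv k s"
proof -
  have "(\<integral>t. norm (g t - k t) \<partial>circle) = (\<integral>t. 0 \<partial>circle)"
    by (intro Bochner_Integration.integral_cong) (auto simp: assms(3))
  then show ?thesis using conv_extD[OF assms(1,2,4)] by simp
qed

lemma conv_ext_bound:
  assumes "conv_ext g u" "s \<in> {0..2 * pi}"
  shows "norm (u s) \<le> conv_bound * (\<integral>t. norm (g t) \<partial>circle)"
proof -
  have "conv (\<lambda>t. 0) s = 0" using conv_diff[OF is_trig_zero is_trig_zero, of s] by simp
  then show ?thesis using conv_extD[OF assms(1) is_trig_zero assms(2)] by simp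
qed

lemma conv_ext_approx:
  assumes g: "SM g" "integrable circle (\<lambda>t. norm (g t))" and u: "conv_ext g u" and e: "e > 0"
  obtains k where "is_trig k" "(\<integral>t. norm (g t - k t) \<partial>circle) \<le> e"
    "\<And>s. s \<in> {0..2 * pi} \<Longrightarrow> norm (u s - conv k s) \<le> conv_bound * e"
proof -
  obtain k where k: "is_trig k" "(\<integral>t. norm (g t - k t) \<partial>circle) \<le> e"
    using trig_dense_L1[OF g e] by blast
  have "norm (u s - conv k s) \<le> conv_bound * e" if "s \<in> {0..2 * pi}" for s
    using conv_extD[OF u k(1) that] mult_left_mono[OF k(2) conv_bound(1)] by linarith
  then show ?thesis using that k by blast
qed

text \<open>\<open>u\<close> is a uniform limit of trigonometric polynomials, hence
  continuous.\<close>

lemma SM_conv_ext: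
  assumes g: "SM g" "integrable circle (\<lambda>t. norm (g t))" and u: "conv_ext g u"
  shows "SM u"
proof (rule SM_continuous)
  show "continuous_on {0..2 * pi} u"
  proof (rule uniform_limit_theorem)
    define K where "K n = (SOME k. is_trig k \<and> (\<forall>s\<in>{0..2 * pi}. norm (u s - conv k s) \<le> conv_bound * inverse (real (Suc n))))" for n
    have K: "is_trig (K n)" "s \<in> {0..2 * pi} \<Longrightarrow> norm (u s - conv (K n) s) \<le> conv_bound * inverse (real (Suc n))" for n s
    proof -
      have "inverse (real (Suc n)) > 0" by simp
      from conv_ext_approx[OF g u this] have "\<exists>k. is_trig k \<and> (\<forall>s\<in>{0..2 * pi}. norm (u s - conv k s) \<le> conv_bound * inverse (real (Suc n)))"
        by metis
      from someI_ex[OF this, folded K_def] show "is_trig (K n)"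
        "s \<in> {0..2 * pi} \<Longrightarrow> norm (u s - conv (K n) s) \<le> conv_bound * inverse (real (Suc n))" by auto
    qed
    show "\<forall>\<^sub>F n in sequentially. continuous_on {0..2 * pi} (conv (K n))"
      by (intro always_eventually allI continuous_on_trig is_trig_conv K)
    show "uniform_limit {0..2 * pi} (\<lambda>n. conv (K n)) u sequentially"
      unfolding uniform_limit_iff
    proof (intro allI impI)
      fix e :: real assume e: "e > 0"
      have "(\<lambda>n. conv_bound * inverse (real (Suc n))) \<longlonglongrightarrow> conv_bound * 0"
        by (intro tendsto_intros LIMSEQ_inverse_real_of_nat)
      then have "\<forall>\<^sub>F n in sequentially. conv_bound * inverse (real (Suc n)) < e"
        using e by (intro order_tendstoD(2)) auto
      then show "\<forall>\<^sub>F n in sequentially. \<forall>s\<in>{0..2 * pi}. dist (conv (K n) s) (u s) < e"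
      proof eventually_elim
        case (elim n)
        then show ?case using K(2)[of _ n] by (force simp: dist_norm norm_minus_commute)
      qed
    qed
  qed simp
qed

lemma conv_ext_add:
  assumes g: "SM g" "integrable circle (\<lambda>t. norm (g t))" and g': "SM g'" "integrable circle (\<lambda>t. norm (g' t))"
    and u: "conv_ext g u" "conv_ext g' u'" "conv_ext g'' u''"
    and eq: "\<And>t. t \<in> {0..<2 * pi} \<Longrightarrow> g'' t = g t + g' t" and s: "s \<in> {0..2 * pi}"
  shows "u'' s = u s + u' s"
proof -
  have "norm (u'' s - (u s + u' s)) \<le> 0 + e" if e: "e > 0" for e
  proof -
    \<comment> \<open>Four errors of size \<open>conv_bound * d\<close> occur; the added 1 keeps the
      denominator positive.\<close>
    define d where "d = e / (4 * (conv_bound + 1))"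
    have d: "d > 0" using e conv_bound(1) by (simp add: d_def)
    obtain k where k: "is_trig k" "(\<integral>t. norm (g t - k t) \<partial>circle) \<le> d" "norm (u s - conv k s) \<le> conv_bound * d"
      using conv_ext_approx[OF g u(1) d] s by metis
    obtain k' where k': "is_trig k'" "(\<integral>t. norm (g' t - k' t) \<partial>circle) \<le> d" "norm (u' s - conv k' s) \<le> conv_bound * d"
      using conv_ext_approx[OF g' u(2) d] s by metis
    have "norm (u'' s - conv (\<lambda>t. k t + k' t) s) \<le> conv_bound * (\<integral>t. norm (g'' t - (k t + k' t)) \<partial>circle)"
      by (rule conv_extD[OF u(3) is_trig_add[OF k(1) k'(1)] s])
    also have "(\<integral>t. norm (g'' t - (k t + k' t)) \<partial>circle) = (\<integral>t. norm (g t + g' t - (k t + k' t)) \<partial>circle)"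
      by (intro Bochner_Integration.integral_cong) (auto simp: eq)
    also have "\<dots> \<le> (\<integral>t. norm (g t - k t) \<partial>circle) + (\<integral>t. norm (g' t - k' t) \<partial>circle)"
    proof (rule L1_triangle)
      show "norm (g t + g' t - (k t + k' t)) \<le> norm (g t - k t) + norm (g' t - k' t)" for t
        using norm_triangle_ineq[of "g t - k t" "g' t - k' t"] by (simp add: algebra_simps)
    qed (intro SM_add SM_diff SM_trig g g' k k' integrable_L1_diff)+
    also have "\<dots> \<le> d + d" using k k' by simp
    finally have 1: "norm (u'' s - (conv k s + conv k' s)) \<le> conv_bound * (d + d)"
      using conv_bound(1) by (simp add: conv_add[OF k(1) k'(1)] mult_left_mono)
    have split: "u'' s - (u s + u' s) = (u'' s - (conv k s + conv k' s)) - ((u s - conv k s) + (u' s - conv k' s))"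
      by simp
    have "norm (u'' s - (u s + u' s)) \<le> norm (u'' s - (conv k s + conv k' s)) + norm ((u s - conv k s) + (u' s - conv k' s))"
      unfolding split by (rule norm_triangle_ineq4)
    also have "\<dots> \<le> norm (u'' s - (conv k s + conv k' s)) + (norm (u s - conv k s) + norm (u' s - conv k' s))"
      by (intro add_left_mono norm_triangle_ineq)
    finally have "norm (u'' s - (u s + u' s)) \<le> norm (u'' s - (conv k s + conv k' s)) + (norm (u s - conv k s) + norm (u' s - conv k' s))" .
    also have "\<dots> \<le> conv_bound * (d + d) + (conv_bound * d + conv_bound * d)"
      using 1 k(3) k'(3) by (intro add_mono)
    also have "\<dots> = 4 * conv_bound * d" by (simp add: algebra_simps)
    also have "\<dots> \<le> 4 * (conv_bound + 1) * d" using d by (intro mult_right_mono) auto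
    also have "\<dots> = e" using conv_bound(1) by (simp add: d_def)
    finally show ?thesis by simp
  qed
  then have "norm (u'' s - (u s + u' s)) \<le> 0" by (rule field_le_epsilon)
  then show ?thesis by simp
qed

lemma conv_ext_scaleC:
  assumes g: "SM g" "integrable circle (\<lambda>t. norm (g t))"
    and u: "conv_ext g u" "conv_ext g' u'"
    and eq: "\<And>t. t \<in> {0..<2 * pi} \<Longrightarrow> g' t = c *\<^sub>C g t" and s: "s \<in> {0..2 * pi}"
  shows "u' s = c *\<^sub>C u s"
proof -
  have "norm (u' s - c *\<^sub>C u s) \<le> 0 + e" if e: "e > 0" for e
  proof -
    \<comment> \<open>Two errors of size \<open>conv_bound * cmod c * d\<close> occur; the added
      ones keep the denominator positive.\<close>
    define d where "d = e / (2 * ((conv_bound + 1) * (cmod c + 1)))"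
    have cb: "(conv_bound + 1) * (cmod c + 1) > 0"
      using conv_bound(1) by (intro mult_pos_pos add_nonneg_pos) auto
    have d: "d > 0" using e cb by (simp add: d_def)
    obtain k where k: "is_trig k" "(\<integral>t. norm (g t - k t) \<partial>circle) \<le> d" "norm (u s - conv k s) \<le> conv_bound * d"
      using conv_ext_approx[OF g u(1) d] s by metis
    have "norm (u' s - conv (\<lambda>t. c *\<^sub>C k t) s) \<le> conv_bound * (\<integral>t. norm (g' t - c *\<^sub>C k t) \<partial>circle)"
      by (rule conv_extD[OF u(2) is_trig_scaleC[OF k(1)] s])
    also have "(\<integral>t. norm (g' t - c *\<^sub>C k t) \<partial>circle) = (\<integral>t. cmod c * norm (g t - k t) \<partial>circle)"
      by (intro Bochner_Integration.integral_cong) (auto simp: eq norm_scaleC simp flip: scaleC.diff_right)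
    also have "\<dots> \<le> cmod c * d" using k(2) by (simp add: mult_left_mono)
    finally have 1: "norm (u' s - c *\<^sub>C conv k s) \<le> conv_bound * (cmod c * d)"
      using conv_bound(1) by (simp add: conv_scaleC[OF k(1)] mult_left_mono)
    have "norm (u' s - c *\<^sub>C u s) \<le> norm (u' s - c *\<^sub>C conv k s) + norm (c *\<^sub>C (u s - conv k s))"
      using norm_triangle_ineq4[of "u' s - c *\<^sub>C conv k s" "c *\<^sub>C (u s - conv k s)"] by (simp add: scaleC.diff_right)
    also have "\<dots> \<le> conv_bound * (cmod c * d) + cmod c * (conv_bound * d)"
      unfolding norm_scaleC using 1 k(3) by (intro add_mono mult_left_mono) auto
    also have "\<dots> = 2 * (conv_bound * cmod c) * d" by simp
    also have "\<dots> \<le> 2 * ((conv_bound + 1) * (cmod c + 1)) * d"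
      using d conv_bound(1) by (intro mult_right_mono mult_left_mono mult_mono) auto
    also have "\<dots> = e"
    proof -
      have "2 * x * (e / (2 * x)) = e" if "x \<noteq> 0" for x :: real using that by simp
      then show ?thesis unfolding d_def using cb by (metis less_numeral_extra(3))
    qed
    finally show ?thesis by simp
  qed
  then have "norm (u' s - c *\<^sub>C u s) \<le> 0" by (rule field_le_epsilon)
  then show ?thesis by simp
qed

text \<open>Inverting \<open>J\<close> turns the norm of the fractional domain into the ordinary
  one. \<open>L1_le_Lp\<close> then gives integrability, the extended convolution is bounded, and
  bounded functions on the circle have finite \<open>L_p\<close> norm.\<close>

lemma multiplier_Lp_of_inverse:
  assumes p: "p \<ge> 1"
  shows "multiplier R (range J) X_nrm p (Lp_space UNIV norm p) (Lp_norm norm p)"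
proof -
  define U where "U f = (SOME u. conv_ext (\<lambda>t. J_inv (f t)) u)" for f
  have Lp: "SM (\<lambda>t. J_inv (f t))" "integrable circle (\<lambda>t. norm (J_inv (f t)))"
    "\<And>t. t \<in> {0..<2 * pi} \<Longrightarrow> J (J_inv (f t)) = f t" "conv_ext (\<lambda>t. J_inv (f t)) (U f)"
    "(\<integral>t. norm (J_inv (f t)) \<partial>circle) \<le> (2 * pi + 1) * Lp_norm X_nrm p f"
    if "f \<in> Lp_space (range J) X_nrm p" for f
  proof -
    have sm: "strongly_measurable (range J) X_nrm f" and int: "integrable circle (\<lambda>t. norm (J_inv (f t)) powr p)"
      using that by (auto simp: Lp_space_def X_norm_def)
    show 1: "SM (\<lambda>t. J_inv (f t))" and "\<And>t. t \<in> {0..<2 * pi} \<Longrightarrow> J (J_inv (f t)) = f t"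
      using SM_J_inv[OF sm] by auto
    show 2: "integrable circle (\<lambda>t. norm (J_inv (f t)))"
      and "(\<integral>t. norm (J_inv (f t)) \<partial>circle) \<le> (2 * pi + 1) * Lp_norm X_nrm p f"
      using L1_le_Lp[OF p SM_norm_measurable[OF 1] _ int] by (auto simp: Lp_norm_def X_norm_def)
    show "conv_ext (\<lambda>t. J_inv (f t)) (U f)"
      unfolding U_def by (rule someI_ex[OF conv_ext_exists[OF 1 2]])
  qed
  define b where "b f = conv_bound * (\<integral>t. norm (J_inv (f t)) \<partial>circle)" for f
  have b: "norm (U f t) \<le> b f" if "f \<in> Lp_space (range J) X_nrm p" "t \<in> {0..2 * pi}" for f t
    unfolding b_def by (rule conv_ext_bound[OF Lp(4)[OF that(1)] that(2)])
  have SMU: "SM (U f)" if "f \<in> Lp_space (range J) X_nrm p" for f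
    by (rule SM_conv_ext[OF Lp(1)[OF that] Lp(2)[OF that] Lp(4)[OF that]])
  have meas: "(\<lambda>t. norm (U f t) powr p) \<in> borel_measurable circle" if "f \<in> Lp_space (range J) X_nrm p" for f
    using SM_norm_measurable[OF SMU[OF that]] by measurable
  have bp: "\<bar>norm (U f t) powr p\<bar> \<le> b f powr p" if "f \<in> Lp_space (range J) X_nrm p" "t \<in> {0..<2 * pi}" for f t
    using b[OF that(1), of t] that(2) p by (auto intro: powr_mono2)
  show ?thesis
    unfolding multiplier_def
  proof (rule exI[of _ U], intro conjI ballI allI impI)
    fix f assume f: "f \<in> Lp_space (range J) X_nrm p"
    show "U f \<in> Lp_space UNIV norm p"
      unfolding Lp_space_def using SMU[OF f] integrable_circle_bounded[OF meas[OF f] bp[OF f]] by simp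
  next
    show "\<exists>C. \<forall>f\<in>Lp_space (range J) X_nrm p. Lp_norm norm p (U f) \<le> C * Lp_norm X_nrm p f"
    proof (intro exI ballI)
      fix f assume f: "f \<in> Lp_space (range J) X_nrm p"
      have b0: "b f \<ge> 0" unfolding b_def using conv_bound(1) by simp
      have "Lp_norm norm p (U f) \<le> (2 * pi * b f powr p) powr (1 / p)"
        unfolding Lp_norm_def
        using integral_circle_le[OF meas[OF f] bp[OF f]] p by (intro powr_mono2) auto
      also have "\<dots> = (2 * pi) powr (1 / p) * b f"
        using b0 p by (simp add: powr_mult powr_powr)
      also have "b f \<le> conv_bound * ((2 * pi + 1) * Lp_norm X_nrm p f)"
        unfolding b_def by (intro mult_left_mono Lp(5)[OF f] conv_bound(1))
      finally show "Lp_norm norm p (U f) \<le> ((2 * pi) powr (1 / p) * (conv_bound * (2 * pi + 1))) * Lp_norm X_nrm p f"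
        by (simp add: mult_left_mono mult.assoc)
    qed
  next
    fix f g assume f: "f \<in> Lp_space (range J) X_nrm p" and g: "g \<in> Lp_space (range J) X_nrm p"
    have eq: "J_inv (f t + g t) = J_inv (f t) + J_inv (g t)" if "t \<in> {0..<2 * pi}" for t
      using Lp(3)[OF f that] Lp(3)[OF g that] frac_power_J J_lin(2) by metis
    have sm: "SM (\<lambda>t. J_inv (f t) + J_inv (g t))" by (intro SM_add Lp(1) f g)
    have "integrable circle (\<lambda>t. norm (J_inv (f t) + J_inv (g t)))"
      by (rule Bochner_Integration.integrable_bound[OF Bochner_Integration.integrable_add[OF Lp(2)[OF f] Lp(2)[OF g]]
            SM_norm_measurable[OF sm]]) (auto simp: norm_triangle_ineq)
    then have "\<exists>u. conv_ext (\<lambda>t. J_inv (f t) + J_inv (g t)) u" by (rule conv_ext_exists[OF sm])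
    then have "\<exists>u. conv_ext (\<lambda>t. J_inv (f t + g t)) u"
      using conv_ext_cong[OF eq] by simp
    then have ext: "conv_ext (\<lambda>t. J_inv (f t + g t)) (U (\<lambda>s. f s + g s))"
      unfolding U_def by (rule someI_ex)
    show "AE t in circle. U (\<lambda>s. f s + g s) t = U f t + U g t"
      by (intro AE_I2 conv_ext_add[OF Lp(1)[OF f] Lp(2)[OF f] Lp(1)[OF g] Lp(2)[OF g] Lp(4)[OF f] Lp(4)[OF g] ext eq]) auto
  next
    fix c f assume f: "f \<in> Lp_space (range J) X_nrm p"
    have eq: "J_inv (c *\<^sub>C f t) = c *\<^sub>C J_inv (f t)" if "t \<in> {0..<2 * pi}" for t
      using Lp(3)[OF f that] frac_power_J J_lin(6) by metis
    have sm: "SM (\<lambda>t. c *\<^sub>C J_inv (f t))"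
      by (rule SM_compose2[OF Lp(1)[OF f] Lp(1)[OF f], of "\<lambda>x y. c *\<^sub>C x"])
        (auto simp: case_prod_beta intro!: continuous_intros)
    have "integrable circle (\<lambda>t. norm (c *\<^sub>C J_inv (f t)))"
      unfolding norm_scaleC by (intro integrable_mult_right Lp(2) f)
    then have "\<exists>u. conv_ext (\<lambda>t. c *\<^sub>C J_inv (f t)) u" by (rule conv_ext_exists[OF sm])
    then have "\<exists>u. conv_ext (\<lambda>t. J_inv (c *\<^sub>C f t)) u"
      using conv_ext_cong[OF eq] by simp
    then have ext: "conv_ext (\<lambda>t. J_inv (c *\<^sub>C f t)) (U (\<lambda>s. c *\<^sub>C f s))"
      unfolding U_def by (rule someI_ex)
    show "AE t in circle. U (\<lambda>s. c *\<^sub>C f s) t = c *\<^sub>C U f t"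
      by (intro AE_I2 conv_ext_scaleC[OF Lp(1)[OF f] Lp(2)[OF f] Lp(4)[OF f] ext eq]) auto
  next
    fix F :: "int set" and c assume F: "finite F \<and> (\<forall>k\<in>F. c k \<in> range J)"
    define d where "d k = J_inv (c k)" for k
    have d: "J (d k) = c k" if "k \<in> F" for k using F that by (auto simp: d_def)
    have "trig_poly F c t = J (trig_poly F d t)" for t
      by (simp add: trig_poly_def J_lin(6,8) d)
    then have inv: "J_inv (trig_poly F c t) = trig_poly F d t" for t by simp
    have tr: "is_trig (trig_poly F d)" using F by (simp add: is_trigI)
    have "\<exists>u. conv_ext (trig_poly F d) u"
      by (rule conv_ext_exists[OF SM_trig[OF tr] integrable_norm_trig[OF tr]])
    then have "conv_ext (trig_poly F d) (U (trig_poly F c))"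
      unfolding U_def inv by (rule someI_ex)
    then have "U (trig_poly F c) t = conv (trig_poly F d) t" if "t \<in> {0..2 * pi}" for t
      using that by (intro conv_ext_trig[OF _ tr]) auto
    moreover have "conv (trig_poly F d) t = trig_poly F (\<lambda>k. R k (c k)) t" for t
      using F d by (simp add: conv_trig_poly) (simp add: trig_poly_def)
    ultimately show "AE t in circle. U (trig_poly F c) t = trig_poly F (\<lambda>k. R k (c k)) t"
      by (intro AE_I2) auto
  qed
qed

end

end

context fractional_semigroup
begin

subsection \<open>From multipliers to the range condition\<close>

text \<open>All that is kept of the multiplier is an estimate from the supremum norm of a polynomial
  to the quasi-norm of its image. The factor \<open>(2 * pi) powr (1 / p)\<close> is the
  \<open>L_p\<close> norm of the constant 1, and the ideal property passes from the extension
  \<open>U\<close> to the polynomial that equals it almost everywhere.\<close>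

lemma multiplier_weak_bound:
  assumes lat: "quasi_normed_function_lattice F q" and p: "p \<ge> 1"
    and mult: "multiplier R (range J) X_nrm p (lattice_space F) (lattice_norm q)"
  shows "\<exists>C\<ge>0. \<forall>S c B. finite S \<longrightarrow> B \<ge> 0 \<longrightarrow> (\<forall>t\<in>{0..2 * pi}. norm (trig_poly S c t) \<le> B) \<longrightarrow>
    (\<lambda>t. norm (trig_poly S (\<lambda>k. R k (J (c k))) t)) \<in> F \<and> q (\<lambda>t. norm (trig_poly S (\<lambda>k. R k (J (c k))) t)) \<le> C * B"
proof -
  obtain U C where UF: "\<forall>f\<in>Lp_space (range J) X_nrm p. U f \<in> lattice_space F"
    and UC: "\<forall>f\<in>Lp_space (range J) X_nrm p. lattice_norm q (U f) \<le> C * Lp_norm X_nrm p f"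
    and Ut: "\<forall>S c. finite S \<and> (\<forall>k\<in>S. c k \<in> range J) \<longrightarrow>
        (AE t in circle. U (trig_poly S c) t = trig_poly S (\<lambda>k. R k (c k)) t)"
    using mult unfolding multiplier_def by (elim exE conjE) (rule that; assumption)
  have "(\<lambda>t. norm (trig_poly S (\<lambda>k. R k (J (c k))) t)) \<in> F \<and>
      q (\<lambda>t. norm (trig_poly S (\<lambda>k. R k (J (c k))) t)) \<le> \<bar>C\<bar> * (2 * pi) powr (1 / p) * B"
    if S: "finite S" and B: "B \<ge> 0" and le: "\<And>t. t \<in> {0..2 * pi} \<Longrightarrow> norm (trig_poly S c t) \<le> B" for S c B
  proof -
    define h where "h = trig_poly S c"
    define f where "f = trig_poly S (\<lambda>k. J (c k))"
    have fJ: "f = (\<lambda>t. J (h t))" by (auto simp: f_def h_def trig_poly_def J_lin(6,8))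
    have SMh: "SM h" unfolding h_def by (intro SM_trig is_trigI S)
    have nf: "X_nrm (f t) = norm (h t)" for t by (simp add: fJ)
    have bd: "\<bar>X_nrm (f t) powr p\<bar> \<le> B powr p" if "t \<in> {0..<2 * pi}" for t
      using le[of t] that p by (auto simp: nf h_def intro!: powr_mono2)
    have meas: "(\<lambda>t. X_nrm (f t) powr p) \<in> borel_measurable circle"
      unfolding nf using SM_norm_measurable[OF SMh] by measurable
    have fLp: "f \<in> Lp_space (range J) X_nrm p"
      unfolding Lp_space_def using SM_J[OF SMh] integrable_circle_bounded[OF meas bd] by (simp add: fJ)
    have "Lp_norm X_nrm p f \<le> (2 * pi * B powr p) powr (1 / p)"
      unfolding Lp_norm_def using integral_circle_le[OF meas bd] p by (intro powr_mono2) auto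
    also have "\<dots> = (2 * pi) powr (1 / p) * B" using B p by (simp add: powr_mult powr_powr)
    finally have Lpn: "Lp_norm X_nrm p f \<le> (2 * pi) powr (1 / p) * B" .
    have SMv: "SM (trig_poly S (\<lambda>k. R k (J (c k))))" by (intro SM_trig is_trigI S)
    have "AE t in circle. U f t = trig_poly S (\<lambda>k. R k (J (c k))) t"
      unfolding f_def using Ut S by simp
    then have ae: "AE t in circle. \<bar>norm (trig_poly S (\<lambda>k. R k (J (c k))) t)\<bar> \<le> \<bar>norm (U f t)\<bar>"
      by eventually_elim simp
    have "(\<lambda>t. norm (U f t)) \<in> F" using UF fLp by (auto simp: lattice_space_def)
    from lattice_ideal[OF lat this SM_norm_measurable[OF SMv] ae]
    have "(\<lambda>t. norm (trig_poly S (\<lambda>k. R k (J (c k))) t)) \<in> F"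
      and "q (\<lambda>t. norm (trig_poly S (\<lambda>k. R k (J (c k))) t)) \<le> q (\<lambda>t. norm (U f t))" by auto
    moreover have "q (\<lambda>t. norm (U f t)) \<le> C * Lp_norm X_nrm p f"
      using UC fLp by (auto simp: lattice_norm_def)
    moreover have "C * Lp_norm X_nrm p f \<le> \<bar>C\<bar> * Lp_norm X_nrm p f"
      by (intro mult_right_mono) (auto simp: Lp_norm_def)
    moreover have "\<bar>C\<bar> * Lp_norm X_nrm p f \<le> \<bar>C\<bar> * ((2 * pi) powr (1 / p) * B)"
      by (intro mult_left_mono Lpn) auto
    ultimately show ?thesis by (simp add: mult.assoc)
  qed
  then show ?thesis by (intro exI[of _ "\<bar>C\<bar> * (2 * pi) powr (1 / p)"] conjI allI impI) auto
qed

text \<open>The multiplier is applied to trigonometric approximations \<open>h\<close> of \<open>(1 - cos s) T\<^sub>s x\<close>.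
  The images \<open>u\<close> satisfy \<open>P (u s) = \<integral> T\<^sub>t J (h (s - t)) dt\<close>, and along a subsequence they
  converge at some point \<open>s\<close>, where the right-hand side tends to a combination of
  \<open>T\<^sub>s J x\<close> and \<open>T\<^sub>s\<^sub>+\<^sub>2\<^sub>\<pi> J x\<close> whose coefficients add up to \<open>2 \<pi>\<close>.\<close>

lemma range_P_if_multiplier:
  assumes lat: "quasi_normed_function_lattice F q" and p: "p \<ge> 1"
    and mult: "multiplier R (range J) X_nrm p (lattice_space F) (lattice_norm q)"
  shows "J x \<in> range P"
proof -
  obtain C where C: "C \<ge> 0" and all: "\<forall>S c B. finite S \<longrightarrow> B \<ge> 0 \<longrightarrow>
    (\<forall>t\<in>{0..2 * pi}. norm (trig_poly S c t) \<le> B) \<longrightarrow>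
    (\<lambda>t. norm (trig_poly S (\<lambda>k. R k (J (c k))) t)) \<in> F \<and> q (\<lambda>t. norm (trig_poly S (\<lambda>k. R k (J (c k))) t)) \<le> C * B"
    using multiplier_weak_bound[OF assms] by (elim exE conjE) (rule that; assumption)
  note weak = all[rule_format]
  obtain \<kappa> :: real where \<kappa>: "0 < \<kappa>" "\<kappa> \<le> 1 / 2" and BC: "\<And>E D. (\<And>n. E n \<in> sets circle) \<Longrightarrow> (\<And>n. indicator (E n) \<in> F) \<Longrightarrow>
       (\<And>n. q (indicator (E n)) \<le> D * \<kappa> ^ n) \<Longrightarrow> \<exists>t\<in>{0..<2 * pi}. \<forall>\<^sub>F n in sequentially. t \<notin> E n"
    using lattice_borel_cantelli[OF lat] by blast
  define f where "f s = (1 - cos s) *\<^sub>R T s x" for s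
  have fc: "continuous_on {0..2 * pi} f"
    unfolding f_def by (intro continuous_intros continuous_on_T_Icc) auto
  have f0: "f 0 = f (2 * pi)" by (simp add: f_def)
  \<comment> \<open>The sets \<open>E n\<close> use the threshold \<open>(1 / 2) ^ n\<close>, which
    multiplies the quasi-norm bound by \<open>2 ^ n\<close>; the halving in
    \<open>\<epsilon> n\<close> pays for this and leaves the ratio \<open>\<kappa>\<close> that
    \<open>BC\<close> requires.\<close>
  define \<epsilon> where "\<epsilon> n = (\<kappa> / 2) ^ n" for n :: nat
  have \<epsilon>: "\<epsilon> n > 0" "\<epsilon> (Suc n) \<le> \<epsilon> n" for n
  proof -
    show "\<epsilon> n > 0" using \<kappa> by (simp add: \<epsilon>_def)
    then show "\<epsilon> (Suc n) \<le> \<epsilon> n" using \<kappa> mult_right_mono[of "\<kappa> / 2" 1 "\<epsilon> n"] by (simp add: \<epsilon>_def)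
  qed
  have "\<exists>S c. finite S \<and> (\<forall>t\<in>{0..2 * pi}. norm (f t - trig_poly S c t) \<le> \<epsilon> n)" for n
    using is_trig_dense[OF fc f0 \<epsilon>(1)] unfolding is_trig_def by blast
  then obtain S c where S: "\<And>n. finite (S n)" and fS: "\<And>n t. t \<in> {0..2 * pi} \<Longrightarrow> norm (f t - trig_poly (S n) (c n) t) \<le> \<epsilon> n"
    by metis
  define h where "h n = trig_poly (S n) (c n)" for n
  define u where "u n = trig_poly (S n) (\<lambda>k. R k (J (c n k)))" for n
  define g where "g n t = norm (u (Suc n) t - u n t)" for n t
  have RJ: "bounded_clinear (\<lambda>y. R k (J y))" for k
    using bounded_linear_compose[OF R_lin(1) J_lin(1)] by (simp add: bounded_clinear_def R_lin J_lin)
  have gF: "g n \<in> F \<and> q (g n) \<le> C * (2 * \<epsilon> n)" for n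
  proof -
    obtain S' d where d: "finite S'" "\<And>t. trig_poly S' d t = h (Suc n) t - h n t"
      "\<And>t. trig_poly S' (\<lambda>k. R k (J (d k))) t = u (Suc n) t - u n t"
      by (rule trig_poly_diff_multiplier[OF S[of "Suc n"] S[of n] RJ, where c = "c (Suc n)" and c' = "c n"])
        (rule that; simp add: h_def u_def)
    have "norm (trig_poly S' d t) \<le> 2 * \<epsilon> n" if t: "t \<in> {0..2 * pi}" for t
      using fS[OF t, of n] fS[OF t, of "Suc n"] \<epsilon>(2)[of n]
        norm_triangle_ineq4[of "f t - h n t" "f t - h (Suc n) t"] by (simp add: d h_def)
    from weak[OF d(1) _ this] show ?thesis using \<epsilon>(1)[of n] by (simp add: d(3) g_def [abs_def])
  qed
  have SMg: "SM (\<lambda>t. u (Suc n) t - u n t)" for n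
    unfolding u_def by (intro SM_diff SM_trig is_trigI S)
  have gm: "g n \<in> borel_measurable circle" for n
    using SM_norm_measurable[OF SMg] by (simp add: g_def [abs_def])
  define E where "E n = {t \<in> space circle. (1 / 2) ^ n \<le> g n t}" for n
  have Es: "E n \<in> sets circle" for n
    unfolding E_def using gm by measurable
  have EF: "indicator (E n) \<in> F \<and> q (indicator (E n)) \<le> 2 * C * \<kappa> ^ n" for n
  proof -
    have "\<bar>indicator (E n) t\<bar> \<le> \<bar>2 ^ n * g n t\<bar>" for t
    proof (cases "t \<in> E n")
      case True
      then have "2 ^ n * (1 / 2) ^ n \<le> 2 ^ n * g n t" by (intro mult_left_mono) (auto simp: E_def)
      then show ?thesis using True by (simp add: power_one_over)
    qed simp
    then have "indicator (E n) \<in> F \<and> q (indicator (E n)) \<le> q (\<lambda>t. 2 ^ n * g n t)"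
      using gF Es by (intro lattice_ideal[OF lat lattice_scale[OF lat]]) auto
    moreover have "q (\<lambda>t. 2 ^ n * g n t) = 2 ^ n * q (g n)"
      using lattice_homogeneous[OF lat, of "g n" "2 ^ n"] gF by simp
    moreover have "2 ^ n * q (g n) \<le> 2 ^ n * (C * (2 * \<epsilon> n))"
      using gF by (intro mult_left_mono) auto
    moreover have "2 ^ n * (C * (2 * \<epsilon> n)) = 2 * C * \<kappa> ^ n"
      by (simp add: \<epsilon>_def power_divide)
    ultimately show ?thesis by simp
  qed
  obtain s where s: "s \<in> {0..<2 * pi}" "\<forall>\<^sub>F n in sequentially. s \<notin> E n"
    using BC[of E "2 * C"] Es EF by blast
  \<comment> \<open>At \<open>s\<close> the increments of \<open>u n s\<close> are eventually below
    \<open>(1 / 2) ^ n\<close>, so the telescoping series converges.\<close>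
  have "summable (\<lambda>n. u (Suc n) s - u n s)"
  proof (rule summable_comparison_test_ev)
    show "\<forall>\<^sub>F n in sequentially. norm (u (Suc n) s - u n s) \<le> (1 / 2) ^ n"
      using s(2) by eventually_elim (use s(1) in \<open>auto simp: E_def g_def\<close>)
  qed (simp add: summable_geometric)
  from summable_LIMSEQ[OF this] have "(\<lambda>n. u n s - u 0 s) \<longlonglongrightarrow> (\<Sum>n. u (Suc n) s - u n s)"
    unfolding sum_lessThan_telescope[of "\<lambda>n. u n s"] .
  from tendsto_add[OF this tendsto_const[of "u 0 s"]] obtain v where v: "(\<lambda>n. u n s) \<longlonglongrightarrow> v"
    by auto
  then have Pv: "(\<lambda>n. P (u n s)) \<longlonglongrightarrow> P v" by (rule bounded_linear.tendsto[OF P_lin(1)])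
  define y where "y = T s (J x)"
  define a where "a = integral {0..s} (\<lambda>t. 1 - cos (s - t))"
  define b where "b = integral {s..2 * pi} (\<lambda>t. 1 - cos (s - t))"
  have ab: "a + b = 2 * pi"
  proof -
    have "a + b = integral {0..2 * pi} (\<lambda>t. 1 - cos (s - t))"
      unfolding a_def b_def using s
      by (intro Henstock_Kurzweil_Integration.integral_combine integrable_continuous_interval continuous_intros) auto
    also have "((\<lambda>t. 1 - cos (s - t)) has_integral (2 * pi - 0)) {0..2 * pi}"
      using has_integral_diff[OF has_integral_const_real[of "1 :: real" 0 "2 * pi"] has_integral_cos_shift[of 1 s]] by simp
    then have "integral {0..2 * pi} (\<lambda>t. 1 - cos (s - t)) = 2 * pi" by (simp add: integral_unique)
    finally show ?thesis .
  qed
  \<comment> \<open>The limit of the integrands: with \<open>f\<close> continued periodically,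
    \<open>T t J f (s - t)\<close> is \<open>1 - cos (s - t)\<close> times \<open>J x\<close> moved
    by the total time \<open>s\<close> for \<open>t \<le> s\<close> and by \<open>s + 2 * pi\<close>
    beyond.\<close>
  define w where "w t = (1 - cos (s - t)) *\<^sub>R (if t \<le> s then y else T (2 * pi) y)" for t
  have whi: "(w has_integral (a *\<^sub>R y + b *\<^sub>R T (2 * pi) y)) {0..2 * pi}"
  proof (rule has_integral_combine[of 0 s])
    have "((\<lambda>t. (1 - cos (s - t)) *\<^sub>R y) has_integral a *\<^sub>R y) {0..s}"
      unfolding a_def by (intro has_integral_scaleR_left integrable_integral integrable_continuous_interval continuous_intros)
    then show "(w has_integral a *\<^sub>R y) {0..s}"
      by (rule has_integral_eq[rotated]) (simp add: w_def)
    have "((\<lambda>t. (1 - cos (s - t)) *\<^sub>R T (2 * pi) y) has_integral b *\<^sub>R T (2 * pi) y) {s..2 * pi}"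
      unfolding b_def by (intro has_integral_scaleR_left integrable_integral integrable_continuous_interval continuous_intros)
    then show "(w has_integral b *\<^sub>R T (2 * pi) y) {s..2 * pi}"
      by (rule has_integral_eq[rotated]) (auto simp: w_def)
  qed (use s in auto)
  have Q: "((\<lambda>t. cis (of_int k * (- t)) *\<^sub>C T t (J z)) has_integral R k (P (J z))) {0..2 * pi}" for k z
    using fourier_resolvent[OF spec[rule_format, of k], of "J z"] by (simp add: P_def)
  have Pu: "((\<lambda>t. T t (J (h n (s - t)))) has_integral P (u n s)) {0..2 * pi}" for n
  proof -
    have "trig_poly (S n) (\<lambda>k. R k (P (J (c n k)))) s = P (u n s)"
      by (simp add: u_def trig_poly_def P_lin(6,8) R_P)
    then show ?thesis using trig_convolution[OF J_clinear Q S[of n], of "c n" s] by (simp add: h_def)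
  qed
  obtain K where K: "K > 0" "\<And>t x. 0 \<le> t \<Longrightarrow> t \<le> 2 * pi \<Longrightarrow> norm (T t x) \<le> K * norm x"
    using local_bound by blast
  obtain L where L: "L > 0" "\<And>x. norm (J x) \<le> norm x * L"
    using bounded_linear.pos_bounded[OF J_lin(1)] by blast
  have close: "norm (T t (J (h n (s - t))) - w t) \<le> K * (\<epsilon> n * L)" if t: "t \<in> {0..2 * pi}" for n t
  proof -
    \<comment> \<open>The representative of \<open>s - t\<close> modulo \<open>2 * pi\<close> in the
      interval where \<open>f\<close> was approximated.\<close>
    define r where "r = (if t \<le> s then s - t else s - t + 2 * pi)"
    have r: "r \<in> {0..2 * pi}" using s t by (auto simp: r_def)
    have hr: "h n (s - t) = h n r"
      using is_trig_periodic[OF is_trigI[OF S[of n], of "c n"], of "s - t"] by (auto simp: r_def h_def)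
    have "T t (J (f r)) = (1 - cos r) *\<^sub>R T (t + r) (J x)"
      using t r by (simp add: f_def J_lin(5) T_lin(5) J_T T_add)
    moreover have "cos r = cos (s - t)" by (simp add: r_def)
    moreover have "T (t + r) (J x) = (if t \<le> s then y else T (2 * pi) y)"
      using s T_add[of "2 * pi" s "J x"] by (auto simp: r_def y_def add.commute)
    ultimately have wr: "w t = T t (J (f r))" by (simp add: w_def)
    have "T t (J (h n (s - t))) - w t = T t (J (h n r - f r))"
      using t by (simp add: hr wr J_lin T_lin)
    also have "norm \<dots> \<le> K * norm (J (h n r - f r))" using K(2) t by simp
    also have "\<dots> \<le> K * (norm (h n r - f r) * L)" using L(2) K(1) by (intro mult_left_mono) auto
    also have "\<dots> \<le> K * (\<epsilon> n * L)"
      using fS[OF r, of n] K(1) L(1) by (intro mult_left_mono mult_right_mono) (auto simp: h_def norm_minus_commute)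
    finally show ?thesis .
  qed
  have lim: "(\<lambda>n. P (u n s)) \<longlonglongrightarrow> a *\<^sub>R y + b *\<^sub>R T (2 * pi) y"
  proof (rule LIM_zero_cancel, rule Lim_null_comparison)
    show "\<forall>\<^sub>F n in sequentially. norm (P (u n s) - (a *\<^sub>R y + b *\<^sub>R T (2 * pi) y)) \<le> K * (\<epsilon> n * L) * (2 * pi)"
    proof (intro always_eventually allI)
      fix n
      have "norm (P (u n s) - (a *\<^sub>R y + b *\<^sub>R T (2 * pi) y)) \<le> K * (\<epsilon> n * L) * measure lborel {0..2 * pi}"
        by (rule has_integral_bound_real[OF _ _ has_integral_diff[OF Pu whi], of _ "{}"])
          (use K(1) L(1) \<epsilon>(1)[of n] close in auto)
      then show "norm (P (u n s) - (a *\<^sub>R y + b *\<^sub>R T (2 * pi) y)) \<le> K * (\<epsilon> n * L) * (2 * pi)" by simp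
    qed
    have "(\<lambda>n. K * (\<epsilon> n * L) * (2 * pi)) \<longlonglongrightarrow> K * (0 * L) * (2 * pi)"
      unfolding \<epsilon>_def using \<kappa> by (intro tendsto_intros LIMSEQ_realpow_zero) auto
    then show "(\<lambda>n. K * (\<epsilon> n * L) * (2 * pi)) \<longlonglongrightarrow> 0" by simp
  qed
  have Pv': "P v = a *\<^sub>R y + b *\<^sub>R T (2 * pi) y" by (rule LIMSEQ_unique[OF Pv lim])
  \<comment> \<open>Adding \<open>P (b y) = b y - b T (2 * pi) y\<close> cancels the shifted term
    and leaves the coefficient \<open>a + b\<close>, which is not 0.\<close>
  have "P (v + b *\<^sub>R y) = (a + b) *\<^sub>R y"
    unfolding P_lin(2) P_lin(5) Pv' by (simp add: P_def scaleR_diff_right scaleR_add_left)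
  then have "P ((1 / (2 * pi)) *\<^sub>R (v + b *\<^sub>R y)) = y"
    unfolding P_lin(5) ab by simp
  moreover define z where "z = (1 / (2 * pi)) *\<^sub>R (v + b *\<^sub>R y)"
  ultimately have z: "P z = y" by simp
  \<comment> \<open>Applying \<open>T (2 * pi - s)\<close> completes the period:
    \<open>T (2 * pi) (J x)\<close> lies in the range of \<open>P\<close>, and adding
    \<open>P (J x)\<close> gives \<open>J x\<close>.\<close>
  have "T (2 * pi) (J x) = T (2 * pi - s) y"
    unfolding y_def using s T_add[of "2 * pi - s" s "J x"] by simp
  also have "\<dots> = P (T (2 * pi - s) z)" using s T_P[of "2 * pi - s" z] by (simp add: z)
  finally have "J x = P (J x + T (2 * pi - s) z)"
    unfolding P_lin(2) by (simp add: P_def)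
  then show ?thesis by (metis rangeI)
qed

subsection \<open>The weak condition\<close>

text \<open>Formally the sum is the integral of \<open>x' (T t (S y))\<close> against the transform
  of \<open>\<Phi>\<close> at \<open>- t\<close>. Summability at \<open>t = 0\<close> makes
  \<open>\<Phi>\<close> absolutely summable, so finite partial sums approximate the transform
  uniformly and only their integrals have to be evaluated.\<close>

lemma weak_estimate:
  assumes "range J \<subseteq> range P"
  shows "\<exists>K>0. \<forall>y. \<forall>x' :: 'a \<Rightarrow> complex. \<forall>\<Phi>. bounded_clinear x' \<and> smooth_check \<Phi> \<longrightarrow>
    (\<lambda>k. x' (R k (J y)) * \<Phi> k) summable_on UNIV \<and>
    cmod (\<Sum>\<^sub>\<infinity>k\<in>UNIV. x' (R k (J y)) * \<Phi> k) \<le> K * norm y * onorm x' * (\<integral>t. cmod (check_transform \<Phi> t) \<partial>circle)"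
proof -
  obtain S where S: "bounded_clinear S" "\<And>y. P (S y) = J y" using bounded_inverse[OF assms] by blast
  obtain K where K: "K > 0" "\<And>t x. 0 \<le> t \<Longrightarrow> t \<le> 2 * pi \<Longrightarrow> norm (T t x) \<le> K * norm x"
    using local_bound by blast
  obtain L where L: "L > 0" "\<And>x. norm (S x) \<le> norm x * L"
    using bounded_linear.pos_bounded[OF bounded_clinearD(1)[OF S(1)]] by blast
  have "(\<lambda>k. x' (R k (J y)) * \<Phi> k) summable_on UNIV \<and>
      cmod (\<Sum>\<^sub>\<infinity>k\<in>UNIV. x' (R k (J y)) * \<Phi> k) \<le> (K * L) * norm y * onorm x' * (\<integral>t. cmod (check_transform \<Phi> t) \<partial>circle)"
    if x': "bounded_clinear x'" and \<Phi>: "smooth_check \<Phi>" for y and x' :: "'a \<Rightarrow> complex" and \<Phi>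
  proof -
    note xl = bounded_clinearD[OF x']
    define b where "b = K * L * norm y * onorm x'"
    define w where "w t = x' (T t (S y))" for t
    define \<alpha>' where "\<alpha>' k = x' (R k (J y))" for k
    have b0: "b \<ge> 0" unfolding b_def using K L onorm_pos_le[OF xl(1)] by simp
    have w: "cmod (w t) \<le> b" if "t \<in> {0..2 * pi}" for t
    proof -
      have "cmod (w t) \<le> onorm x' * norm (T t (S y))" unfolding w_def by (rule onorm[OF xl(1)])
      also have "\<dots> \<le> onorm x' * (K * (norm y * L))"
      proof (intro mult_left_mono onorm_pos_le[OF xl(1)])
        have "norm (T t (S y)) \<le> K * norm (S y)" using K(2) that by simp
        also have "\<dots> \<le> K * (norm y * L)" using L(2) K(1) by (intro mult_left_mono) auto
        finally show "norm (T t (S y)) \<le> K * (norm y * L)" .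
      qed
      finally show ?thesis by (simp add: b_def mult_ac)
    qed
    have wc: "continuous_on {0..2 * pi} w"
      unfolding w_def by (intro bounded_linear.continuous_on[OF xl(1)] continuous_on_T_Icc) simp
    have \<alpha>i: "((\<lambda>t. cis (of_int k * (- t)) * w t) has_integral \<alpha>' k) {0..2 * pi}" for k
      using has_integral_linear[OF R_J_integral[OF S, of k y] xl(1)]
      by (simp add: o_def w_def \<alpha>'_def xl(6) scaleC_complex_def)
    have \<alpha>b: "cmod (\<alpha>' k) \<le> b * (2 * pi)" for k
    proof -
      have "cmod (\<alpha>' k) \<le> b * measure lborel {0..2 * pi}"
        by (rule has_integral_bound_real[OF b0 _ \<alpha>i, of "{}"]) (use w in \<open>auto simp: norm_mult\<close>)
      then show ?thesis by simp
    qed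
    have sum\<Phi>: "(\<lambda>k. \<Phi> k * cis (of_int k * t)) summable_on UNIV" for t using \<Phi> by (simp add: smooth_check_def)
    from sum\<Phi>[of 0] have abs\<Phi>: "(\<lambda>k. norm (\<Phi> k)) summable_on UNIV"
      by (simp add: summable_on_iff_abs_summable_on_complex)
    define A where "A = (\<Sum>\<^sub>\<infinity>k\<in>UNIV. norm (\<Phi> k))"
    have abs2: "(\<lambda>k. norm (\<alpha>' k * \<Phi> k)) summable_on UNIV"
    proof (rule Infinite_Sum.summable_on_comparison_test)
      show "(\<lambda>k. b * (2 * pi) * norm (\<Phi> k)) summable_on UNIV" by (rule summable_on_cmult_right[OF abs\<Phi>])
      show "norm (\<alpha>' k * \<Phi> k) \<le> b * (2 * pi) * norm (\<Phi> k)" for k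
        unfolding norm_mult using \<alpha>b by (rule mult_right_mono) simp
    qed simp
    then have summ: "(\<lambda>k. \<alpha>' k * \<Phi> k) summable_on UNIV" by (rule abs_summable_summable)
    define I where "I = (\<integral>t. cmod (check_transform \<Phi> t) \<partial>circle)"
    have chc: "continuous_on B (check_transform \<Phi>)" for B
      using \<Phi> by (auto simp: smooth_check_def intro: smooth_imp_continuous)
    have per: "check_transform \<Phi> (t + 2 * pi) = check_transform \<Phi> t" for t
    proof -
      have "cis (of_int k * (t + 2 * pi)) = cis (of_int k * t)" for k :: int
        using is_trig_periodic[OF is_trig_monomial[of k "1 :: complex"], of t] by (simp add: scaleC_complex_def)
      then show ?thesis by (simp add: check_transform_def)
    qed
    have chr: "continuous_on {0..2 * pi} (\<lambda>t. check_transform \<Phi> (0 - t))"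
      by (rule continuous_on_compose2[OF chc[of UNIV]]) (auto intro!: continuous_intros)
    have I: "integral {0..2 * pi} (\<lambda>t. cmod (check_transform \<Phi> (0 - t))) = I"
    proof -
      have c: "continuous_on B (\<lambda>t. cmod (check_transform \<Phi> t))" for B
        by (intro continuous_on_norm chc)
      show ?thesis
        unfolding I_def using integral_periodic_reflect[OF c, of 0] integral_circle_eq[OF c] by (simp add: per)
    qed
    have "cmod (\<Sum>\<^sub>\<infinity>k\<in>UNIV. \<alpha>' k * \<Phi> k) \<le> b * I + e" if e: "e > 0" for e
    proof -
      \<comment> \<open>The uniform error \<open>d\<close> costs \<open>b * d * (2 * pi)\<close> in
        the integral, and truncating the sum costs another \<open>d\<close>; together they make
        \<open>e\<close>.\<close>
      define d where "d = e / (b * (2 * pi) + 1)"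
      have den: "b * (2 * pi) + 1 > 0" using b0 by (intro add_nonneg_pos mult_nonneg_nonneg) auto
      have d: "d > 0" using e den by (simp add: d_def)
      have "((\<lambda>k. norm (\<Phi> k)) has_sum A) UNIV" unfolding A_def by (rule has_sum_infsum[OF abs\<Phi>])
      then have "\<forall>\<^sub>F F in finite_subsets_at_top UNIV. dist (\<Sum>k\<in>F. norm (\<Phi> k)) A < d"
        unfolding has_sum_def tendsto_iff using d by blast
      moreover have "\<forall>\<^sub>F F in finite_subsets_at_top UNIV. dist (\<Sum>k\<in>F. \<alpha>' k * \<Phi> k) (\<Sum>\<^sub>\<infinity>k\<in>UNIV. \<alpha>' k * \<Phi> k) < d"
        using has_sum_infsum[OF summ] d unfolding has_sum_def tendsto_iff by blast
      moreover have "\<forall>\<^sub>F F in finite_subsets_at_top UNIV. finite (F :: int set)"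
        by (rule eventually_finite_subsets_at_top_weakI)
      ultimately have "\<forall>\<^sub>F F in finite_subsets_at_top UNIV. finite F \<and> dist (\<Sum>k\<in>F. norm (\<Phi> k)) A < d
          \<and> dist (\<Sum>k\<in>F. \<alpha>' k * \<Phi> k) (\<Sum>\<^sub>\<infinity>k\<in>UNIV. \<alpha>' k * \<Phi> k) < d"
        by eventually_elim auto
      then obtain F where F: "finite F" "dist (\<Sum>k\<in>F. norm (\<Phi> k)) A < d"
        "dist (\<Sum>k\<in>F. \<alpha>' k * \<Phi> k) (\<Sum>\<^sub>\<infinity>k\<in>UNIV. \<alpha>' k * \<Phi> k) < d"
        using eventually_happens'[OF finite_subsets_at_top_neq_bot] by blast
      have tail: "cmod ((\<Sum>k\<in>F. \<Phi> k * cis (of_int k * t)) - check_transform \<Phi> t) \<le> d" for t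
      proof -
        have nk: "norm (\<Phi> k * cis (of_int k * t)) = norm (\<Phi> k)" for k by (simp add: norm_mult)
        have "check_transform \<Phi> t - (\<Sum>k\<in>F. \<Phi> k * cis (of_int k * t)) = (\<Sum>\<^sub>\<infinity>k\<in>UNIV - F. \<Phi> k * cis (of_int k * t))"
          unfolding check_transform_def using F(1) sum\<Phi>[of t]
          by (subst infsum_Diff) (auto simp: summable_on_finite)
        also have "cmod \<dots> \<le> (\<Sum>\<^sub>\<infinity>k\<in>UNIV - F. norm (\<Phi> k * cis (of_int k * t)))"
          unfolding nk by (rule order_trans[OF norm_infsum_bound]) (auto simp: nk intro: summable_on_subset_banach[OF abs\<Phi>])
        also have "\<dots> = A - (\<Sum>k\<in>F. norm (\<Phi> k))"
          unfolding nk A_def using F(1) abs\<Phi> by (subst infsum_Diff) (auto simp: summable_on_finite)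
        also have "\<dots> \<le> d" using F(2) by (simp add: dist_real_def)
        finally show ?thesis by (simp add: norm_minus_commute)
      qed
      have hF: "((\<lambda>t. (\<Sum>k\<in>F. \<Phi> k * cis (of_int k * (0 - t))) * w t) has_integral (\<Sum>k\<in>F. \<alpha>' k * \<Phi> k)) {0..2 * pi}"
      proof -
        have "((\<lambda>t. \<Sum>k\<in>F. \<Phi> k * (cis (of_int k * (- t)) * w t)) has_integral (\<Sum>k\<in>F. \<Phi> k * \<alpha>' k)) {0..2 * pi}"
          by (intro has_integral_sum F has_integral_mult_right \<alpha>i)
        then show ?thesis by (simp add: sum_distrib_left mult_ac)
      qed
      have "cmod (\<Sum>k\<in>F. \<alpha>' k * \<Phi> k) \<le> integral {0..2 * pi} (\<lambda>t. b * cmod (check_transform \<Phi> (0 - t)) + b * d)"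
        unfolding integral_unique[OF hF, symmetric]
      proof (rule integral_norm_bound_integral)
        show "(\<lambda>t. (\<Sum>k\<in>F. \<Phi> k * cis (of_int k * (0 - t))) * w t) integrable_on {0..2 * pi}" using hF by blast
        show "(\<lambda>t. b * cmod (check_transform \<Phi> (0 - t)) + b * d) integrable_on {0..2 * pi}"
          by (intro integrable_continuous_interval continuous_intros chr)
        fix t assume t: "t \<in> {0..2 * pi}"
        have "cmod (\<Sum>k\<in>F. \<Phi> k * cis (of_int k * (0 - t))) \<le> cmod (check_transform \<Phi> (0 - t)) + d"
          using tail[of "0 - t"] norm_triangle_sub[of "\<Sum>k\<in>F. \<Phi> k * cis (of_int k * (0 - t))" "check_transform \<Phi> (0 - t)"]
          by linarith
        then have "cmod ((\<Sum>k\<in>F. \<Phi> k * cis (of_int k * (0 - t))) * w t) \<le> (cmod (check_transform \<Phi> (0 - t)) + d) * b"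
          unfolding norm_mult using w[OF t] d by (intro mult_mono) auto
        then show "cmod ((\<Sum>k\<in>F. \<Phi> k * cis (of_int k * (0 - t))) * w t) \<le> b * cmod (check_transform \<Phi> (0 - t)) + b * d"
          by (simp add: algebra_simps)
      qed
      also have "\<dots> = b * I + b * d * (2 * pi)"
      proof (rule integral_unique)
        have "((\<lambda>t. cmod (check_transform \<Phi> (0 - t))) has_integral I) {0..2 * pi}"
          unfolding I[symmetric] by (intro integrable_integral integrable_continuous_interval continuous_intros chr)
        then show "((\<lambda>t. b * cmod (check_transform \<Phi> (0 - t)) + b * d) has_integral b * I + b * d * (2 * pi)) {0..2 * pi}"
          using has_integral_const_real[of "b * d" 0 "2 * pi"]
          by (intro has_integral_add has_integral_mult_right) (auto simp: mult.commute)
      qed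
      finally have "cmod (\<Sum>\<^sub>\<infinity>k\<in>UNIV. \<alpha>' k * \<Phi> k) \<le> b * I + b * d * (2 * pi) + d"
        using F(3) norm_triangle_sub[of "\<Sum>\<^sub>\<infinity>k\<in>UNIV. \<alpha>' k * \<Phi> k" "\<Sum>k\<in>F. \<alpha>' k * \<Phi> k"]
        by (simp add: dist_norm norm_minus_commute)
      also have "\<dots> = b * I + (b * (2 * pi) + 1) * d" by (simp add: algebra_simps)
      also have "(b * (2 * pi) + 1) * d = e" using den by (simp add: d_def)
      finally show ?thesis .
    qed
    then have "cmod (\<Sum>\<^sub>\<infinity>k\<in>UNIV. \<alpha>' k * \<Phi> k) \<le> b * I" by (rule field_le_epsilon)
    then show ?thesis using summ by (simp add: \<alpha>'_def b_def I_def)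
  qed
  then show ?thesis using K(1) L(1) by (intro exI[of _ "K * L"]) auto
qed

lemma fejer_functional:
  fixes x' :: "'a \<Rightarrow> complex"
  assumes x': "bounded_clinear x'"
  obtains \<Phi> where "smooth_check \<Phi>" "(\<Sum>\<^sub>\<infinity>k\<in>UNIV. x' (R k y) * \<Phi> k) = x' (cesaro N y)"
    "\<And>t. check_transform \<Phi> t = of_real (fejer N t)"
proof -
  \<comment> \<open>The triangular weights of the Cesaro mean: the proportion of those
    \<open>n < N\<close> with \<open>|k| \<le> n\<close>, which for \<open>N > 0\<close> is
    \<open>1 - |k| / N\<close> inside \<open>[- N, N]\<close> and 0 outside.\<close>
  define \<Phi> :: "int \<Rightarrow> complex" where "\<Phi> k = (\<Sum>n<N. if k \<in> {- int n..int n} then 1 else 0) / of_nat N" for k :: int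
  have supp: "\<Phi> k = 0" if "k \<notin> {- int N..int N}" for k
    unfolding \<Phi>_def using that by (subst sum.neutral) auto
  have fin: "(\<Sum>k\<in>{- int N..int N}. g k * \<Phi> k) = (\<Sum>n<N. \<Sum>k\<in>{- int n..int n}. g k) / of_nat N"
    for g :: "int \<Rightarrow> complex"
  proof -
    have "(\<Sum>k\<in>{- int N..int N}. g k * \<Phi> k)
        = (\<Sum>k\<in>{- int N..int N}. \<Sum>n<N. if k \<in> {- int n..int n} then g k else 0) / of_nat N"
    proof -
      have one: "g k * (if Q then 1 else 0) = (if Q then g k else 0)" for k Q by simp
      show ?thesis
        unfolding \<Phi>_def times_divide_eq_right sum_distrib_left one sum_divide_distrib[symmetric] ..
    qed
    also have "(\<Sum>k\<in>{- int N..int N}. \<Sum>n<N. if k \<in> {- int n..int n} then g k else 0)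
        = (\<Sum>n<N. \<Sum>k\<in>{- int N..int N}. if k \<in> {- int n..int n} then g k else 0)"
      by (rule sum.swap)
    also have "\<dots> = (\<Sum>n<N. \<Sum>k\<in>{- int n..int n}. g k)"
      by (intro sum.cong refl sum.mono_neutral_cong_right) auto
    finally show ?thesis .
  qed
  have inf: "(\<Sum>\<^sub>\<infinity>k\<in>UNIV. g k * \<Phi> k) = (\<Sum>n<N. \<Sum>k\<in>{- int n..int n}. g k) / of_nat N" for g :: "int \<Rightarrow> complex"
  proof -
    have "(\<Sum>\<^sub>\<infinity>k\<in>UNIV. g k * \<Phi> k) = (\<Sum>\<^sub>\<infinity>k\<in>{- int N..int N}. g k * \<Phi> k)"
      by (rule infsum_cong_neutral) (use supp in auto)
    then show ?thesis using fin by simp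
  qed
  have ck: "check_transform \<Phi> t = of_real (fejer N t)" for t
  proof -
    have "check_transform \<Phi> t = (\<Sum>\<^sub>\<infinity>k\<in>UNIV. cis (of_int k * t) * \<Phi> k)"
      by (simp add: check_transform_def mult.commute)
    then show ?thesis by (simp add: inf fejer_def sum_cis_symmetric)
  qed
  have "check_transform \<Phi> = trig_poly {- int N..int N} \<Phi>"
  proof
    fix t
    have "check_transform \<Phi> t = (\<Sum>\<^sub>\<infinity>k\<in>{- int N..int N}. \<Phi> k * cis (of_int k * t))"
      unfolding check_transform_def by (rule infsum_cong_neutral) (use supp in auto)
    then show "check_transform \<Phi> t = trig_poly {- int N..int N} \<Phi> t"
      by (simp add: trig_poly_def scaleC_complex_def mult.commute)
  qed
  then have "smooth (check_transform \<Phi>)" using smooth_trig[OF is_trigI] by simp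
  moreover have "(\<lambda>k. \<Phi> k * cis (of_int k * t)) summable_on UNIV" for t
  proof -
    have "(\<lambda>k. \<Phi> k * cis (of_int k * t)) summable_on {- int N..int N}" by (rule summable_on_finite) simp
    then show ?thesis by (rule summable_on_cong_neutral[THEN iffD1, rotated -1]) (use supp in auto)
  qed
  ultimately have "smooth_check \<Phi>" by (simp add: smooth_check_def)
  moreover have "(\<Sum>\<^sub>\<infinity>k\<in>UNIV. x' (R k y) * \<Phi> k) = x' (cesaro N y)"
    unfolding inf
    by (simp add: cesaro_def bounded_clinearD(5,8)[OF x'] scaleR_conv_of_real divide_inverse mult.commute)
  ultimately show ?thesis using that ck by blast
qed

text \<open>The functional that norms \<open>cesaro N (J y)\<close>, tested with the Fejer kernel of
  mass \<open>2 * pi\<close>, bounds the means uniformly. Convergence on the dense set of vectors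
  \<open>P z\<close>, where \<open>J\<close> commutes with \<open>P\<close>, then makes them Cauchy
  everywhere.\<close>

lemma range_P_if_weak_estimate:
  assumes "K > 0" and weak: "\<And>y (x' :: 'a \<Rightarrow> complex) \<Phi>. bounded_clinear x' \<Longrightarrow> smooth_check \<Phi> \<Longrightarrow>
    cmod (\<Sum>\<^sub>\<infinity>k\<in>UNIV. x' (R k (J y)) * \<Phi> k) \<le> K * norm y * onorm x' * (\<integral>t. cmod (check_transform \<Phi> t) \<partial>circle)"
  shows "J y \<in> range P"
proof -
  have bound: "norm (cesaro N (J y)) \<le> K * (2 * pi) * norm y" for N y
  proof (cases "N = 0")
    case True
    then show ?thesis using assms(1) by (simp add: cesaro_def)
  next
    case False
    obtain x' :: "'a \<Rightarrow> complex" where x': "bounded_clinear x'" "\<And>x. cmod (x' x) \<le> norm x"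
      "x' (cesaro N (J y)) = of_real (norm (cesaro N (J y)))"
      using hahn_banach by blast
    obtain \<Phi> where \<Phi>: "smooth_check \<Phi>" "(\<Sum>\<^sub>\<infinity>k\<in>UNIV. x' (R k (J y)) * \<Phi> k) = x' (cesaro N (J y))"
      "\<And>t. check_transform \<Phi> t = of_real (fejer N t)"
      using fejer_functional[OF x'(1), of "J y" N] by blast
    have "(\<integral>t. cmod (check_transform \<Phi> t) \<partial>circle) = (\<integral>t. fejer N t \<partial>circle)"
      by (simp add: \<Phi>(3) fejer_nonneg)
    also have "\<dots> = integral {0..2 * pi} (fejer N)"
      by (intro integral_circle_eq continuous_on_fejer continuous_on_id)
    also have "\<dots> = 2 * pi"
    proof -
      have "fejer N (0 - t) = fejer N t" for t by (simp add: fejer_def)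
      then show ?thesis using integral_unique[OF has_integral_fejer[of N 0]] False by simp
    qed
    finally have int: "(\<integral>t. cmod (check_transform \<Phi> t) \<partial>circle) = 2 * pi" .
    have "onorm x' \<le> 1" using x'(2) by (intro onorm_bound) auto
    then have "K * norm y * onorm x' * (2 * pi) \<le> K * norm y * 1 * (2 * pi)"
      using assms(1) by (intro mult_right_mono mult_left_mono) auto
    moreover have "norm (cesaro N (J y)) \<le> K * norm y * onorm x' * (2 * pi)"
      using weak[OF x'(1) \<Phi>(1), of y] by (simp add: \<Phi>(2) x'(3) int)
    ultimately show ?thesis by (simp add: mult_ac)
  qed
  note cl = bounded_clinearD[OF cesaro_clinear[OF spec]]
  have "Cauchy (\<lambda>N. cesaro N (J y))"
  proof (rule metric_CauchyI)
    fix e :: real assume e: "e > 0"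
    define d where "d = e / (3 * (K * (2 * pi) + 1))"
    have den: "K * (2 * pi) + 1 > 0" using assms(1) by (intro add_nonneg_pos) auto
    have d: "d > 0" using e den by (simp add: d_def)
    have Kd: "K * (2 * pi) * d < e / 3"
    proof -
      have "K * (2 * pi) * d < (K * (2 * pi) + 1) * d" using d by simp
      also have "\<dots> = e / 3"
      proof -
        have "x * (e / (3 * x)) = e / 3" if "x \<noteq> 0" for x :: real using that by simp
        then show ?thesis unfolding d_def using den by (metis less_numeral_extra(3))
      qed
      finally show ?thesis .
    qed
    obtain z where z: "norm (y - P z) \<le> d" using dense_range[OF spec d, of y] by (auto simp: P_def)
    have near: "norm (cesaro N (J y) - cesaro N (P (J z))) < e / 3" for N
    proof -
      have "cesaro N (J y) - cesaro N (P (J z)) = cesaro N (J (y - P z))"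
        by (simp add: cl J_lin J_P)
      also have "norm \<dots> \<le> K * (2 * pi) * norm (y - P z)" by (rule bound)
      also have "\<dots> \<le> K * (2 * pi) * d" using z assms(1) by (intro mult_left_mono) auto
      finally show ?thesis using Kd by linarith
    qed
    have "Cauchy (\<lambda>N. cesaro N (P (J z)))"
      using LIMSEQ_imp_Cauchy[OF cesaro_P_tendsto] .
    then obtain M where M: "\<And>m n. m \<ge> M \<Longrightarrow> n \<ge> M \<Longrightarrow> norm (cesaro m (P (J z)) - cesaro n (P (J z))) < e / 3"
      using CauchyD[of _ "e / 3"] e by (metis zero_less_divide_iff zero_less_numeral)
    show "\<exists>M. \<forall>m\<ge>M. \<forall>n\<ge>M. dist (cesaro m (J y)) (cesaro n (J y)) < e"
    proof (intro exI[of _ M] allI impI)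
      fix m n assume mn: "m \<ge> M" "n \<ge> M"
      show "dist (cesaro m (J y)) (cesaro n (J y)) < e"
        using near[of m] near[of n] M[OF mn]
          dist_triangle[of "cesaro m (J y)" "cesaro n (J y)" "cesaro m (P (J z))"]
          dist_triangle[of "cesaro m (P (J z))" "cesaro n (J y)" "cesaro n (P (J z))"]
          norm_minus_commute[of "cesaro n (P (J z))" "cesaro n (J y)"]
        unfolding dist_norm by linarith
    qed
  qed
  then show ?thesis by (intro range_P_if_convergent) (simp add: Cauchy_convergent_iff)
qed

end

theorem theorem4p1:
  fixes T :: "real \<Rightarrow> 'a::complex_banach \<Rightarrow> 'a"
    and A :: "'a operator"
    and \<alpha> \<omega> \<theta> :: real
  assumes semigroup: "C0_semigroup T"
    and gen: "A = generator T"
    and alpha: "\<alpha> > 0"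
    and omega: "ereal \<omega> > max (growth_bound T + 3) 3"
    and theta: "admissible A \<omega> \<theta>"
    and iZ: "\<forall>k::int. \<i> * of_int k \<in> resolvent_set A"
  shows
    "let X\<alpha> = X_space A \<omega> \<theta> \<alpha>;
         N\<alpha> = X_norm A \<omega> \<theta> \<alpha>;
         R = (\<lambda>k::int. resolvent A (\<i> * of_int k));
         cond1 = (X\<alpha> \<subseteq> range (\<lambda>x. x - T (2 * pi) x));
         cond2 = (\<forall>x\<in>X\<alpha>. C1_summable (\<lambda>k. R k x));
         mult_Lp = (\<lambda>p::real. multiplier R X\<alpha> N\<alpha> p (Lp_space UNIV norm p) (Lp_norm norm p));
         cond3_some = (\<exists>p\<ge>1. mult_Lp p);
         cond3_all = (\<forall>p\<ge>1. mult_Lp p);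
         cond4 = (\<exists>F q. quasi_normed_function_lattice F q \<and>
                    multiplier R X\<alpha> N\<alpha> 1 (lattice_space F) (lattice_norm q));
         cond5 = (\<exists>K>0. \<forall>x\<in>X\<alpha>. \<forall>x' :: 'a \<Rightarrow> complex. \<forall>\<Phi>.
                    bounded_clinear x' \<and> smooth_check \<Phi> \<longrightarrow>
                    (\<lambda>k. x' (R k x) * \<Phi> k) summable_on UNIV \<and>
                    cmod (\<Sum>\<^sub>\<infinity>k\<in>UNIV. x' (R k x) * \<Phi> k)
                      \<le> K * N\<alpha> x * onorm x' * (\<integral>t. cmod (check_transform \<Phi> t) \<partial>circle))
     in (cond1 \<longleftrightarrow> cond2) \<and> (cond1 \<longleftrightarrow> cond3_some) \<and> (cond1 \<longleftrightarrow> cond3_all) \<and>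
        (cond1 \<longleftrightarrow> cond4) \<and> (cond1 \<longleftrightarrow> cond5)"
proof -
  have growth: "growth_bound T < \<infinity>"
    using omega by (cases "growth_bound T") auto
  interpret fractional_semigroup T \<alpha> \<omega> \<theta>
    using semigroup growth alpha theta iZ unfolding gen by unfold_locales auto
  have rangeP: "range (\<lambda>x. x - T (2 * pi) x) = range P" by (simp add: P_def)
  have 12: "range J \<subseteq> range P \<longleftrightarrow> (\<forall>x\<in>range J. C1_summable (\<lambda>k. R k x))"
    unfolding C1_summable_iff using cesaro_convergentI range_P_if_convergent by blast
  have 13: "\<forall>p\<ge>1. multiplier R (range J) X_nrm p (Lp_space UNIV norm p) (Lp_norm norm p)"
    if "range J \<subseteq> range P"
    using bounded_inverse[OF that] multiplier_Lp_of_inverse by metis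
  have 31: "range J \<subseteq> range P"
    if "p \<ge> 1" "multiplier R (range J) X_nrm p (Lp_space UNIV norm p) (Lp_norm norm p)" for p
    using range_P_if_multiplier[OF Lp_lattice[OF that(1)] that(1)] that(2)
    by (auto simp: Lp_space_lattice Lp_norm_lattice)
  \<comment> \<open>The lattice \<open>L_1\<close> itself serves as witness.\<close>
  have 14: "\<exists>F q. quasi_normed_function_lattice F q \<and>
      multiplier R (range J) X_nrm 1 (lattice_space F) (lattice_norm q)" if "range J \<subseteq> range P"
    using 13[OF that] Lp_lattice[of 1] Lp_space_lattice[of 1] Lp_norm_lattice[of 1] by (metis order_refl)
  have 41: "range J \<subseteq> range P" if "quasi_normed_function_lattice F q"
    "multiplier R (range J) X_nrm 1 (lattice_space F) (lattice_norm q)" for F q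
    using range_P_if_multiplier[OF that(1) _ that(2)] by auto
  have 15: "(\<exists>K>0. \<forall>x\<in>range J. \<forall>x' :: 'a \<Rightarrow> complex. \<forall>\<Phi>. bounded_clinear x' \<and> smooth_check \<Phi> \<longrightarrow>
      (\<lambda>k. x' (R k x) * \<Phi> k) summable_on UNIV \<and>
      cmod (\<Sum>\<^sub>\<infinity>k\<in>UNIV. x' (R k x) * \<Phi> k) \<le> K * X_nrm x * onorm x' * (\<integral>t. cmod (check_transform \<Phi> t) \<partial>circle))
    \<longleftrightarrow> range J \<subseteq> range P"
  proof
    assume "range J \<subseteq> range P"
    from weak_estimate[OF this] show "\<exists>K>0. \<forall>x\<in>range J. \<forall>x' :: 'a \<Rightarrow> complex. \<forall>\<Phi>. bounded_clinear x' \<and> smooth_check \<Phi> \<longrightarrow>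
      (\<lambda>k. x' (R k x) * \<Phi> k) summable_on UNIV \<and>
      cmod (\<Sum>\<^sub>\<infinity>k\<in>UNIV. x' (R k x) * \<Phi> k) \<le> K * X_nrm x * onorm x' * (\<integral>t. cmod (check_transform \<Phi> t) \<partial>circle)"
      by simp
  next
    assume "\<exists>K>0. \<forall>x\<in>range J. \<forall>x' :: 'a \<Rightarrow> complex. \<forall>\<Phi>. bounded_clinear x' \<and> smooth_check \<Phi> \<longrightarrow>
      (\<lambda>k. x' (R k x) * \<Phi> k) summable_on UNIV \<and>
      cmod (\<Sum>\<^sub>\<infinity>k\<in>UNIV. x' (R k x) * \<Phi> k) \<le> K * X_nrm x * onorm x' * (\<integral>t. cmod (check_transform \<Phi> t) \<partial>circle)"
    then obtain K where K: "K > 0" "\<And>y (x' :: 'a \<Rightarrow> complex) \<Phi>. bounded_clinear x' \<Longrightarrow> smooth_check \<Phi> \<Longrightarrow>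
      cmod (\<Sum>\<^sub>\<infinity>k\<in>UNIV. x' (R k (J y)) * \<Phi> k) \<le> K * X_nrm (J y) * onorm x' * (\<integral>t. cmod (check_transform \<Phi> t) \<partial>circle)"
      by blast
    show "range J \<subseteq> range P"
      using range_P_if_weak_estimate[OF K(1) K(2)[unfolded X_norm_J]] by blast
  qed
  have 3: "range J \<subseteq> range P \<longleftrightarrow> (\<exists>p\<ge>1. multiplier R (range J) X_nrm p (Lp_space UNIV norm p) (Lp_norm norm p))"
    "range J \<subseteq> range P \<longleftrightarrow> (\<forall>p\<ge>1. multiplier R (range J) X_nrm p (Lp_space UNIV norm p) (Lp_norm norm p))"
    using 13 31 by (blast intro: order_refl)+
  have 4: "range J \<subseteq> range P \<longleftrightarrow> (\<exists>F q. quasi_normed_function_lattice F q \<and>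
      multiplier R (range J) X_nrm 1 (lattice_space F) (lattice_norm q))"
    using 14 41 by blast
  show ?thesis
    unfolding Let_def gen rangeP X_space_eq
    by (intro conjI 12 3 4 15[symmetric])
qed

end
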